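(* Consider the network of $m$ control loops described in the context, and suppose that the schedulers of all $m$ control loops are admissible, i.e. each $\delta^i_k$ depends only on the primitive random variables of its own loop: $\delta^i_k=g(x_0^i,w^i_{0:k-1},v^i_{0:k},a^i_{0:k})$ for a $\{0,1\}$-valued function $g$. Then for every $i\in\{1,\dots,m\}$ the control policy $$u^i_k=K_i\,\mathsf{E}[x_k^i\mid\mathsf{H}_k^i],\qquad k\in\mathbb{N}_0,$$ where $$K_i=-(B_i^{\intercal}P_iB_i+R_i)^{-1}B_i^{\intercal}P_iA_i,\qquad P_i=A_i^{\intercal}P_iA_i+Q_i-K_i^{\intercal}(B_i^{\intercal}P_iB_i+R_i)K_i,$$ is an optimal control policy, in the sense that it minimizes the average quadratic cost $$J^i=\limsup_{T\to\infty}\frac1T\,\mathsf{E}\Big[\sum_{k=0}^{T-1}x_k^{i\intercal}Q_ix_k^i+u_k^{i\intercal}R_iu_k^i\Big]$$ over control policies for loop $i$ in which $u^i_k$ is a function of the information $\mathsf{H}^i_k$ available to the controller.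
   Context: Systems. For $i\in\{1,\dots,m\}$, subsystem $i$ is $x^i_{k+1}=A_ix^i_k+B_iu^i_k+w^i_k$, $y^i_k=C_ix^i_k+v^i_k$, $k\in\mathbb{N}_0$, with $x^i_k\in\mathbb{R}^{n_i}$, $u^i_k\in\mathbb{R}^{m_i}$, $y^i_k\in\mathbb{R}^{o_i}$. The sequences $(w^i_k)_k$ and $(v^i_k)_k$ are i.i.d. zero-mean Gaussian with positive definite covariances $W_i$ and $V_i$. $(A_i,B_i)$ is controllable, $(A_i,C_i)$ is observable, $Q_i\succeq0$, $R_i\succ0$, and $(A_i,Q_i^{1/2})$ is observable. The random variables $x^i_0$, $w^i_k$, $v^i_k$ ($k\in\mathbb{N}_0$), together with the random variables $a^i_k\in\mathbb{R}^{r_i}$ internally generated by scheduler $i$, are called the primitive random variables of loop $i$; they are independent of each other, and the $a^i_k$ are independent of states, inputs and noises of all loops. Different loops are independent. $a_{0:k}$ denotes $(a_0,\dots,a_k)$. $P_i$ denotes the positive definite solution of the displayed algebraic Riccati equation. Network. $\delta^i_k\in\{0,1\}$ equals 1 iff scheduler $i$ attempts a transmission at time $k$. The network is available to user $i$ iff no other user attempts: $\rho^i_k=\prod_{j\ne i}(1-\delta^j_k)$. The attempt succeeds iff $\sigma^i_k:=\rho^i_k\delta^i_k=1$; otherwise the data are lost, with no retransmission. There are no transmission delays. Information. The scheduler of loop $i$ knows $\mathsf{L}^i_k=\{\delta^i_\ell,y^i_\ell:0\le\ell\le k-1\}\cup\{\rho^i_\ell:\delta^i_\ell=1,\,0\le\ell\le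 k-1\}\cup\{y^i_k\}$ and runs the stationary Kalman filter $\hat x^i_{k+1|k}=A_i\hat x^i_{k|k}+B_iu^i_k$, $\hat x^i_{k|k}=\hat x^i_{k|k-1}+L_i(y^i_k-C_i\hat x^i_{k|k-1})$, where $L_i=\bar\Theta_iC_i^{\intercal}(C_i\bar\Theta_iC_i^{\intercal}+V_i)^{-1}$, $\bar\Theta_i=A_i\Theta_iA_i^{\intercal}+W_i$, $\Theta_i=\bar\Theta_i-L_i(C_i\bar\Theta_iC_i^{\intercal}+V_i)L_i^{\intercal}$. The initial state $x^i_0$ is zero-mean Gaussian, with $\hat x^i_{0|-1}=0$, such that $\mathsf{E}[(x^i_0-\hat x^i_{0|0})(x^i_0-\hat x^i_{0|0})^{\intercal}\mid\mathsf{L}^i_0]=\Theta_i$ (so $\hat x^i_{k|k}=\mathsf{E}[x^i_k|\mathsf{L}^i_k]$ with error covariance $\Theta_i$ for all $k$). If $\delta^i_k=1$, scheduler $i$ sends $\hat x^i_{k|k}$. The controller of loop $i$ has the information $\mathsf{H}^i_k=\{\hat x^i_{\ell|\ell}:\sigma^i_\ell=1,\,0\le\ell\le k\}\cup\{\sigma^i_\ell:0\le\ell\le k\}$. *)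

theory Defs
  imports "HOL-Probability.Probability" "Jordan_Normal_Form.Gauss_Jordan_Elimination"
begin

no_notation inner (infix "\<bullet>" 70)
no_notation vec_nth (infixl "$" 90)

definition pos_semidef :: "nat \<Rightarrow> real mat \<Rightarrow> bool" where
  "pos_semidef n S \<longleftrightarrow> S \<in> carrier_mat n n \<and> transpose_mat S = S \<and>
     (\<forall>x\<in>carrier_vec n. 0 \<le> x \<bullet> (S *\<^sub>v x))"

definition pos_def :: "nat \<Rightarrow> real mat \<Rightarrow> bool" where
  "pos_def n S \<longleftrightarrow> S \<in> carrier_mat n n \<and> transpose_mat S = S \<and>
     (\<forall>x\<in>carrier_vec n. x \<noteq> 0\<^sub>v n \<longrightarrow> 0 < x \<bullet> (S *\<^sub>v x))"

text \<open>Only meaningful for invertible matrices.\<close>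

definition mat_inv :: "real mat \<Rightarrow> real mat" where
  "mat_inv S = the (mat_inverse S)"

primrec lin_state :: "real mat \<Rightarrow> real mat \<Rightarrow> real vec \<Rightarrow> (nat \<Rightarrow> real vec) \<Rightarrow> nat \<Rightarrow> real vec" where
  "lin_state A B x u 0 = x"
| "lin_state A B x u (Suc k) = A *\<^sub>v lin_state A B x u k + B *\<^sub>v u k"

definition controllable :: "nat \<Rightarrow> nat \<Rightarrow> real mat \<Rightarrow> real mat \<Rightarrow> bool" where
  "controllable n q A B \<longleftrightarrow>
     (\<forall>x\<in>carrier_vec n. \<forall>z\<in>carrier_vec n.
        \<exists>N u. (\<forall>k. u k \<in> carrier_vec q) \<and> lin_state A B x u N = z)"

text \<open>The initial state of the unforced system is determined by its output sequence.\<close>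

definition observable :: "nat \<Rightarrow> real mat \<Rightarrow> real mat \<Rightarrow> bool" where
  "observable n A C \<longleftrightarrow>
     (\<forall>x\<in>carrier_vec n. \<forall>z\<in>carrier_vec n.
        (\<forall>k. C *\<^sub>v ((A ^\<^sub>m k) *\<^sub>v x) = C *\<^sub>v ((A ^\<^sub>m k) *\<^sub>v z)) \<longrightarrow> x = z)"

text \<open>The Borel sigma-algebra of Euclidean n-space, carried by \<^term>\<open>carrier_vec n\<close>.\<close>

definition vec_borel :: "nat \<Rightarrow> real vec measure" where
  "vec_borel n =
     vimage_algebra (carrier_vec n) (\<lambda>v. \<lambda>j\<in>{..<n}. v $ j) (PiM {..<n} (\<lambda>_. borel))"

definition centered_normal :: "real \<Rightarrow> real measure" where
  "centered_normal s =
     (if s = 0 then return borel 0 else density lborel (normal_density 0 (sqrt s)))"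

text \<open>A random vector is zero-mean Gaussian with covariance S iff every linear form c of it
  is normally distributed with mean zero and variance \<open>c \<bullet> S c\<close>.\<close>

definition centered_gaussian :: "'w measure \<Rightarrow> nat \<Rightarrow> real mat \<Rightarrow> ('w \<Rightarrow> real vec) \<Rightarrow> bool" where
  "centered_gaussian M n S X \<longleftrightarrow>
     X \<in> measurable M (vec_borel n) \<and>
     (\<forall>c\<in>carrier_vec n. distr M borel (\<lambda>\<omega>. c \<bullet> X \<omega>) = centered_normal (c \<bullet> (S *\<^sub>v c)))"

definition vec_cond_exp ::
    "'w measure \<Rightarrow> 'w measure \<Rightarrow> nat \<Rightarrow> ('w \<Rightarrow> real vec) \<Rightarrow> 'w \<Rightarrow> real vec" where
  "vec_cond_exp M F n X \<omega> = Matrix.vec n (\<lambda>j. real_cond_exp M F (\<lambda>\<omega>. X \<omega> $ j) \<omega>)"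

record subsystem =
  nx :: nat
  nu :: nat
  ny :: nat
  na :: nat
  mA :: "real mat"
  mB :: "real mat"
  mC :: "real mat"
  mW :: "real mat"
  mV :: "real mat"
  mQ :: "real mat"
  mR :: "real mat"

definition subsystem_ok :: "subsystem \<Rightarrow> bool" where
  "subsystem_ok s \<longleftrightarrow>
     mA s \<in> carrier_mat (nx s) (nx s) \<and>
     mB s \<in> carrier_mat (nx s) (nu s) \<and>
     mC s \<in> carrier_mat (ny s) (nx s) \<and>
     pos_def (nx s) (mW s) \<and> pos_def (ny s) (mV s) \<and>
     pos_semidef (nx s) (mQ s) \<and> pos_def (nu s) (mR s) \<and>
     controllable (nx s) (nu s) (mA s) (mB s) \<and>
     observable (nx s) (mA s) (mC s) \<and>
     (\<exists>S. pos_semidef (nx s) S \<and> S * S = mQ s \<and> observable (nx s) (mA s) S)"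

definition control_weight :: "subsystem \<Rightarrow> real mat \<Rightarrow> real mat" where
  "control_weight s P = transpose_mat (mB s) * P * mB s + mR s"

definition control_gain :: "subsystem \<Rightarrow> real mat \<Rightarrow> real mat" where
  "control_gain s P = - (mat_inv (control_weight s P) * transpose_mat (mB s) * P * mA s)"

definition control_riccati :: "subsystem \<Rightarrow> real mat \<Rightarrow> bool" where
  "control_riccati s P \<longleftrightarrow>
     P = transpose_mat (mA s) * P * mA s + mQ s
         - transpose_mat (control_gain s P) * control_weight s P * control_gain s P"

definition pred_cov :: "subsystem \<Rightarrow> real mat \<Rightarrow> real mat" where
  "pred_cov s \<Theta> = mA s * \<Theta> * transpose_mat (mA s) + mW s"

definition innov_cov :: "subsystem \<Rightarrow> real mat \<Rightarrow> real mat" where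
  "innov_cov s \<Theta> = mC s * pred_cov s \<Theta> * transpose_mat (mC s) + mV s"

definition filter_gain :: "subsystem \<Rightarrow> real mat \<Rightarrow> real mat" where
  "filter_gain s \<Theta> = pred_cov s \<Theta> * transpose_mat (mC s) * mat_inv (innov_cov s \<Theta>)"

definition filter_riccati :: "subsystem \<Rightarrow> real mat \<Rightarrow> bool" where
  "filter_riccati s \<Theta> \<longleftrightarrow>
     \<Theta> = pred_cov s \<Theta> - filter_gain s \<Theta> * innov_cov s \<Theta> * transpose_mat (filter_gain s \<Theta>)"

text \<open>Initial state, process noise, measurement noise and randomization of the scheduler.\<close>

datatype primitive = X0 | Wn nat | Vn nat | An nat

primrec prim_dim :: "subsystem \<Rightarrow> primitive \<Rightarrow> nat" where
  "prim_dim s X0 = nx s"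
| "prim_dim s (Wn k) = nx s"
| "prim_dim s (Vn k) = ny s"
| "prim_dim s (An k) = na s"

text \<open>\<open>\<xi> i p\<close> is the primitive random variable p of loop i. All primitive random variables of
  all loops are mutually independent.\<close>

definition primitives_indep ::
    "'w measure \<Rightarrow> nat \<Rightarrow> (nat \<Rightarrow> subsystem) \<Rightarrow> (nat \<Rightarrow> primitive \<Rightarrow> 'w \<Rightarrow> real vec) \<Rightarrow> bool" where
  "primitives_indep M m S \<xi> \<longleftrightarrow>
     prob_space.indep_vars M (\<lambda>(i, p). vec_borel (prim_dim (S i) p)) (\<lambda>(i, p). \<xi> i p)
       ({1..m} \<times> UNIV)"

text \<open>The scheduler's information at time 0 is the first output \<open>y 0\<close>; since the first
  prediction is zero, the first filtered estimate is the filter gain applied to \<open>y 0\<close>.\<close>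

definition initial_state_ok ::
    "'w measure \<Rightarrow> subsystem \<Rightarrow> real mat \<Rightarrow> (primitive \<Rightarrow> 'w \<Rightarrow> real vec) \<Rightarrow> bool" where
  "initial_state_ok M s \<Theta> \<zeta> \<longleftrightarrow>
     (\<exists>\<Sigma>. pos_semidef (nx s) \<Sigma> \<and> centered_gaussian M (nx s) \<Sigma> (\<zeta> X0)) \<and>
     (let y = (\<lambda>\<omega>. mC s *\<^sub>v \<zeta> X0 \<omega> + \<zeta> (Vn 0) \<omega>);
          e = (\<lambda>\<omega>. \<zeta> X0 \<omega> - filter_gain s \<Theta> *\<^sub>v y \<omega>);
          L0 = vimage_algebra (space M) y (vec_borel (ny s))
      in \<forall>p<nx s. \<forall>q<nx s.
           AE \<omega> in M. real_cond_exp M L0 (\<lambda>\<omega>. e \<omega> $ p * e \<omega> $ q) \<omega> = \<Theta> $$ (p, q))"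

definition noise_ok :: "'w measure \<Rightarrow> subsystem \<Rightarrow> (primitive \<Rightarrow> 'w \<Rightarrow> real vec) \<Rightarrow> bool" where
  "noise_ok M s \<zeta> \<longleftrightarrow>
     (\<forall>k. centered_gaussian M (nx s) (mW s) (\<zeta> (Wn k)) \<and>
          centered_gaussian M (ny s) (mV s) (\<zeta> (Vn k)))"

definition prims_upto :: "nat \<Rightarrow> primitive set" where
  "prims_upto k = {X0} \<union> Wn ` {..<k} \<union> Vn ` {..k} \<union> An ` {..k}"

definition admissible_scheduler ::
    "'w measure \<Rightarrow> subsystem \<Rightarrow> (primitive \<Rightarrow> 'w \<Rightarrow> real vec) \<Rightarrow> (nat \<Rightarrow> 'w \<Rightarrow> nat) \<Rightarrow> bool" where
  "admissible_scheduler M s \<zeta> d \<longleftrightarrow>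
     (\<forall>k. \<exists>g \<in> measurable (PiM (prims_upto k) (\<lambda>p. vec_borel (prim_dim s p))) (count_space {0, 1}).
        \<forall>\<omega>\<in>space M. d k \<omega> = g (\<lambda>p\<in>prims_upto k. \<zeta> p \<omega>))"

definition available :: "nat \<Rightarrow> (nat \<Rightarrow> nat \<Rightarrow> 'w \<Rightarrow> nat) \<Rightarrow> nat \<Rightarrow> nat \<Rightarrow> 'w \<Rightarrow> nat" where
  "available m \<delta> i k \<omega> = (\<Prod>j\<in>{1..m} - {i}. 1 - \<delta> j k \<omega>)"

definition success :: "nat \<Rightarrow> (nat \<Rightarrow> nat \<Rightarrow> 'w \<Rightarrow> nat) \<Rightarrow> nat \<Rightarrow> nat \<Rightarrow> 'w \<Rightarrow> nat" where
  "success m \<delta> i k \<omega> = available m \<delta> i k \<omega> * \<delta> i k \<omega>"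

text \<open>Signals of one loop with primitive variables \<open>\<zeta>\<close> when \<open>u k \<omega>\<close> is the input applied at
  time k; L is the filter gain.\<close>

primrec state ::
    "subsystem \<Rightarrow> (primitive \<Rightarrow> 'w \<Rightarrow> real vec) \<Rightarrow> (nat \<Rightarrow> 'w \<Rightarrow> real vec) \<Rightarrow> nat \<Rightarrow> 'w \<Rightarrow> real vec"
where
  "state s \<zeta> u 0 \<omega> = \<zeta> X0 \<omega>"
| "state s \<zeta> u (Suc k) \<omega> = mA s *\<^sub>v state s \<zeta> u k \<omega> + mB s *\<^sub>v u k \<omega> + \<zeta> (Wn k) \<omega>"

definition measured ::
    "subsystem \<Rightarrow> (primitive \<Rightarrow> 'w \<Rightarrow> real vec) \<Rightarrow> (nat \<Rightarrow> 'w \<Rightarrow> real vec) \<Rightarrow> nat \<Rightarrow> 'w \<Rightarrow> real vec"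
where
  "measured s \<zeta> u k \<omega> = mC s *\<^sub>v state s \<zeta> u k \<omega> + \<zeta> (Vn k) \<omega>"

definition filter_update :: "subsystem \<Rightarrow> real mat \<Rightarrow> real vec \<Rightarrow> real vec \<Rightarrow> real vec" where
  "filter_update s L xp y = xp + L *\<^sub>v (y - mC s *\<^sub>v xp)"

primrec predicted ::
    "subsystem \<Rightarrow> real mat \<Rightarrow> (primitive \<Rightarrow> 'w \<Rightarrow> real vec) \<Rightarrow> (nat \<Rightarrow> 'w \<Rightarrow> real vec) \<Rightarrow>
      nat \<Rightarrow> 'w \<Rightarrow> real vec"
where
  "predicted s L \<zeta> u 0 \<omega> = 0\<^sub>v (nx s)"
| "predicted s L \<zeta> u (Suc k) \<omega> =
     mA s *\<^sub>v filter_update s L (predicted s L \<zeta> u k \<omega>) (measured s \<zeta> u k \<omega>) + mB s *\<^sub>v u k \<omega>"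

definition filtered ::
    "subsystem \<Rightarrow> real mat \<Rightarrow> (primitive \<Rightarrow> 'w \<Rightarrow> real vec) \<Rightarrow> (nat \<Rightarrow> 'w \<Rightarrow> real vec) \<Rightarrow>
      nat \<Rightarrow> 'w \<Rightarrow> real vec"
where
  "filtered s L \<zeta> u k \<omega> = filter_update s L (predicted s L \<zeta> u k \<omega>) (measured s \<zeta> u k \<omega>)"

text \<open>The controller's information at time k: for every \<open>l \<le> k\<close> the success indicator and, in
  case of success, the filtered estimate; a lost packet is represented by the constant zero
  vector, which carries no information beyond the indicator.\<close>

definition history ::
    "subsystem \<Rightarrow> real mat \<Rightarrow> (primitive \<Rightarrow> 'w \<Rightarrow> real vec) \<Rightarrow> (nat \<Rightarrow> 'w \<Rightarrow> nat) \<Rightarrow>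
      (nat \<Rightarrow> 'w \<Rightarrow> real vec) \<Rightarrow> nat \<Rightarrow> 'w \<Rightarrow> nat \<Rightarrow> nat \<times> real vec"
where
  "history s L \<zeta> \<sigma> u k \<omega> =
     (\<lambda>l\<in>{..k}. (\<sigma> l \<omega>, if \<sigma> l \<omega> = 1 then filtered s L \<zeta> u l \<omega> else 0\<^sub>v (nx s)))"

definition history_space :: "subsystem \<Rightarrow> nat \<Rightarrow> (nat \<Rightarrow> nat \<times> real vec) measure" where
  "history_space s k = PiM {..k} (\<lambda>_. count_space UNIV \<Otimes>\<^sub>M vec_borel (nx s))"

definition info_algebra ::
    "'w measure \<Rightarrow> subsystem \<Rightarrow> real mat \<Rightarrow> (primitive \<Rightarrow> 'w \<Rightarrow> real vec) \<Rightarrow> (nat \<Rightarrow> 'w \<Rightarrow> nat) \<Rightarrow>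
      (nat \<Rightarrow> 'w \<Rightarrow> real vec) \<Rightarrow> nat \<Rightarrow> 'w measure"
where
  "info_algebra M s L \<zeta> \<sigma> u k =
     vimage_algebra (space M) (history s L \<zeta> \<sigma> u k) (history_space s k)"

definition policies :: "subsystem \<Rightarrow> (nat \<Rightarrow> (nat \<Rightarrow> nat \<times> real vec) \<Rightarrow> real vec) set" where
  "policies s = {\<gamma>. \<forall>k. \<gamma> k \<in> measurable (history_space s k) (vec_borel (nu s))}"

text \<open>The closed-loop input process of a policy. As \<^term>\<open>history s L \<zeta> \<sigma> u k\<close> involves only the
  inputs before time k, it satisfies \<open>u k \<omega> = \<gamma> k (history s L \<zeta> \<sigma> u k \<omega>)\<close>; the recursion
  determines the inputs one time step after the other, starting from an irrelevant process.\<close>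

primrec inputs_before ::
    "subsystem \<Rightarrow> real mat \<Rightarrow> (primitive \<Rightarrow> 'w \<Rightarrow> real vec) \<Rightarrow> (nat \<Rightarrow> 'w \<Rightarrow> nat) \<Rightarrow>
      (nat \<Rightarrow> (nat \<Rightarrow> nat \<times> real vec) \<Rightarrow> real vec) \<Rightarrow> nat \<Rightarrow> nat \<Rightarrow> 'w \<Rightarrow> real vec"
where
  "inputs_before s L \<zeta> \<sigma> \<gamma> 0 = (\<lambda>_ _. 0\<^sub>v (nu s))"
| "inputs_before s L \<zeta> \<sigma> \<gamma> (Suc k) =
     (inputs_before s L \<zeta> \<sigma> \<gamma> k)
       (k := \<lambda>\<omega>. \<gamma> k (history s L \<zeta> \<sigma> (inputs_before s L \<zeta> \<sigma> \<gamma> k) k \<omega>))"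

definition input ::
    "subsystem \<Rightarrow> real mat \<Rightarrow> (primitive \<Rightarrow> 'w \<Rightarrow> real vec) \<Rightarrow> (nat \<Rightarrow> 'w \<Rightarrow> nat) \<Rightarrow>
      (nat \<Rightarrow> (nat \<Rightarrow> nat \<times> real vec) \<Rightarrow> real vec) \<Rightarrow> nat \<Rightarrow> 'w \<Rightarrow> real vec"
where
  "input s L \<zeta> \<sigma> \<gamma> k = inputs_before s L \<zeta> \<sigma> \<gamma> (Suc k) k"

lemma measured_cong:
  assumes "\<And>l. l < k \<Longrightarrow> u l \<omega> = u' l \<omega>"
  shows "state s \<zeta> u k \<omega> = state s \<zeta> u' k \<omega>"
    and "measured s \<zeta> u k \<omega> = measured s \<zeta> u' k \<omega>"
proof -
  show "state s \<zeta> u k \<omega> = state s \<zeta> u' k \<omega>"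
    using assms by (induction k) auto
  then show "measured s \<zeta> u k \<omega> = measured s \<zeta> u' k \<omega>"
    by (simp add: measured_def)
qed

lemma predicted_cong:
  assumes "\<And>l. l < k \<Longrightarrow> u l \<omega> = u' l \<omega>"
  shows "predicted s L \<zeta> u k \<omega> = predicted s L \<zeta> u' k \<omega>"
  using assms
proof (induction k)
  case (Suc k)
  then have "predicted s L \<zeta> u k \<omega> = predicted s L \<zeta> u' k \<omega>"
    "measured s \<zeta> u k \<omega> = measured s \<zeta> u' k \<omega>"
    by (auto intro!: measured_cong(2))
  with Suc.prems show ?case by simp
qed simp

lemma history_cong:
  assumes "\<And>l. l < k \<Longrightarrow> u l \<omega> = u' l \<omega>"
  shows "history s L \<zeta> \<sigma> u k \<omega> = history s L \<zeta> \<sigma> u' k \<omega>"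
proof -
  have "filtered s L \<zeta> u l \<omega> = filtered s L \<zeta> u' l \<omega>" if "l \<le> k" for l
  proof -
    have "predicted s L \<zeta> u l \<omega> = predicted s L \<zeta> u' l \<omega>"
      "measured s \<zeta> u l \<omega> = measured s \<zeta> u' l \<omega>"
      using assms that by (auto intro!: predicted_cong measured_cong(2))
    then show ?thesis by (simp add: filtered_def)
  qed
  then show ?thesis
    unfolding history_def by (intro restrict_ext) simp
qed

lemma inputs_before_eq:
  "l < k \<Longrightarrow> inputs_before s L \<zeta> \<sigma> \<gamma> k l = input s L \<zeta> \<sigma> \<gamma> l"
  by (induction k) (auto simp: input_def less_Suc_eq)

lemma input_eq:
  "input s L \<zeta> \<sigma> \<gamma> k \<omega> = \<gamma> k (history s L \<zeta> \<sigma> (input s L \<zeta> \<sigma> \<gamma>) k \<omega>)"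
proof -
  have "history s L \<zeta> \<sigma> (inputs_before s L \<zeta> \<sigma> \<gamma> k) k \<omega> = history s L \<zeta> \<sigma> (input s L \<zeta> \<sigma> \<gamma>) k \<omega>"
    by (intro history_cong) (simp add: inputs_before_eq)
  then show ?thesis by (simp add: input_def)
qed

definition certainty_equivalent ::
    "'w measure \<Rightarrow> subsystem \<Rightarrow> real mat \<Rightarrow> (primitive \<Rightarrow> 'w \<Rightarrow> real vec) \<Rightarrow> (nat \<Rightarrow> 'w \<Rightarrow> nat) \<Rightarrow>
      real mat \<Rightarrow> (nat \<Rightarrow> (nat \<Rightarrow> nat \<times> real vec) \<Rightarrow> real vec) \<Rightarrow> bool"
where
  "certainty_equivalent M s L \<zeta> \<sigma> K \<gamma> \<longleftrightarrow>
     (let u = input s L \<zeta> \<sigma> \<gamma> in \<forall>k. AE \<omega> in M.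
        u k \<omega> = K *\<^sub>v vec_cond_exp M (info_algebra M s L \<zeta> \<sigma> u k) (nx s) (state s \<zeta> u k) \<omega>)"

text \<open>The stage costs are nonnegative, so the expectation always exists in \<open>[0, \<infinity>]\<close>.\<close>

definition average_cost ::
    "'w measure \<Rightarrow> subsystem \<Rightarrow> (primitive \<Rightarrow> 'w \<Rightarrow> real vec) \<Rightarrow> (nat \<Rightarrow> 'w \<Rightarrow> real vec) \<Rightarrow> ennreal"
where
  "average_cost M s \<zeta> u =
     limsup (\<lambda>T. ennreal (1 / real T) *
       (\<integral>\<^sup>+\<omega>. ennreal (\<Sum>k<T. state s \<zeta> u k \<omega> \<bullet> (mQ s *\<^sub>v state s \<zeta> u k \<omega>)
                              + u k \<omega> \<bullet> (mR s *\<^sub>v u k \<omega>)) \<partial>M))"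

definition optimal_policy ::
    "'w measure \<Rightarrow> subsystem \<Rightarrow> real mat \<Rightarrow> (primitive \<Rightarrow> 'w \<Rightarrow> real vec) \<Rightarrow> (nat \<Rightarrow> 'w \<Rightarrow> nat) \<Rightarrow>
      (nat \<Rightarrow> (nat \<Rightarrow> nat \<times> real vec) \<Rightarrow> real vec) \<Rightarrow> bool"
where
  "optimal_policy M s L \<zeta> \<sigma> \<gamma> \<longleftrightarrow>
     \<gamma> \<in> policies s \<and>
     (\<forall>\<gamma>'\<in>policies s.
        average_cost M s \<zeta> (input s L \<zeta> \<sigma> \<gamma>) \<le> average_cost M s \<zeta> (input s L \<zeta> \<sigma> \<gamma>'))"

end

theory Submission
  imports Defs "Jordan_Normal_Form.Determinant" "HOL-Real_Asymp.Real_Asymp"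
begin

text \<open>
  The state is the sum of the state of the loop without inputs and a vector that is a known linear
  function of the inputs, and the Kalman estimates split alike. Hence the controller's information
  generates the same sigma-algebra \<open>F k\<close> for every policy, and the estimation error \<open>e k\<close> does not
  depend on the policy. An admissible scheduler is blind to the inputs, so the process noise at time
  k is independent of everything that determines the input at time k. Completing the square with
  the Riccati solution P, whose gain and weight are K and W, therefore gives for square integrable
  inputs
  \<open>E cost(T) + E (x T \<bullet> P x T) = c T + (\<Sum>k<T. E (d k \<bullet> W d k))\<close>,
  where \<open>d k = u k - K E[x k | F k]\<close> and \<open>c T\<close> depends only on the noises and the errors \<open>e k\<close>.
  The certainty equivalent policy has \<open>d = 0\<close>, so its cost is at most the limit superior of \<open>c T / T\<close>.
  For the converse one has to control the terminal term of an arbitrary policy: by observability it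
  is bounded by the costs and the noise of the next few steps, so for finite average cost it is
  small compared with T at some time in each window of length about \<open>sqrt T\<close>, and as c is monotone
  this suffices.
\<close>

section \<open>Positive definite matrices\<close>

text \<open>The terminal term cannot simply be dropped: an arbitrary policy may have a huge state at
  particular times, and the limit superior sees every T. The window length \<open>sqrt T\<close> is
  a compromise. Averaging over l indices yields a terminal term of order T / l, so l must tend to
  infinity, while comparing quantities at indices up to l apart requires l / T to vanish. Two
  further obstacles shape the proof. The certainty equivalent law is circular, since the inputs
  determine the information that defines the conditional mean. Because \<open>F k\<close> is known
  beforehand, the law is solved recursively from the estimate of the loop without inputs, and
  factorization through the history turns the solution into a policy. Moreover, an arbitrary policy
  need not have second moments; then positive definiteness of R forces the expected cost to be
  infinite from some horizon on. Independence enters through one orthogonality relation: the noise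
  of time k against functions of all other primitive variables of all loops, future ones included.
  The sigma-algebras \<open>G k\<close> are therefore not increasing in k.\<close>

lemma pos_def_imp_pos_semidef: "pos_def n S \<Longrightarrow> pos_semidef n S"
  unfolding pos_def_def pos_semidef_def
  by (metis less_eq_real_def scalar_prod_left_zero mult_mat_vec_carrier)

lemma pos_semidefD:
  assumes "pos_semidef n S"
  shows "S \<in> carrier_mat n n" "transpose_mat S = S"
    "x \<in> carrier_vec n \<Longrightarrow> 0 \<le> x \<bullet> (S *\<^sub>v x)"
  using assms by (auto simp: pos_semidef_def)

lemma scalar_prod_symmetric_mat:
  fixes S :: "real mat"
  assumes "S \<in> carrier_mat n n" "transpose_mat S = S" "x \<in> carrier_vec n" "y \<in> carrier_vec n"
  shows "x \<bullet> (S *\<^sub>v y) = y \<bullet> (S *\<^sub>v x)"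
proof -
  have "x \<bullet> (S *\<^sub>v y) = (transpose_mat S *\<^sub>v x) \<bullet> y"
    using assms by (intro transpose_vec_mult_scalar[symmetric]) auto
  also have "\<dots> = y \<bullet> (S *\<^sub>v x)"
    using assms by (subst comm_scalar_prod[of _ n]) auto
  finally show ?thesis .
qed

lemma scalar_prod_transpose_mult_mult:
  fixes A P :: "real mat"
  assumes "A \<in> carrier_mat k n" "P \<in> carrier_mat k k" "x \<in> carrier_vec n" "y \<in> carrier_vec n"
  shows "x \<bullet> ((transpose_mat A * P * A) *\<^sub>v y) = (A *\<^sub>v x) \<bullet> (P *\<^sub>v (A *\<^sub>v y))"
proof -
  have "(transpose_mat A * P * A) *\<^sub>v y = transpose_mat A *\<^sub>v (P *\<^sub>v (A *\<^sub>v y))"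
    using assms by (simp add: assoc_mult_mat_vec[of _ n k] del: assoc_mult_mat)
  then have "x \<bullet> ((transpose_mat A * P * A) *\<^sub>v y) = (transpose_mat A *\<^sub>v (P *\<^sub>v (A *\<^sub>v y))) \<bullet> x"
    using assms by (subst comm_scalar_prod[of _ n]) auto
  also have "\<dots> = (P *\<^sub>v (A *\<^sub>v y)) \<bullet> (A *\<^sub>v x)"
    using assms by (intro transpose_vec_mult_scalar) auto
  also have "\<dots> = (A *\<^sub>v x) \<bullet> (P *\<^sub>v (A *\<^sub>v y))"
    using assms by (subst comm_scalar_prod[of _ k]) auto
  finally show ?thesis .
qed

lemma transpose_mult_mult_carrier:
  "A \<in> carrier_mat k n \<Longrightarrow> P \<in> carrier_mat k k \<Longrightarrow> transpose_mat A * P * A \<in> carrier_mat n n"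
  by auto

lemma pos_semidef_congruence:
  assumes "pos_semidef k P" "A \<in> carrier_mat k n"
  shows "pos_semidef n (transpose_mat A * P * A)"
proof -
  note P = pos_semidefD[OF assms(1)]
  have "transpose_mat (transpose_mat A * P * A) = transpose_mat A * P * A"
    using P assms(2) by (simp add: transpose_mult[of _ _ _] transpose_mult[of _ n k _ n] assoc_mult_mat[of _ n k _ k _ n]
        transpose_mult[of _ n k _ k])
  then show ?thesis
    using P assms(2) by (auto simp: pos_semidef_def scalar_prod_transpose_mult_mult simp del: assoc_mult_mat)
qed

lemma pos_def_add_pos_semidef:
  assumes "pos_semidef n S" "pos_def n T"
  shows "pos_def n (S + T)"
proof -
  have *: "S \<in> carrier_mat n n" "T \<in> carrier_mat n n"
    using assms by (auto simp: pos_semidef_def pos_def_def)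
  moreover have "transpose_mat (S + T) = S + T"
    using assms * by (simp add: transpose_add pos_semidef_def pos_def_def)
  moreover have "0 < x \<bullet> ((S + T) *\<^sub>v x)" if "x \<in> carrier_vec n" "x \<noteq> 0\<^sub>v n" for x
  proof -
    have "x \<bullet> ((S + T) *\<^sub>v x) = x \<bullet> (S *\<^sub>v x) + x \<bullet> (T *\<^sub>v x)"
      using * that by (simp add: add_mult_distrib_mat_vec[of _ n n] scalar_prod_add_distrib[of _ n])
    then show ?thesis
      using assms that by (auto simp: pos_semidef_def pos_def_def intro!: add_nonneg_pos)
  qed
  ultimately show ?thesis
    by (simp add: pos_def_def)
qed

text \<open>A kernel vector v would give \<open>v \<bullet> (S *\<^sub>v v) = 0\<close>, so the
  determinant is nonzero and \<open>mat_inverse\<close> returns a proper inverse. Only then does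
  \<open>mat_inv\<close>, defined with \<open>the\<close>, have a meaning.\<close>

lemma pos_def_mat_inv:
  assumes "pos_def n S"
  shows "mat_inv S \<in> carrier_mat n n" "S * mat_inv S = 1\<^sub>m n"
proof -
  have S: "S \<in> carrier_mat n n"
    using assms by (simp add: pos_def_def)
  have "Determinant.det S \<noteq> 0"
  proof
    assume "Determinant.det S = 0"
    then obtain v where v: "v \<in> carrier_vec n" "v \<noteq> 0\<^sub>v n" "S *\<^sub>v v = 0\<^sub>v n"
      using det_0_iff_vec_prod_zero_field[OF S] by auto
    then have "v \<bullet> (S *\<^sub>v v) = 0" by simp
    then show False
      using assms v unfolding pos_def_def by (metis less_irrefl)
  qed
  then have "S \<in> Units (ring_mat TYPE(real) n ())"
    by (rule det_non_zero_imp_unit[OF S])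
  then obtain B where "mat_inverse S = Some B"
    using mat_inverse(1)[OF S] by fastforce
  then show "mat_inv S \<in> carrier_mat n n" "S * mat_inv S = 1\<^sub>m n"
    using mat_inverse(2)[OF S] by (auto simp: mat_inv_def)
qed

lemma scalar_prod_mult_mat_vec_sum:
  fixes G :: "real mat"
  assumes "G \<in> carrier_mat k n" "x \<in> carrier_vec k" "y \<in> carrier_vec n"
  shows "x \<bullet> (G *\<^sub>v y) = (\<Sum>a<k. \<Sum>b<n. x $ a * (G $$ (a, b) * y $ b))"
  using assms
  by (simp add: scalar_prod_def mult_mat_vec_def sum_distrib_left atLeast0LessThan)

text \<open>Compactness of the unit sphere does two jobs: it selects finitely many forms without a
  common zero on the sphere, and it gives their sum a positive minimum there. For the observability
  forms this takes the place of a dimension count by Cayley-Hamilton.\<close>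

lemma quadratic_forms_lower_bound:
  fixes G :: "nat \<Rightarrow> real mat"
  assumes G: "\<And>j. pos_semidef n (G j)"
    and inj: "\<And>x. x \<in> carrier_vec n \<Longrightarrow> (\<And>j. x \<bullet> (G j *\<^sub>v x) = 0) \<Longrightarrow> x = 0\<^sub>v n"
  obtains N \<epsilon> where "0 < \<epsilon>"
    "\<And>x. x \<in> carrier_vec n \<Longrightarrow> \<epsilon> * (x \<bullet> x) \<le> (\<Sum>j\<le>N. x \<bullet> (G j *\<^sub>v x))"
proof -
  define q where "q j f = (\<Sum>a<n. \<Sum>b<n. f a * (G j $$ (a, b) * f b))" for j and f :: "nat \<Rightarrow> real"
  have q_eq: "q j f = vec n f \<bullet> (G j *\<^sub>v vec n f)" for j f
    using pos_semidefD(1)[OF G[of j]]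
    by (subst scalar_prod_mult_mat_vec_sum) (auto simp: q_def)
  have q_nonneg: "0 \<le> q j f" for j f
    unfolding q_eq using pos_semidefD(3)[OF G] by simp
  have cont_q: "continuous_on UNIV (q j)" for j
    unfolding q_def by (intro continuous_intros) auto
  \<comment> \<open>Vectors are represented by functions on all natural numbers, where the product
    topology and Tychonoff's theorem are at hand. \<open>C\<close> leaves the coordinates from n on
    free; the box \<open>B\<close> sets them to zero, so that the intersection is a compact copy of
    the sphere.\<close>
  define C where "C = {f :: nat \<Rightarrow> real. (\<Sum>a<n. (f a)\<^sup>2) = 1}"
  define B where "B = PiE UNIV (\<lambda>a. if a < n then {-1..1::real} else {0})"
  have "compact B"
  proof -
    have "compactin (product_topology (\<lambda>i. euclidean) UNIV) B"
      unfolding B_def compactin_PiE by (auto simp: compactin_euclidean_iff)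
    then show ?thesis
      by (simp add: euclidean_product_topology compactin_euclidean_iff)
  qed
  moreover have "closed C"
  proof -
    have "closed ((\<lambda>f. \<Sum>a<n. (f a)\<^sup>2) -` {1::real} :: (nat \<Rightarrow> real) set)"
      by (intro closed_vimage continuous_intros) auto
    then show ?thesis by (simp add: C_def vimage_def)
  qed
  ultimately have K: "compact (B \<inter> C)" by (rule compact_Int_closed)
  have pos: "\<exists>j. 0 < q j f" if "f \<in> C" for f
  proof (rule ccontr)
    assume "\<not> ?thesis"
    then have "q j f = 0" for j
      using q_nonneg[of j f] by (meson not_less order_antisym)
    then have "vec n f = 0\<^sub>v n"
      by (intro inj) (auto simp: q_eq)
    then have "f a = 0" if "a < n" for a
      using that by (metis index_vec index_zero_vec(1))
    then show False
      using that by (simp add: C_def)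
  qed
  have "B \<inter> C \<subseteq> (\<Union>j. {f. 0 < q j f})"
    using pos by auto
  moreover have "open {f. 0 < q j f}" for j
    using cont_q by (intro open_Collect_less) auto
  ultimately obtain J where J: "finite J" "B \<inter> C \<subseteq> (\<Union>j\<in>J. {f. 0 < q j f})"
    using compactE_image[OF K, of UNIV "\<lambda>j. {f. 0 < q j f}"] by metis
  obtain N where N: "J \<subseteq> {..N}"
    using J(1) by (meson finite_nat_iff_bounded_le)
  define Q where "Q f = (\<Sum>j\<le>N. q j f)" for f
  have Q_pos: "0 < Q f" if f: "f \<in> B \<inter> C" for f
  proof -
    obtain j where "j \<in> J" "0 < q j f" using J(2) f by blast
    then show ?thesis
      unfolding Q_def using N by (intro sum_pos2[of _ j]) (auto intro: q_nonneg)
  qed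
  have cont_Q: "continuous_on (B \<inter> C) Q"
    unfolding Q_def using cont_q by (intro continuous_on_sum) (auto intro: continuous_on_subset)
  obtain \<epsilon> where \<epsilon>: "0 < \<epsilon>" "\<And>f. f \<in> B \<inter> C \<Longrightarrow> \<epsilon> \<le> Q f"
  \<comment> \<open>For \<open>n = 0\<close> the sphere is empty and any positive constant
    serves.\<close>
  proof (cases "B \<inter> C = {}")
    case True
    then show ?thesis by (intro that[of 1]) auto
  next
    case False
    then obtain g where "g \<in> B \<inter> C" "\<And>f. f \<in> B \<inter> C \<Longrightarrow> Q g \<le> Q f"
      using continuous_attains_inf[OF K _ cont_Q] by auto
    then show ?thesis using Q_pos by (intro that[of "Q g"]) auto
  qed
  show thesis
  proof (rule that[of \<epsilon> N])
    show "0 < \<epsilon>" by fact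
    fix x :: "real vec" assume x: "x \<in> carrier_vec n"
    define s where "s = x \<bullet> x"
    have s: "s = (\<Sum>a<n. (x $ a)\<^sup>2)"
      using x by (simp add: s_def scalar_prod_def power2_eq_square atLeast0LessThan)
    show "\<epsilon> * (x \<bullet> x) \<le> (\<Sum>j\<le>N. x \<bullet> (G j *\<^sub>v x))"
    proof (cases "s = 0")
      case True
      then show ?thesis
        using x pos_semidefD(3)[OF G x] by (simp add: s_def sum_nonneg)
    next
      case False
      moreover have "0 \<le> s" unfolding s by (simp add: sum_nonneg)
      ultimately have "0 < s" by simp
      \<comment> \<open>Normalization to the sphere; the forms are homogeneous of degree two, so the
        bound at \<open>f\<close> scales back by the factor \<open>s\<close>.\<close>
      define f where "f a = (if a < n then x $ a / sqrt s else 0)" for a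
      have "f \<in> C"
      proof -
        have "(\<Sum>a<n. (f a)\<^sup>2) = (\<Sum>a<n. (x $ a)\<^sup>2 / s)"
          using \<open>0 < s\<close> by (intro sum.cong) (auto simp: f_def power_divide)
        then show ?thesis
          using \<open>0 < s\<close> by (simp add: C_def flip: sum_divide_distrib s)
      qed
      moreover have "f \<in> B"
      proof -
        have "x $ a \<le> sqrt s \<and> - sqrt s \<le> x $ a" if "a < n" for a
        proof -
          have "(x $ a)\<^sup>2 \<le> s"
            unfolding s using that by (intro member_le_sum) auto
          then have "\<bar>x $ a\<bar> \<le> sqrt s"
            by (metis real_sqrt_abs real_sqrt_le_iff)
          then show ?thesis by auto
        qed
        then show ?thesis
          using \<open>0 < s\<close> by (auto simp: B_def f_def PiE_def extensional_def field_simps)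
      qed
      ultimately have "\<epsilon> \<le> Q f" by (intro \<epsilon>) auto
      moreover have "q j f = (x \<bullet> (G j *\<^sub>v x)) / s" for j
      proof -
        have "q j f = (\<Sum>a<n. \<Sum>b<n. (x $ a * (G j $$ (a, b) * x $ b)) / s)"
          unfolding q_def using \<open>0 < s\<close> by (intro sum.cong) (auto simp: f_def field_simps)
        also have "\<dots> = (\<Sum>a<n. \<Sum>b<n. x $ a * (G j $$ (a, b) * x $ b)) / s"
          by (simp add: sum_divide_distrib)
        also have "\<dots> = (x \<bullet> (G j *\<^sub>v x)) / s"
          using x pos_semidefD(1)[OF G[of j]] by (simp add: scalar_prod_mult_mat_vec_sum)
        finally show ?thesis .
      qed
      ultimately have "\<epsilon> \<le> (\<Sum>j\<le>N. x \<bullet> (G j *\<^sub>v x)) / s"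
        by (simp add: Q_def flip: sum_divide_distrib)
      then show ?thesis
        using \<open>0 < s\<close> by (simp add: field_simps s_def)
    qed
  qed
qed

text \<open>The constant family reduces this to the previous bound; its sum consists of
  \<open>Suc N\<close> equal terms, whence the division of the constant.\<close>

lemma pos_def_lower_bound:
  assumes "pos_def n R"
  obtains \<epsilon> where "0 < \<epsilon>" "\<And>x. x \<in> carrier_vec n \<Longrightarrow> \<epsilon> * (x \<bullet> x) \<le> x \<bullet> (R *\<^sub>v x)"
proof -
  obtain N \<epsilon> where *: "0 < \<epsilon>"
    "\<And>x. x \<in> carrier_vec n \<Longrightarrow> \<epsilon> * (x \<bullet> x) \<le> (\<Sum>j\<le>N::nat. x \<bullet> (R *\<^sub>v x))"
    using assms by (rule_tac quadratic_forms_lower_bound[of n "\<lambda>_. R"])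
      (auto simp: pos_def_imp_pos_semidef, metis less_irrefl pos_def_def)
  show thesis
    using * by (intro that[of "\<epsilon> / real (Suc N)"]) (auto simp: field_simps)
qed

section \<open>Upper bounds for matrices and quadratic forms\<close>

lemma scalar_prod_self_nonneg: "0 \<le> (x :: real vec) \<bullet> x"
  by (simp add: scalar_prod_def sum_nonneg)

text \<open>Cauchy-Schwarz in every row; the constant is the squared Frobenius norm.\<close>

lemma mult_mat_vec_bound:
  fixes A :: "real mat"
  assumes A: "A \<in> carrier_mat k n"
  obtains c where "0 \<le> c" "\<And>x. x \<in> carrier_vec n \<Longrightarrow> (A *\<^sub>v x) \<bullet> (A *\<^sub>v x) \<le> c * (x \<bullet> x)"
proof (rule that)
  let ?c = "\<Sum>a<k. \<Sum>b<n. (A $$ (a, b))\<^sup>2"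
  show "0 \<le> ?c" by (simp add: sum_nonneg)
  fix x :: "real vec" assume x: "x \<in> carrier_vec n"
  have "(A *\<^sub>v x) \<bullet> (A *\<^sub>v x) = (\<Sum>a<k. (\<Sum>b<n. A $$ (a, b) * x $ b)\<^sup>2)"
    using A x by (simp add: scalar_prod_def power2_eq_square atLeast0LessThan)
  also have "\<dots> \<le> (\<Sum>a<k. (\<Sum>b<n. (A $$ (a, b))\<^sup>2) * (\<Sum>b<n. (x $ b)\<^sup>2))"
    by (intro sum_mono Cauchy_Schwarz_ineq_sum)
  also have "\<dots> = ?c * (x \<bullet> x)"
    using x by (simp add: scalar_prod_def power2_eq_square atLeast0LessThan sum_distrib_right)
  finally show "(A *\<^sub>v x) \<bullet> (A *\<^sub>v x) \<le> ?c * (x \<bullet> x)" .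
qed

text \<open>Expanding the nonnegative square of \<open>x - P *\<^sub>v x\<close> bounds the form by
  the mean of \<open>x \<bullet> x\<close> and the squared length of
  \<open>P *\<^sub>v x\<close>.\<close>

lemma quadratic_form_upper_bound:
  fixes P :: "real mat"
  assumes P: "P \<in> carrier_mat n n"
  obtains c where "0 \<le> c" "\<And>x. x \<in> carrier_vec n \<Longrightarrow> x \<bullet> (P *\<^sub>v x) \<le> c * (x \<bullet> x)"
proof -
  obtain c where c: "0 \<le> c" "\<And>x. x \<in> carrier_vec n \<Longrightarrow> (P *\<^sub>v x) \<bullet> (P *\<^sub>v x) \<le> c * (x \<bullet> x)"
    using mult_mat_vec_bound[OF P] by blast
  show thesis
  proof (rule that[of "(1 + c) / 2"])
    fix x :: "real vec" assume x: "x \<in> carrier_vec n"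
    have "0 \<le> (x - P *\<^sub>v x) \<bullet> (x - P *\<^sub>v x)"
      by (rule scalar_prod_self_nonneg)
    also have "\<dots> = x \<bullet> x - 2 * (x \<bullet> (P *\<^sub>v x)) + (P *\<^sub>v x) \<bullet> (P *\<^sub>v x)"
      using x P
      by (simp add: minus_scalar_prod_distrib[of _ n] scalar_prod_minus_distrib[of _ n]
          comm_scalar_prod[of "P *\<^sub>v x" n x])
    also have "\<dots> \<le> (1 + c) * (x \<bullet> x) - 2 * (x \<bullet> (P *\<^sub>v x))"
      using c(2)[OF x] by (simp add: algebra_simps)
    finally show "x \<bullet> (P *\<^sub>v x) \<le> (1 + c) / 2 * (x \<bullet> x)" by simp
  qed (use c in simp)
qed

section \<open>Completion of squares and observability\<close>

lemma subsystem_okD: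
  assumes "subsystem_ok s"
  shows "mA s \<in> carrier_mat (nx s) (nx s)" "mB s \<in> carrier_mat (nx s) (nu s)"
    "mC s \<in> carrier_mat (ny s) (nx s)" "pos_def (nx s) (mW s)" "pos_def (ny s) (mV s)"
    "pos_semidef (nx s) (mQ s)" "pos_def (nu s) (mR s)"
  using assms by (auto simp: subsystem_ok_def)

text \<open>Parallelogram identity for the seminorm of P, with the nonnegative term of
  \<open>x + y\<close> discarded.\<close>

lemma pos_semidef_diff_le:
  assumes P: "pos_semidef n P" and x: "x \<in> carrier_vec n" and y: "y \<in> carrier_vec n"
  shows "(x - y) \<bullet> (P *\<^sub>v (x - y)) \<le> 2 * (x \<bullet> (P *\<^sub>v x)) + 2 * (y \<bullet> (P *\<^sub>v y))"
proof -
  note D = pos_semidefD[OF P]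
  have "0 \<le> (x + y) \<bullet> (P *\<^sub>v (x + y))"
    using x y by (intro D) auto
  also have "\<dots> = x \<bullet> (P *\<^sub>v x) + 2 * (x \<bullet> (P *\<^sub>v y)) + y \<bullet> (P *\<^sub>v y)"
    using x y D(1) scalar_prod_symmetric_mat[OF D(1,2) x y]
    by (simp add: mult_add_distrib_mat_vec[of _ n n] add_scalar_prod_distrib[of _ n]
        scalar_prod_add_distrib[of _ n])
  finally have "- 2 * (x \<bullet> (P *\<^sub>v y)) \<le> x \<bullet> (P *\<^sub>v x) + y \<bullet> (P *\<^sub>v y)"
    by simp
  moreover have "(x - y) \<bullet> (P *\<^sub>v (x - y)) = x \<bullet> (P *\<^sub>v x) - 2 * (x \<bullet> (P *\<^sub>v y)) + y \<bullet> (P *\<^sub>v y)"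
    using x y D(1) scalar_prod_symmetric_mat[OF D(1,2) x y]
    by (simp add: mult_minus_distrib_mat_vec[of _ n n] minus_scalar_prod_distrib[of _ n]
        scalar_prod_minus_distrib[of _ n])
  ultimately show ?thesis by simp
qed

lemma control_weight_pos_def:
  assumes s: "subsystem_ok s" and P: "pos_def (nx s) P"
  shows "pos_def (nu s) (control_weight s P)"
  unfolding control_weight_def
  by (intro pos_def_add_pos_semidef pos_semidef_congruence[of "nx s"] pos_def_imp_pos_semidef P
      subsystem_okD[OF s])

lemma control_gain_carrier:
  assumes s: "subsystem_ok s" and P: "pos_def (nx s) P"
  shows "control_gain s P \<in> carrier_mat (nu s) (nx s)"
  using pos_def_mat_inv(1)[OF control_weight_pos_def[OF assms]] subsystem_okD[OF s]
    pos_semidefD(1)[OF pos_def_imp_pos_semidef[OF P]]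
  unfolding control_gain_def by (intro uminus_carrier_mat mult_carrier_mat) auto

text \<open>The normal equation of the minimization over the input. Together with the Riccati
  equation it is all that completing the square needs to know about the gain, so the inverse
  disappears from the computation.\<close>

lemma control_weight_gain:
  assumes s: "subsystem_ok s" and P: "pos_def (nx s) P"
  shows "control_weight s P * control_gain s P = - (transpose_mat (mB s) * P * mA s)"
proof -
  let ?W = "control_weight s P" and ?D = "transpose_mat (mB s) * P * mA s"
  note I = pos_def_mat_inv[OF control_weight_pos_def[OF assms]]
  have W: "?W \<in> carrier_mat (nu s) (nu s)"
    using control_weight_pos_def[OF assms] by (simp add: pos_def_def)
  note c = subsystem_okD[OF s] pos_semidefD(1)[OF pos_def_imp_pos_semidef[OF P]]
  have D: "?D \<in> carrier_mat (nu s) (nx s)" using c by simp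
  have "control_gain s P = - (mat_inv ?W * ?D)"
    using c I(1) unfolding control_gain_def
    by (simp add: assoc_mult_mat[of _ "nu s" "nu s" _ "nx s"] assoc_mult_mat[of _ "nu s" "nx s" _ "nx s"])
  then have "?W * control_gain s P = - (?W * (mat_inv ?W * ?D))"
    using W I(1) D by simp
  also have "?W * (mat_inv ?W * ?D) = (?W * mat_inv ?W) * ?D"
    using W I(1) D by (intro assoc_mult_mat[symmetric])
  also have "\<dots> = ?D" unfolding I(2) by (rule left_mult_one_mat[OF D])
  finally show ?thesis .
qed

text \<open>The cost-to-go \<open>x \<bullet> P x\<close> turns the stage cost into a square in the deviation of the input
  from the state feedback, up to a cross term that is linear in the noise.\<close>

lemma completing_squares:
  assumes s: "subsystem_ok s" and P: "pos_def (nx s) P" and ric: "control_riccati s P"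
    and x: "x \<in> carrier_vec (nx s)" and u: "u \<in> carrier_vec (nu s)" and w: "w \<in> carrier_vec (nx s)"
  defines "c \<equiv> mA s *\<^sub>v x + mB s *\<^sub>v u" and "v \<equiv> u - control_gain s P *\<^sub>v x"
  shows "x \<bullet> (mQ s *\<^sub>v x) + u \<bullet> (mR s *\<^sub>v u) + (c + w) \<bullet> (P *\<^sub>v (c + w)) =
    x \<bullet> (P *\<^sub>v x) + v \<bullet> (control_weight s P *\<^sub>v v) + w \<bullet> (P *\<^sub>v w) + 2 * (w \<bullet> (P *\<^sub>v c))"
proof -
  let ?n = "nx s" and ?m = "nu s" and ?W = "control_weight s P" and ?K = "control_gain s P"
  let ?A = "mA s" and ?B = "mB s"
  note PD = pos_semidefD[OF pos_def_imp_pos_semidef[OF P]]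
  note WD = pos_semidefD[OF pos_def_imp_pos_semidef[OF control_weight_pos_def[OF s P]]]
  note KD = control_gain_carrier[OF s P]
  note AB = subsystem_okD(1,2)[OF s]
  note R = pos_semidefD(1)[OF pos_def_imp_pos_semidef[OF subsystem_okD(7)[OF s]]]
  note Q = pos_semidefD(1)[OF subsystem_okD(6)[OF s]]
  define a where "a = ?A *\<^sub>v x"
  define b where "b = ?B *\<^sub>v u"
  define k where "k = ?K *\<^sub>v x"
  have ab: "a \<in> carrier_vec ?n" "b \<in> carrier_vec ?n" "k \<in> carrier_vec ?m" "c \<in> carrier_vec ?n"
    using AB KD x u by (auto simp: a_def b_def k_def c_def)
  have 1: "(c + w) \<bullet> (P *\<^sub>v (c + w)) = c \<bullet> (P *\<^sub>v c) + 2 * (w \<bullet> (P *\<^sub>v c)) + w \<bullet> (P *\<^sub>v w)"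
    using ab w PD(1) scalar_prod_symmetric_mat[OF PD(1,2) ab(4) w]
    by (simp add: mult_add_distrib_mat_vec[of _ ?n ?n] add_scalar_prod_distrib[of _ ?n]
        scalar_prod_add_distrib[of _ ?n])
  have 2: "c \<bullet> (P *\<^sub>v c) = a \<bullet> (P *\<^sub>v a) + 2 * (b \<bullet> (P *\<^sub>v a)) + b \<bullet> (P *\<^sub>v b)"
    using ab PD(1) scalar_prod_symmetric_mat[OF PD(1,2) ab(1,2)]
    unfolding c_def a_def[symmetric] b_def[symmetric]
    by (simp add: mult_add_distrib_mat_vec[of _ ?n ?n] add_scalar_prod_distrib[of _ ?n]
        scalar_prod_add_distrib[of _ ?n])
  have 3: "v \<bullet> (?W *\<^sub>v v) = u \<bullet> (?W *\<^sub>v u) - 2 * (u \<bullet> (?W *\<^sub>v k)) + k \<bullet> (?W *\<^sub>v k)"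
    using ab u WD(1) scalar_prod_symmetric_mat[OF WD(1,2) u ab(3)]
    unfolding v_def k_def[symmetric]
    by (simp add: mult_minus_distrib_mat_vec[of _ ?m ?m] minus_scalar_prod_distrib[of _ ?m]
        scalar_prod_minus_distrib[of _ ?m])
  have 4: "u \<bullet> (?W *\<^sub>v u) = b \<bullet> (P *\<^sub>v b) + u \<bullet> (mR s *\<^sub>v u)"
    unfolding control_weight_def b_def using AB PD(1) R u transpose_mult_mult_carrier[OF AB(2) PD(1)]
    by (simp add: add_mult_distrib_mat_vec[of _ ?m ?m] scalar_prod_add_distrib[of _ ?m]
        scalar_prod_transpose_mult_mult[of _ ?n] del: assoc_mult_mat)
  \<comment> \<open>The normal equation turns the mixed term of the square in \<open>v\<close> into
    the mixed term of fact \<open>2\<close>; the terms in \<open>k\<close> cancel against the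
    Riccati correction in fact \<open>6\<close>.\<close>
  have 5: "u \<bullet> (?W *\<^sub>v k) = - (b \<bullet> (P *\<^sub>v a))"
  proof -
    have "?W *\<^sub>v k = (?W * ?K) *\<^sub>v x"
      unfolding k_def using WD(1) KD x by simp
    also have "\<dots> = - (transpose_mat ?B *\<^sub>v (P *\<^sub>v a))"
      unfolding control_weight_gain[OF s P] a_def using AB PD(1) x
      by (simp add: assoc_mult_mat_vec[of _ ?m ?n] assoc_mult_mat_vec[of _ ?n ?n]
          uminus_mult_mat_vec del: assoc_mult_mat)
    finally have "u \<bullet> (?W *\<^sub>v k) = - (u \<bullet> (transpose_mat ?B *\<^sub>v (P *\<^sub>v a)))"
      using AB PD(1) ab u by simp
    also have "u \<bullet> (transpose_mat ?B *\<^sub>v (P *\<^sub>v a)) = (transpose_mat ?B *\<^sub>v (P *\<^sub>v a)) \<bullet> u"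
      using AB PD(1) ab u by (intro comm_scalar_prod[of _ ?m]) auto
    also have "\<dots> = (P *\<^sub>v a) \<bullet> (?B *\<^sub>v u)"
      using AB PD(1) ab u by (intro transpose_vec_mult_scalar) auto
    also have "\<dots> = b \<bullet> (P *\<^sub>v a)"
      unfolding b_def using AB PD(1) ab u by (intro comm_scalar_prod[of _ ?n]) auto
    finally show ?thesis .
  qed
  have 6: "x \<bullet> (P *\<^sub>v x) = a \<bullet> (P *\<^sub>v a) + x \<bullet> (mQ s *\<^sub>v x) - k \<bullet> (?W *\<^sub>v k)"
  proof -
    have "x \<bullet> (P *\<^sub>v x) = x \<bullet> ((transpose_mat ?A * P * ?A + mQ s - transpose_mat ?K * ?W * ?K) *\<^sub>v x)"
      using ric unfolding control_riccati_def by simp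
    also have "\<dots> = x \<bullet> ((transpose_mat ?A * P * ?A) *\<^sub>v x) + x \<bullet> (mQ s *\<^sub>v x)
        - x \<bullet> ((transpose_mat ?K * ?W * ?K) *\<^sub>v x)"
      using AB PD(1) WD(1) KD Q x transpose_mult_mult_carrier[OF AB(1) PD(1)]
        transpose_mult_mult_carrier[OF KD WD(1)]
      by (simp add: minus_mult_distrib_mat_vec[of _ ?n ?n] add_mult_distrib_mat_vec[of _ ?n ?n]
          scalar_prod_add_distrib[of _ ?n] scalar_prod_minus_distrib[of _ ?n] del: assoc_mult_mat)
    also have "\<dots> = a \<bullet> (P *\<^sub>v a) + x \<bullet> (mQ s *\<^sub>v x) - k \<bullet> (?W *\<^sub>v k)"
      using AB PD(1) WD(1) KD x
      by (simp add: scalar_prod_transpose_mult_mult[of _ ?n] scalar_prod_transpose_mult_mult[of _ ?m]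
          a_def k_def del: assoc_mult_mat)
    finally show ?thesis .
  qed
  show ?thesis
    unfolding 1 2 3 4 5 6 by simp
qed

text \<open>A single sample path, on which inequalities hold deterministically. Shifting the time
  gives a trajectory again, so bounds on \<open>x 0\<close> apply at every time and can be proved by
  induction on the horizon.\<close>

definition trajectory ::
    "subsystem \<Rightarrow> (nat \<Rightarrow> real vec) \<Rightarrow> (nat \<Rightarrow> real vec) \<Rightarrow> (nat \<Rightarrow> real vec) \<Rightarrow> bool" where
  "trajectory s x u w \<longleftrightarrow> (\<forall>k. x k \<in> carrier_vec (nx s) \<and> u k \<in> carrier_vec (nu s) \<and>
     w k \<in> carrier_vec (nx s) \<and> x (Suc k) = mA s *\<^sub>v x k + mB s *\<^sub>v u k + w k)"

definition stage_cost :: "subsystem \<Rightarrow> real vec \<Rightarrow> real vec \<Rightarrow> real" where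
  "stage_cost s x u = x \<bullet> (mQ s *\<^sub>v x) + u \<bullet> (mR s *\<^sub>v u)"

lemma stage_cost_nonneg:
  assumes "subsystem_ok s" "x \<in> carrier_vec (nx s)" "u \<in> carrier_vec (nu s)"
  shows "0 \<le> stage_cost s x u" "0 \<le> x \<bullet> (mQ s *\<^sub>v x)" "0 \<le> u \<bullet> (mR s *\<^sub>v u)"
  using pos_semidefD(3)[OF subsystem_okD(6)[OF assms(1)] assms(2)]
    pos_semidefD(3)[OF pos_def_imp_pos_semidef[OF subsystem_okD(7)[OF assms(1)]] assms(3)]
  by (auto simp: stage_cost_def)

text \<open>Read backwards, the recursion expresses \<open>mA s *\<^sub>v x 0\<close> as
  \<open>x 1\<close> minus the contributions of input and noise at time 0. One more power of A is
  thus handled by the induction hypothesis for the shifted path; the input is paid for by its own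
  cost, and the noise enters the bound explicitly.\<close>

lemma unforced_weight_le:
  assumes s: "subsystem_ok s"
  shows "\<exists>c\<ge>0. \<forall>x u w. trajectory s x u w \<longrightarrow>
    (mA s ^\<^sub>m j *\<^sub>v x 0) \<bullet> (mQ s *\<^sub>v (mA s ^\<^sub>m j *\<^sub>v x 0)) \<le>
      c * (\<Sum>l\<le>j. stage_cost s (x l) (u l) + w l \<bullet> w l)"
proof (induction j)
  case 0
  have "(mA s ^\<^sub>m 0 *\<^sub>v x 0) \<bullet> (mQ s *\<^sub>v (mA s ^\<^sub>m 0 *\<^sub>v x 0)) \<le>
      1 * (\<Sum>l\<le>0. stage_cost s (x l) (u l) + w l \<bullet> w l)" if "trajectory s x u w" for x u w
    using that stage_cost_nonneg(3)[OF s, of "x 0" "u 0"] scalar_prod_self_nonneg[of "w 0"]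
      subsystem_okD(1)[OF s]
    by (auto simp: trajectory_def stage_cost_def)
  then show ?case by (intro exI[of _ 1]) auto
next
  case (Suc j)
  let ?n = "nx s" and ?F = "mA s ^\<^sub>m j"
  let ?G = "transpose_mat ?F * mQ s * ?F"
  note AB = subsystem_okD(1,2)[OF s]
  have F: "?F \<in> carrier_mat ?n ?n" using AB(1) by simp
  note Q = pos_semidefD(1)[OF subsystem_okD(6)[OF s]]
  have G: "pos_semidef ?n ?G"
    by (intro pos_semidef_congruence[OF _ F] subsystem_okD[OF s])
  have G_eq: "v \<bullet> (?G *\<^sub>v v) = (?F *\<^sub>v v) \<bullet> (mQ s *\<^sub>v (?F *\<^sub>v v))" if "v \<in> carrier_vec ?n" for v
    using F Q that by (intro scalar_prod_transpose_mult_mult)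
  obtain c where c: "0 \<le> c" "\<And>x u w. trajectory s x u w \<Longrightarrow>
      x 0 \<bullet> (?G *\<^sub>v x 0) \<le> c * (\<Sum>l\<le>j. stage_cost s (x l) (u l) + w l \<bullet> w l)"
  proof -
    from Suc obtain c where "0 \<le> c \<and> (\<forall>x u w. trajectory s x u w \<longrightarrow>
        (?F *\<^sub>v x 0) \<bullet> (mQ s *\<^sub>v (?F *\<^sub>v x 0)) \<le> c * (\<Sum>l\<le>j. stage_cost s (x l) (u l) + w l \<bullet> w l))"
      by (elim exE)
    moreover have "x 0 \<in> carrier_vec ?n" if "trajectory s x u w" for x u w
      using that by (simp add: trajectory_def)
    ultimately show thesis
      by (intro that[of c]) (auto simp only: G_eq)
  qed
  obtain g where g: "0 \<le> g" "\<And>x. x \<in> carrier_vec ?n \<Longrightarrow> x \<bullet> (?G *\<^sub>v x) \<le> g * (x \<bullet> x)"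
    using quadratic_form_upper_bound[OF pos_semidefD(1)[OF G]] by blast
  obtain b where b: "0 \<le> b" "\<And>u. u \<in> carrier_vec (nu s) \<Longrightarrow> (mB s *\<^sub>v u) \<bullet> (mB s *\<^sub>v u) \<le> b * (u \<bullet> u)"
    using mult_mat_vec_bound[OF AB(2)] by blast
  obtain r where r: "0 < r" "\<And>u. u \<in> carrier_vec (nu s) \<Longrightarrow> r * (u \<bullet> u) \<le> u \<bullet> (mR s *\<^sub>v u)"
    using pos_def_lower_bound[OF subsystem_okD(7)[OF s]] by blast
  \<comment> \<open>The quotient \<open>b / r\<close> converts stage cost into the squared length of
    \<open>mB s *\<^sub>v u 0\<close>, and \<open>g\<close> bounds the form \<open>?G\<close>. The
    factors 4, 4 and 2 come from splitting a difference of three vectors in two steps.\<close>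
  define d where "d = 4 * c + 4 * (g * (b / r)) + 2 * g"
  have "(mA s ^\<^sub>m Suc j *\<^sub>v x 0) \<bullet> (mQ s *\<^sub>v (mA s ^\<^sub>m Suc j *\<^sub>v x 0)) \<le>
      d * (\<Sum>l\<le>Suc j. stage_cost s (x l) (u l) + w l \<bullet> w l)" if t: "trajectory s x u w" for x u w
  proof -
    define e where "e l = stage_cost s (x l) (u l) + w l \<bullet> w l" for l
    have car: "x k \<in> carrier_vec ?n" "u k \<in> carrier_vec (nu s)" "w k \<in> carrier_vec ?n" for k
      using t by (auto simp: trajectory_def)
    have e: "0 \<le> e l" for l
      using stage_cost_nonneg(1)[OF s car(1,2)] scalar_prod_self_nonneg[of "w l"] by (simp add: e_def)
    have "trajectory s (\<lambda>k. x (Suc k)) (\<lambda>k. u (Suc k)) (\<lambda>k. w (Suc k))"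
      using t unfolding trajectory_def by blast
    from c(2)[OF this] have "x 1 \<bullet> (?G *\<^sub>v x 1) \<le> c * (\<Sum>l\<le>j. e (Suc l))"
      by (simp add: e_def)
    also have "(\<Sum>l\<le>j. e (Suc l)) \<le> (\<Sum>l\<le>Suc j. e l)"
      using e[of 0] by (subst sum.atMost_Suc_shift) simp
    finally have 1: "x 1 \<bullet> (?G *\<^sub>v x 1) \<le> c * (\<Sum>l\<le>Suc j. e l)"
      using c(1) by (simp add: mult_left_mono)
    have e0: "e 0 \<le> (\<Sum>l\<le>Suc j. e l)"
      using e by (intro member_le_sum) auto
    have Bu: "mB s *\<^sub>v u 0 \<in> carrier_vec ?n" using AB car by simp
    have "(mB s *\<^sub>v u 0) \<bullet> (?G *\<^sub>v (mB s *\<^sub>v u 0)) \<le> g * (b * (u 0 \<bullet> u 0))"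
      using g(2)[OF Bu] mult_left_mono[OF b(2)[OF car(2)[of 0]] g(1)] by linarith
    also have "\<dots> \<le> g * (b * (e 0 / r))"
    proof -
      have "r * (u 0 \<bullet> u 0) \<le> e 0"
        using r(2)[OF car(2)[of 0]] stage_cost_nonneg(2)[OF s car(1)[of 0] car(2)[of 0]]
          scalar_prod_self_nonneg[of "w 0"] by (simp add: e_def stage_cost_def)
      then have "u 0 \<bullet> u 0 \<le> e 0 / r" using r(1) by (simp add: field_simps)
      then show ?thesis using g(1) b(1) by (intro mult_left_mono)
    qed
    also have "\<dots> = g * (b / r) * e 0" by simp
    also have "\<dots> \<le> g * (b / r) * (\<Sum>l\<le>Suc j. e l)"
      using e0 g(1) b(1) r(1) by (intro mult_left_mono) auto
    finally have 2: "(mB s *\<^sub>v u 0) \<bullet> (?G *\<^sub>v (mB s *\<^sub>v u 0)) \<le> g * (b / r) * (\<Sum>l\<le>Suc j. e l)" .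
    have "w 0 \<bullet> (?G *\<^sub>v w 0) \<le> g * e 0"
      using g(2)[OF car(3)[of 0]] stage_cost_nonneg(1)[OF s car(1)[of 0] car(2)[of 0]] g(1)
        mult_left_mono[of "w 0 \<bullet> w 0" "e 0" g] by (simp add: e_def)
    also have "\<dots> \<le> g * (\<Sum>l\<le>Suc j. e l)"
      using e0 g(1) by (intro mult_left_mono)
    finally have 3: "w 0 \<bullet> (?G *\<^sub>v w 0) \<le> g * (\<Sum>l\<le>Suc j. e l)" .
    have "mA s *\<^sub>v x 0 = x 1 - mB s *\<^sub>v u 0 - w 0"
    proof -
      have "x 1 = mA s *\<^sub>v x 0 + mB s *\<^sub>v u 0 + w 0"
        using t by (simp add: trajectory_def)
      then show ?thesis
        using AB car[of 0] by (intro eq_vecI) auto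
    qed
    moreover have "mA s ^\<^sub>m Suc j *\<^sub>v x 0 = ?F *\<^sub>v (mA s *\<^sub>v x 0)"
      using assoc_mult_mat_vec[OF F AB(1) car(1)[of 0]] by simp
    ultimately have "(mA s ^\<^sub>m Suc j *\<^sub>v x 0) \<bullet> (mQ s *\<^sub>v (mA s ^\<^sub>m Suc j *\<^sub>v x 0)) =
        (x 1 - mB s *\<^sub>v u 0 - w 0) \<bullet> (?G *\<^sub>v (x 1 - mB s *\<^sub>v u 0 - w 0))"
      using G_eq[of "x 1 - mB s *\<^sub>v u 0 - w 0"] car Bu by simp
    also have "\<dots> \<le> 2 * ((x 1 - mB s *\<^sub>v u 0) \<bullet> (?G *\<^sub>v (x 1 - mB s *\<^sub>v u 0))) + 2 * (w 0 \<bullet> (?G *\<^sub>v w 0))"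
      using car Bu by (intro pos_semidef_diff_le[OF G]) auto
    also have "(x 1 - mB s *\<^sub>v u 0) \<bullet> (?G *\<^sub>v (x 1 - mB s *\<^sub>v u 0)) \<le>
        2 * (x 1 \<bullet> (?G *\<^sub>v x 1)) + 2 * ((mB s *\<^sub>v u 0) \<bullet> (?G *\<^sub>v (mB s *\<^sub>v u 0)))"
      using car Bu by (intro pos_semidef_diff_le[OF G]) auto
    finally have "(mA s ^\<^sub>m Suc j *\<^sub>v x 0) \<bullet> (mQ s *\<^sub>v (mA s ^\<^sub>m Suc j *\<^sub>v x 0)) \<le>
        4 * (x 1 \<bullet> (?G *\<^sub>v x 1)) + 4 * ((mB s *\<^sub>v u 0) \<bullet> (?G *\<^sub>v (mB s *\<^sub>v u 0)))
          + 2 * (w 0 \<bullet> (?G *\<^sub>v w 0))"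
      by simp
    also have "\<dots> \<le> 4 * (c * (\<Sum>l\<le>Suc j. e l)) + 4 * (g * (b / r) * (\<Sum>l\<le>Suc j. e l))
          + 2 * (g * (\<Sum>l\<le>Suc j. e l))"
      using 1 2 3 by linarith
    also have "\<dots> = d * (\<Sum>l\<le>Suc j. e l)"
      unfolding d_def by (simp only: distrib_right mult.assoc)
    finally show ?thesis unfolding e_def .
  qed
  moreover have "0 \<le> d" using c(1) g(1) b(1) r(1) by (simp add: d_def)
  ultimately show ?case by blast
qed

text \<open>If all forms \<open>?G j\<close> vanish at x, the square root H of Q annihilates the
  whole unforced path from x, and observability gives x = 0. Hence finitely many of these forms
  dominate the squared length of \<open>x 0\<close>, and each of them is bounded by costs and
  noise.\<close>

lemma state_le_stage_costs:
  assumes s: "subsystem_ok s"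
  obtains N C where "0 \<le> C" "\<And>x u w. trajectory s x u w \<Longrightarrow>
    x 0 \<bullet> x 0 \<le> C * (\<Sum>l\<le>N. stage_cost s (x l) (u l) + w l \<bullet> w l)"
proof -
  let ?n = "nx s"
  let ?G = "\<lambda>j. transpose_mat (mA s ^\<^sub>m j) * mQ s * mA s ^\<^sub>m j"
  have F: "mA s ^\<^sub>m j \<in> carrier_mat ?n ?n" for j using subsystem_okD(1)[OF s] by simp
  note Q = pos_semidefD(1)[OF subsystem_okD(6)[OF s]]
  have G: "pos_semidef ?n (?G j)" for j
    by (intro pos_semidef_congruence[OF _ F] subsystem_okD[OF s])
  have G_eq: "v \<bullet> (?G j *\<^sub>v v) = (mA s ^\<^sub>m j *\<^sub>v v) \<bullet> (mQ s *\<^sub>v (mA s ^\<^sub>m j *\<^sub>v v))"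
    if "v \<in> carrier_vec ?n" for v j
    using F Q that by (intro scalar_prod_transpose_mult_mult)
  obtain H where H: "pos_semidef ?n H" "H * H = mQ s" "observable ?n (mA s) H"
    using s by (auto simp: subsystem_ok_def)
  have "x = 0\<^sub>v ?n" if x: "x \<in> carrier_vec ?n" and zero: "\<And>j. x \<bullet> (?G j *\<^sub>v x) = 0" for x
  proof -
    have "H *\<^sub>v (mA s ^\<^sub>m j *\<^sub>v x) = 0\<^sub>v ?n" for j
    proof -
      let ?y = "mA s ^\<^sub>m j *\<^sub>v x"
      have y: "?y \<in> carrier_vec ?n" by (rule mult_mat_vec_carrier[OF F x])
      have Hc: "H \<in> carrier_mat ?n ?n" "transpose_mat H = H" using H by (auto simp: pos_semidef_def)
      \<comment> \<open>Since H is symmetric with \<open>H * H = mQ s\<close>, the squared length of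
        \<open>H *\<^sub>v ?y\<close> is the Q-weight of \<open>?y\<close>.\<close>
      have "(H *\<^sub>v ?y) \<bullet> (H *\<^sub>v ?y) = (transpose_mat H *\<^sub>v (H *\<^sub>v ?y)) \<bullet> ?y"
        using y Hc by (intro transpose_vec_mult_scalar[symmetric]) auto
      also have "\<dots> = ((H * H) *\<^sub>v ?y) \<bullet> ?y"
        using y Hc by (simp add: assoc_mult_mat_vec[of _ ?n ?n])
      also have "\<dots> = 0"
        using zero[of j] y Q unfolding G_eq[OF x] H(2)
        by (subst comm_scalar_prod[of _ ?n]) auto
      finally have "(H *\<^sub>v ?y) \<bullet>c (H *\<^sub>v ?y) = 0"
        by (simp add: scalar_prod_def)
      then show ?thesis
        using Hc y conjugate_square_eq_0_vec[of "H *\<^sub>v ?y" ?n] by auto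
    qed
    then have "H *\<^sub>v (mA s ^\<^sub>m j *\<^sub>v x) = H *\<^sub>v (mA s ^\<^sub>m j *\<^sub>v 0\<^sub>v ?n)" for j
    proof -
      have zero: "T *\<^sub>v 0\<^sub>v ?n = 0\<^sub>v ?n" if "T \<in> carrier_mat ?n ?n" for T :: "real mat"
        using that by (intro eq_vecI) auto
      show ?thesis
        unfolding \<open>H *\<^sub>v (mA s ^\<^sub>m j *\<^sub>v x) = 0\<^sub>v ?n\<close> zero[OF F]
        by (rule zero[OF pos_semidefD(1)[OF H(1)], symmetric])
    qed
    then show ?thesis
      using H(3) x unfolding observable_def by auto
  qed
  note inj = this
  obtain N \<epsilon> where N: "0 < \<epsilon>"
    "\<And>x. x \<in> carrier_vec ?n \<Longrightarrow> \<epsilon> * (x \<bullet> x) \<le> (\<Sum>j\<le>N. x \<bullet> (?G j *\<^sub>v x))"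
    by (rule quadratic_forms_lower_bound[of ?n ?G, OF G inj]) (assumption | rule that)+
  have "\<forall>j. \<exists>c\<ge>0. \<forall>x u w. trajectory s x u w \<longrightarrow>
    (mA s ^\<^sub>m j *\<^sub>v x 0) \<bullet> (mQ s *\<^sub>v (mA s ^\<^sub>m j *\<^sub>v x 0)) \<le>
      c * (\<Sum>l\<le>j. stage_cost s (x l) (u l) + w l \<bullet> w l)"
    by (intro allI unforced_weight_le[OF s])
  from choice[OF this] obtain c where c': "\<forall>j. 0 \<le> c j \<and> (\<forall>x u w. trajectory s x u w \<longrightarrow>
    (mA s ^\<^sub>m j *\<^sub>v x 0) \<bullet> (mQ s *\<^sub>v (mA s ^\<^sub>m j *\<^sub>v x 0)) \<le>
      c j * (\<Sum>l\<le>j. stage_cost s (x l) (u l) + w l \<bullet> w l))"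
    by (elim exE)
  then have c: "\<And>j. 0 \<le> c j" "\<And>j x u w. trajectory s x u w \<Longrightarrow>
    (mA s ^\<^sub>m j *\<^sub>v x 0) \<bullet> (mQ s *\<^sub>v (mA s ^\<^sub>m j *\<^sub>v x 0)) \<le>
      c j * (\<Sum>l\<le>j. stage_cost s (x l) (u l) + w l \<bullet> w l)"
    by simp_all
  show thesis
  proof (rule that)
    show "0 \<le> (\<Sum>j\<le>N. c j) / \<epsilon>" using c(1) N(1) by (simp add: sum_nonneg)
    fix x u w assume t: "trajectory s x u w"
    then have car: "x k \<in> carrier_vec ?n" "u k \<in> carrier_vec (nu s)" for k
      by (auto simp: trajectory_def)
    have e: "0 \<le> stage_cost s (x l) (u l) + w l \<bullet> w l" for l
      using stage_cost_nonneg(1)[OF s car] scalar_prod_self_nonneg[of "w l"] by simp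
    have "\<epsilon> * (x 0 \<bullet> x 0) \<le> (\<Sum>j\<le>N. x 0 \<bullet> (?G j *\<^sub>v x 0))"
      by (rule N(2)[OF car(1)])
    also have "\<dots> \<le> (\<Sum>j\<le>N. c j * (\<Sum>l\<le>N. stage_cost s (x l) (u l) + w l \<bullet> w l))"
    proof (rule sum_mono)
      fix j assume "j \<in> {..N}"
      have "x 0 \<bullet> (?G j *\<^sub>v x 0) \<le> c j * (\<Sum>l\<le>j. stage_cost s (x l) (u l) + w l \<bullet> w l)"
        unfolding G_eq[OF car(1)] by (rule c(2)[OF t])
      also have "\<dots> \<le> c j * (\<Sum>l\<le>N. stage_cost s (x l) (u l) + w l \<bullet> w l)"
        using \<open>j \<in> {..N}\<close> e c(1) by (intro mult_left_mono sum_mono2) auto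
      finally show "x 0 \<bullet> (?G j *\<^sub>v x 0) \<le> \<dots>" .
    qed
    finally show "x 0 \<bullet> x 0 \<le> (\<Sum>j\<le>N. c j) / \<epsilon> * (\<Sum>l\<le>N. stage_cost s (x l) (u l) + w l \<bullet> w l)"
      using N(1) by (simp add: field_simps flip: sum_distrib_right)
  qed
qed

section \<open>Square integrable random vectors\<close>

text \<open>The working form of \<open>vec_borel\<close> in everything that follows. Membership in
  the carrier belongs to it because the space of \<open>vec_borel n\<close> is
  \<open>carrier_vec n\<close>.\<close>

lemma measurable_vec_borel_iff:
  "X \<in> measurable M (vec_borel n) \<longleftrightarrow>
     X \<in> space M \<rightarrow> carrier_vec n \<and> (\<forall>j<n. (\<lambda>\<omega>. X \<omega> $ j) \<in> borel_measurable M)"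
proof
  let ?h = "\<lambda>v::real vec. \<lambda>j\<in>{..<n}. v $ j"
  assume X: "X \<in> measurable M (vec_borel n)"
  have h: "?h \<in> measurable (vec_borel n) (PiM {..<n} (\<lambda>_. borel))"
    unfolding vec_borel_def by (intro measurable_vimage_algebra1) (auto simp: space_PiM)
  have "(\<lambda>\<omega>. X \<omega> $ j) \<in> borel_measurable M" if "j < n" for j
  proof -
    have "(\<lambda>\<omega>. ?h (X \<omega>) j) \<in> borel_measurable M"
      using that by (intro measurable_compose[OF measurable_compose[OF X h]
            measurable_component_singleton]) auto
    then show ?thesis using that by simp
  qed
  moreover have "X \<in> space M \<rightarrow> carrier_vec n"
    using measurable_space[OF X] by (auto simp: vec_borel_def)
  ultimately show "X \<in> space M \<rightarrow> carrier_vec n \<and> (\<forall>j<n. (\<lambda>\<omega>. X \<omega> $ j) \<in> borel_measurable M)"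
    by blast
next
  assume "X \<in> space M \<rightarrow> carrier_vec n \<and> (\<forall>j<n. (\<lambda>\<omega>. X \<omega> $ j) \<in> borel_measurable M)"
  then show "X \<in> measurable M (vec_borel n)"
    unfolding vec_borel_def
    by (intro measurable_vimage_algebra2 measurable_restrict) auto
qed

lemma measurable_vec_borelD:
  assumes "X \<in> measurable M (vec_borel n)"
  shows "\<omega> \<in> space M \<Longrightarrow> X \<omega> \<in> carrier_vec n"
    "j < n \<Longrightarrow> (\<lambda>\<omega>. X \<omega> $ j) \<in> borel_measurable M"
  using assms by (auto simp: measurable_vec_borel_iff)

lemma measurable_vec_dim:
  "X \<in> measurable M (vec_borel n) \<Longrightarrow> \<omega> \<in> space M \<Longrightarrow> dim_vec (X \<omega>) = n"
  using measurable_vec_borelD(1)[of X M n \<omega>] by simp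

lemma measurable_vec_const: "c \<in> carrier_vec n \<Longrightarrow> (\<lambda>_. c) \<in> measurable M (vec_borel n)"
  by (simp add: measurable_vec_borel_iff)

lemma measurable_vec_add:
  assumes "X \<in> measurable M (vec_borel n)" "Y \<in> measurable M (vec_borel n)"
  shows "(\<lambda>\<omega>. X \<omega> + Y \<omega>) \<in> measurable M (vec_borel n)"
proof -
  have "(\<lambda>\<omega>. (X \<omega> + Y \<omega>) $ j) \<in> borel_measurable M" if "j < n" for j
  proof -
    have "(\<lambda>\<omega>. X \<omega> $ j + Y \<omega> $ j) \<in> borel_measurable M"
      using assms that by (intro borel_measurable_add measurable_vec_borelD)
    then show ?thesis
      by (rule measurable_cong[THEN iffD2, rotated])
        (use that measurable_vec_dim[OF assms(1)] measurable_vec_dim[OF assms(2)] in auto)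
  qed
  then show ?thesis
    using measurable_vec_dim[OF assms(1)] measurable_vec_dim[OF assms(2)]
    by (auto simp: measurable_vec_borel_iff intro!: carrier_vecI)
qed

lemma measurable_vec_diff:
  assumes "X \<in> measurable M (vec_borel n)" "Y \<in> measurable M (vec_borel n)"
  shows "(\<lambda>\<omega>. X \<omega> - Y \<omega>) \<in> measurable M (vec_borel n)"
proof -
  have "(\<lambda>\<omega>. (X \<omega> - Y \<omega>) $ j) \<in> borel_measurable M" if "j < n" for j
  proof -
    have "(\<lambda>\<omega>. X \<omega> $ j - Y \<omega> $ j) \<in> borel_measurable M"
      using assms that by (intro borel_measurable_diff measurable_vec_borelD)
    then show ?thesis
      by (rule measurable_cong[THEN iffD2, rotated])
        (use that measurable_vec_dim[OF assms(1)] measurable_vec_dim[OF assms(2)] in auto)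
  qed
  then show ?thesis
    using measurable_vec_dim[OF assms(1)] measurable_vec_dim[OF assms(2)]
    by (auto simp: measurable_vec_borel_iff intro!: carrier_vecI)
qed

lemma mult_mat_vec_index_sum:
  "A \<in> carrier_mat k n \<Longrightarrow> x \<in> carrier_vec n \<Longrightarrow> i < k \<Longrightarrow>
    (A *\<^sub>v x) $ i = (\<Sum>j<n. A $$ (i, j) * x $ j)"
  by (simp add: scalar_prod_def atLeast0LessThan)

lemma measurable_mult_mat_vec:
  assumes A: "A \<in> carrier_mat k n" and X: "X \<in> measurable M (vec_borel n)"
  shows "(\<lambda>\<omega>. A *\<^sub>v X \<omega>) \<in> measurable M (vec_borel k)"
proof -
  have "(\<lambda>\<omega>. (A *\<^sub>v X \<omega>) $ i) \<in> borel_measurable M" if "i < k" for i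
  proof -
    have "(\<lambda>\<omega>. \<Sum>j<n. A $$ (i, j) * X \<omega> $ j) \<in> borel_measurable M"
      using measurable_vec_borelD(2)[OF X] by (intro borel_measurable_sum borel_measurable_times) auto
    then show ?thesis
      by (rule measurable_cong[THEN iffD2, rotated])
        (use that A measurable_vec_borelD(1)[OF X] in \<open>simp add: mult_mat_vec_index_sum del: index_mult_mat_vec\<close>)
  qed
  then show ?thesis
    using A measurable_vec_borelD(1)[OF X] by (auto simp: measurable_vec_borel_iff)
qed

lemma measurable_scalar_prod:
  assumes X: "X \<in> measurable M (vec_borel n)" and Y: "Y \<in> measurable M (vec_borel n)"
  shows "(\<lambda>\<omega>. X \<omega> \<bullet> Y \<omega>) \<in> borel_measurable M"
proof -
  have "(\<lambda>\<omega>. \<Sum>j<n. X \<omega> $ j * Y \<omega> $ j) \<in> borel_measurable M"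
    using measurable_vec_borelD(2)[OF X] measurable_vec_borelD(2)[OF Y]
    by (intro borel_measurable_sum borel_measurable_times) auto
  then show ?thesis
    by (rule measurable_cong[THEN iffD2, rotated])
      (use measurable_vec_dim[OF Y] in \<open>simp add: scalar_prod_def atLeast0LessThan\<close>)
qed

definition square_integrable :: "'w measure \<Rightarrow> nat \<Rightarrow> ('w \<Rightarrow> real vec) \<Rightarrow> bool" where
  "square_integrable M n X \<longleftrightarrow>
     X \<in> measurable M (vec_borel n) \<and> (\<forall>j<n. integrable M (\<lambda>\<omega>. (X \<omega> $ j)\<^sup>2))"

lemma square_integrable_measurable:
  "square_integrable M n X \<Longrightarrow> X \<in> measurable M (vec_borel n)"
  by (simp add: square_integrable_def)

lemma integrable_mult_of_squares:
  fixes f g :: "'w \<Rightarrow> real"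
  assumes [measurable]: "f \<in> borel_measurable M" "g \<in> borel_measurable M"
    and "integrable M (\<lambda>\<omega>. (f \<omega>)\<^sup>2)" "integrable M (\<lambda>\<omega>. (g \<omega>)\<^sup>2)"
  shows "integrable M (\<lambda>\<omega>. f \<omega> * g \<omega>)"
proof (rule Bochner_Integration.integrable_bound)
  show "integrable M (\<lambda>\<omega>. (f \<omega>)\<^sup>2 + (g \<omega>)\<^sup>2)" using assms by simp
  have "\<bar>a * b\<bar> \<le> \<bar>a\<^sup>2 + b\<^sup>2\<bar>" for a b :: real
  proof -
    have "2 * (\<bar>a\<bar> * \<bar>b\<bar>) \<le> a\<^sup>2 + b\<^sup>2"
      using sum_squares_bound[of "\<bar>a\<bar>" "\<bar>b\<bar>"] by simp
    moreover have "0 \<le> \<bar>a\<bar> * \<bar>b\<bar>" by simp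
    ultimately have "\<bar>a * b\<bar> \<le> a\<^sup>2 + b\<^sup>2" unfolding abs_mult by linarith
    then show ?thesis by simp
  qed
  then show "AE \<omega> in M. norm (f \<omega> * g \<omega>) \<le> norm ((f \<omega>)\<^sup>2 + (g \<omega>)\<^sup>2)" by simp
qed simp

lemma square_integrable_index_mult:
  assumes "square_integrable M n X" "square_integrable M k Y" "i < n" "j < k"
  shows "integrable M (\<lambda>\<omega>. X \<omega> $ i * Y \<omega> $ j)"
  using assms
  by (intro integrable_mult_of_squares) (auto simp: square_integrable_def measurable_vec_borel_iff)

lemma square_integrable_scalar_prod:
  assumes X: "square_integrable M n X" and Y: "square_integrable M n Y"
  shows "integrable M (\<lambda>\<omega>. X \<omega> \<bullet> Y \<omega>)"
proof -
  have "integrable M (\<lambda>\<omega>. \<Sum>j<n. X \<omega> $ j * Y \<omega> $ j)"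
    using X Y by (intro Bochner_Integration.integrable_sum square_integrable_index_mult) auto
  then show ?thesis
    by (rule Bochner_Integration.integrable_cong[THEN iffD2, rotated -1])
      (use measurable_vec_dim[OF square_integrable_measurable[OF Y]]
        in \<open>simp_all add: scalar_prod_def atLeast0LessThan\<close>)
qed

lemma square_integrable_const:
  "finite_measure M \<Longrightarrow> c \<in> carrier_vec n \<Longrightarrow> square_integrable M n (\<lambda>_. c)"
  by (simp add: square_integrable_def measurable_vec_const finite_measure.integrable_const)

lemma square_integrable_add:
  assumes X: "square_integrable M n X" and Y: "square_integrable M n Y"
  shows "square_integrable M n (\<lambda>\<omega>. X \<omega> + Y \<omega>)"
proof -
  note m = square_integrable_measurable[OF X] square_integrable_measurable[OF Y]
  have "integrable M (\<lambda>\<omega>. ((X \<omega> + Y \<omega>) $ j)\<^sup>2)" if "j < n" for j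
  proof -
    have "integrable M (\<lambda>\<omega>. (X \<omega> $ j)\<^sup>2 + 2 * (X \<omega> $ j * Y \<omega> $ j) + (Y \<omega> $ j)\<^sup>2)"
      using X Y that square_integrable_index_mult[OF X Y that that]
      by (auto simp: square_integrable_def)
    then show ?thesis
      by (rule Bochner_Integration.integrable_cong[THEN iffD2, rotated -1])
        (use measurable_vec_dim[OF m(1)] measurable_vec_dim[OF m(2)] that
          in \<open>simp_all add: power2_eq_square algebra_simps\<close>)
  qed
  then show ?thesis
    using measurable_vec_add[OF m] by (simp add: square_integrable_def)
qed

lemma square_integrable_diff:
  assumes X: "square_integrable M n X" and Y: "square_integrable M n Y"
  shows "square_integrable M n (\<lambda>\<omega>. X \<omega> - Y \<omega>)"
proof -
  note m = square_integrable_measurable[OF X] square_integrable_measurable[OF Y]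
  have "integrable M (\<lambda>\<omega>. ((X \<omega> - Y \<omega>) $ j)\<^sup>2)" if "j < n" for j
  proof -
    have "integrable M (\<lambda>\<omega>. (X \<omega> $ j)\<^sup>2 - 2 * (X \<omega> $ j * Y \<omega> $ j) + (Y \<omega> $ j)\<^sup>2)"
      using X Y that square_integrable_index_mult[OF X Y that that]
      by (auto simp: square_integrable_def)
    then show ?thesis
      by (rule Bochner_Integration.integrable_cong[THEN iffD2, rotated -1])
        (use measurable_vec_dim[OF m(1)] measurable_vec_dim[OF m(2)] that
          in \<open>simp_all add: power2_eq_square algebra_simps\<close>)
  qed
  then show ?thesis
    using measurable_vec_diff[OF m] by (simp add: square_integrable_def)
qed

lemma square_integrable_mult_mat:
  assumes A: "A \<in> carrier_mat k n" and X: "square_integrable M n X"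
  shows "square_integrable M k (\<lambda>\<omega>. A *\<^sub>v X \<omega>)"
proof -
  note m = square_integrable_measurable[OF X]
  have "integrable M (\<lambda>\<omega>. ((A *\<^sub>v X \<omega>) $ i)\<^sup>2)" if "i < k" for i
  proof -
    have "integrable M (\<lambda>\<omega>. \<Sum>a<n. \<Sum>b<n. A $$ (i, a) * X \<omega> $ a * (A $$ (i, b) * X \<omega> $ b))"
    proof (intro Bochner_Integration.integrable_sum)
      fix a b assume "a \<in> {..<n}" "b \<in> {..<n}"
      then have "integrable M (\<lambda>\<omega>. A $$ (i, a) * A $$ (i, b) * (X \<omega> $ a * X \<omega> $ b))"
        using square_integrable_index_mult[OF X X] by simp
      then show "integrable M (\<lambda>\<omega>. A $$ (i, a) * X \<omega> $ a * (A $$ (i, b) * X \<omega> $ b))"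
        by (simp add: ac_simps)
    qed
    moreover have "((A *\<^sub>v X \<omega>) $ i)\<^sup>2 = (\<Sum>a<n. \<Sum>b<n. A $$ (i, a) * X \<omega> $ a * (A $$ (i, b) * X \<omega> $ b))"
      if "\<omega> \<in> space M" for \<omega>
      unfolding power2_eq_square mult_mat_vec_index_sum[OF A measurable_vec_borelD(1)[OF m that] \<open>i < k\<close>]
      by (rule sum_product)
    ultimately show ?thesis
      using Bochner_Integration.integrable_cong[OF refl, of M "\<lambda>\<omega>. ((A *\<^sub>v X \<omega>) $ i)\<^sup>2"] by simp
  qed
  then show ?thesis
    using measurable_mult_mat_vec[OF A m] by (simp add: square_integrable_def)
qed

lemma square_integrable_cong_AE:
  assumes X: "square_integrable M n X" and Y: "Y \<in> measurable M (vec_borel n)"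
    and eq: "AE \<omega> in M. X \<omega> = Y \<omega>"
  shows "square_integrable M n Y"
  unfolding square_integrable_def
proof (intro conjI allI impI)
  fix j assume j: "j < n"
  have "integrable M (\<lambda>\<omega>. (X \<omega> $ j)\<^sup>2)" using X j by (simp add: square_integrable_def)
  then show "integrable M (\<lambda>\<omega>. (Y \<omega> $ j)\<^sup>2)"
    by (rule Bochner_Integration.integrable_cong_AE_imp)
      (use measurable_vec_borelD(2)[OF Y j] eq in auto)
qed fact

text \<open>The Doob-Dynkin lemma, by induction from indicators to monotone limits. It later turns
  inputs that are measurable in the information into functions of the history, and lets independence
  be applied to functions measurable in a generated sigma-algebra.\<close>

lemma measurable_vimage_algebra_factor_ennreal:
  fixes f :: "'a \<Rightarrow> ennreal"
  assumes f: "f \<in> borel_measurable (vimage_algebra X h N)" and h: "h \<in> X \<rightarrow> space N"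
  shows "\<exists>g\<in>borel_measurable N. \<forall>x\<in>X. f x = g (h x)"
  using f
proof (induction rule: borel_measurable_induct)
  case (cong f g)
  then show ?case by simp
next
  case (set A)
  then obtain B where B: "B \<in> sets N" "A = h -` B \<inter> X"
    using sets_vimage_algebra2[OF h] by auto
  show ?case
    using B h by (intro bexI[of _ "indicator B"]) (auto simp: indicator_def)
next
  case (mult u c)
  from mult.IH obtain g where "g \<in> borel_measurable N" "\<forall>x\<in>X. u x = g (h x)" by (elim bexE)
  then show ?case by (intro bexI[of _ "\<lambda>y. c * g y"]) simp_all
next
  case (add u v)
  from add.IH(1) obtain g where "g \<in> borel_measurable N" "\<forall>x\<in>X. u x = g (h x)" by (elim bexE)
  moreover from add.IH(2) obtain g' where "g' \<in> borel_measurable N" "\<forall>x\<in>X. v x = g' (h x)" by (elim bexE)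
  ultimately show ?case by (intro bexI[of _ "\<lambda>y. g' y + g y"]) simp_all
next
  case (seq U)
  have "\<forall>i. \<exists>g. g \<in> borel_measurable N \<and> (\<forall>x\<in>X. U i x = g (h x))"
    using seq.IH unfolding Bex_def by simp
  from choice[OF this] obtain g
    where g: "\<forall>i. g i \<in> borel_measurable N \<and> (\<forall>x\<in>X. U i x = g i (h x))"
    by (elim exE)
  show ?case
  proof (intro bexI[of _ "\<lambda>y. SUP i. g i y"] ballI)
    show "(\<lambda>y. SUP i. g i y) \<in> borel_measurable N"
      using g by (intro borel_measurable_SUP) auto
    show "(\<Squnion> (range U)) x = (SUP i. g i (h x))" if "x \<in> X" for x
      using g that unfolding SUP_apply by simp
  qed
qed

text \<open>As \<open>ennreal\<close> maps negative numbers to zero, \<open>f\<close> is the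
  difference of two nonnegative parts, each of which factors.\<close>

lemma measurable_vimage_algebra_factor_real:
  fixes f :: "'a \<Rightarrow> real"
  assumes f: "f \<in> borel_measurable (vimage_algebra X h N)" and h: "h \<in> X \<rightarrow> space N"
  shows "\<exists>g\<in>borel_measurable N. \<forall>x\<in>X. f x = g (h x)"
proof -
  obtain g where g: "g \<in> borel_measurable N" "\<forall>x\<in>X. ennreal (f x) = g (h x)"
    using measurable_vimage_algebra_factor_ennreal[of "\<lambda>x. ennreal (f x)", OF _ h] f by auto
  obtain g' where g': "g' \<in> borel_measurable N" "\<forall>x\<in>X. ennreal (- f x) = g' (h x)"
    using measurable_vimage_algebra_factor_ennreal[of "\<lambda>x. ennreal (- f x)", OF _ h] f by auto
  have "f x = enn2real (g (h x)) - enn2real (g' (h x))" if "x \<in> X" for x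
  proof -
    have "f x = enn2real (ennreal (f x)) - enn2real (ennreal (- f x))"
      by (cases "0 \<le> f x") (auto simp: ennreal_neg)
    then show ?thesis
      unfolding g(2)[rule_format, OF that] g'(2)[rule_format, OF that] .
  qed
  then show ?thesis
    using g(1) g'(1) by (intro bexI[of _ "\<lambda>y. enn2real (g y) - enn2real (g' y)"] ballI) auto
qed

lemma measurable_vimage_algebra_factor_vec:
  assumes f: "f \<in> measurable (vimage_algebra X h N) (vec_borel n)" and h: "h \<in> X \<rightarrow> space N"
  shows "\<exists>g\<in>measurable N (vec_borel n). \<forall>x\<in>X. f x = g (h x)"
proof -
  have "\<forall>j. \<exists>g. j < n \<longrightarrow> g \<in> borel_measurable N \<and> (\<forall>x\<in>X. f x $ j = g (h x))"
    using measurable_vimage_algebra_factor_real[OF measurable_vec_borelD(2)[OF f] h] by blast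
  from choice[OF this] obtain g
    where "\<forall>j. j < n \<longrightarrow> g j \<in> borel_measurable N \<and> (\<forall>x\<in>X. f x $ j = g j (h x))"
    by (elim exE)
  then have g: "\<And>j. j < n \<Longrightarrow> g j \<in> borel_measurable N"
    "\<And>j x. j < n \<Longrightarrow> x \<in> X \<Longrightarrow> f x $ j = g j (h x)"
    by simp_all
  show ?thesis
  proof (intro bexI ballI)
    show "(\<lambda>y. Matrix.vec n (\<lambda>j. g j y)) \<in> measurable N (vec_borel n)"
      using g(1) by (simp add: measurable_vec_borel_iff)
    show "f x = Matrix.vec n (\<lambda>j. g j (h x))" if "x \<in> X" for x
      using that g(2) measurable_vec_borelD(1)[OF f, of x] by (intro eq_vecI) auto
  qed
qed

lemma integrable_of_square:
  fixes f :: "'w \<Rightarrow> real"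
  assumes "finite_measure M" "f \<in> borel_measurable M" "integrable M (\<lambda>\<omega>. (f \<omega>)\<^sup>2)"
  shows "integrable M f"
  using integrable_mult_of_squares[of f M "\<lambda>_. 1"] assms
  by (simp add: finite_measure.integrable_const)

lemma square_integrable_index:
  assumes "finite_measure M" "square_integrable M n X" "j < n"
  shows "integrable M (\<lambda>\<omega>. X \<omega> $ j)"
  using assms
  by (rule_tac integrable_of_square) (auto simp: square_integrable_def measurable_vec_borel_iff)

section \<open>Conditional expectation of square integrable vectors\<close>

lemma vec_cond_exp_measurable: "vec_cond_exp M F n X \<in> measurable F (vec_borel n)"
  by (auto simp: measurable_vec_borel_iff vec_cond_exp_def)

context finite_measure_subalgebra
begin

lemma measurable_vec_from_subalg:
  "X \<in> measurable F N \<Longrightarrow> X \<in> measurable M N"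
  using measurable_from_subalg[OF subalg] .

text \<open>Conditional Jensen inequality for the square, coordinate by coordinate.\<close>

lemma square_integrable_cond_exp:
  assumes X: "square_integrable M n X"
  shows "square_integrable M n (vec_cond_exp M F n X)"
proof -
  have "integrable M (\<lambda>\<omega>. (real_cond_exp M F (\<lambda>\<omega>. X \<omega> $ j) \<omega>)\<^sup>2)" if "j < n" for j
  proof (rule integrable_convex_cond_exp[where I = UNIV])
    show "integrable M (\<lambda>\<omega>. X \<omega> $ j)"
      using square_integrable_index[OF finite_measure_axioms X that] .
    show "integrable M (\<lambda>\<omega>. (X \<omega> $ j)\<^sup>2)" using X that by (simp add: square_integrable_def)
    show "convex_on UNIV (\<lambda>x::real. x\<^sup>2)" by (rule convex_power2)
  qed auto
  then show ?thesis
    using measurable_vec_from_subalg[OF vec_cond_exp_measurable]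
    by (simp add: square_integrable_def vec_cond_exp_def)
qed

text \<open>Conditional expectation acts as an orthogonal projection: a known factor may be moved
  inside it, the products being integrable by square integrability.\<close>

lemma integral_scalar_prod_cond_exp:
  assumes Y: "square_integrable M n Y" "Y \<in> measurable F (vec_borel n)"
    and X: "square_integrable M n X"
  shows "(\<integral>\<omega>. Y \<omega> \<bullet> (X \<omega> - vec_cond_exp M F n X \<omega>) \<partial>M) = 0"
proof -
  note XC = square_integrable_cond_exp[OF X]
  have "(\<integral>\<omega>. Y \<omega> \<bullet> (X \<omega> - vec_cond_exp M F n X \<omega>) \<partial>M) =
      (\<integral>\<omega>. (\<Sum>j<n. Y \<omega> $ j * X \<omega> $ j - Y \<omega> $ j * vec_cond_exp M F n X \<omega> $ j) \<partial>M)"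
    using measurable_vec_dim[OF square_integrable_measurable[OF X]]
      measurable_vec_dim[OF square_integrable_measurable[OF XC]]
    by (intro Bochner_Integration.integral_cong)
      (simp_all add: scalar_prod_def atLeast0LessThan right_diff_distrib)
  also have "\<dots> = (\<Sum>j<n. (\<integral>\<omega>. Y \<omega> $ j * X \<omega> $ j \<partial>M) - (\<integral>\<omega>. Y \<omega> $ j * vec_cond_exp M F n X \<omega> $ j \<partial>M))"
    using square_integrable_index_mult[OF Y(1) X] square_integrable_index_mult[OF Y(1) XC]
    by (subst Bochner_Integration.integral_sum) auto
  also have "\<dots> = 0"
  proof (rule sum.neutral, intro ballI)
    fix j assume "j \<in> {..<n}"
    then show "(\<integral>\<omega>. Y \<omega> $ j * X \<omega> $ j \<partial>M) - (\<integral>\<omega>. Y \<omega> $ j * vec_cond_exp M F n X \<omega> $ j \<partial>M) = 0"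
      using real_cond_exp_intg(2)[of "\<lambda>\<omega>. Y \<omega> $ j" "\<lambda>\<omega>. X \<omega> $ j"]
        square_integrable_index_mult[OF Y(1) X] measurable_vec_borelD(2)[OF Y(2)]
        measurable_vec_borelD(2)[OF square_integrable_measurable[OF X]]
      by (simp add: vec_cond_exp_def)
  qed
  finally show ?thesis .
qed

text \<open>A known summand passes through the conditional expectation. The sum is required only on
  the space of M, which is where the decomposition of the state holds.\<close>

lemma vec_cond_exp_add_measurable:
  assumes X: "square_integrable M n X" and Z: "square_integrable M n Z" "Z \<in> measurable F (vec_borel n)"
    and Y: "Y \<in> measurable M (vec_borel n)" "\<And>\<omega>. \<omega> \<in> space M \<Longrightarrow> Y \<omega> = X \<omega> + Z \<omega>"
  shows "AE \<omega> in M. vec_cond_exp M F n Y \<omega> = vec_cond_exp M F n X \<omega> + Z \<omega>"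
proof -
  note Xm = measurable_vec_borelD[OF square_integrable_measurable[OF X]]
  note Zm = measurable_vec_borelD[OF square_integrable_measurable[OF Z(1)]]
  have "AE \<omega> in M. \<forall>j\<in>{..<n}. real_cond_exp M F (\<lambda>\<omega>. Y \<omega> $ j) \<omega> =
      real_cond_exp M F (\<lambda>\<omega>. X \<omega> $ j) \<omega> + Z \<omega> $ j"
  proof (rule AE_ball_countable[THEN iffD2], simp, intro ballI)
    fix j assume "j \<in> {..<n}"
    then have j: "j < n" by simp
    have iX: "integrable M (\<lambda>\<omega>. X \<omega> $ j)" and iZ: "integrable M (\<lambda>\<omega>. Z \<omega> $ j)"
      using square_integrable_index[OF finite_measure_axioms _ j] X Z(1) by auto
    have "AE \<omega> in M. real_cond_exp M F (\<lambda>\<omega>. Y \<omega> $ j) \<omega> = real_cond_exp M F (\<lambda>\<omega>. X \<omega> $ j + Z \<omega> $ j) \<omega>"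
      using Y j Zm(2) Xm(2) measurable_vec_borelD(2)[OF Y(1) j]
        measurable_vec_dim[OF square_integrable_measurable[OF X]]
        measurable_vec_dim[OF square_integrable_measurable[OF Z(1)]]
      by (intro real_cond_exp_cong) (auto intro!: AE_I2)
    moreover note real_cond_exp_add[OF iX iZ] real_cond_exp_F_meas[OF iZ measurable_vec_borelD(2)[OF Z(2) j]]
    ultimately show "AE \<omega> in M. real_cond_exp M F (\<lambda>\<omega>. Y \<omega> $ j) \<omega> =
        real_cond_exp M F (\<lambda>\<omega>. X \<omega> $ j) \<omega> + Z \<omega> $ j"
      by eventually_elim simp
  qed
  with AE_space show ?thesis
  proof eventually_elim
    case (elim \<omega>)
    with Zm(1)[of \<omega>] show ?case
      by (intro eq_vecI) (auto simp: vec_cond_exp_def)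
  qed
qed

end

section \<open>Moments of Gaussian vectors\<close>

lemma integrable_return:
  fixes f :: "'a \<Rightarrow> real"
  assumes "x \<in> space N" "f \<in> borel_measurable N"
  shows "integrable (return N x) f"
  using assms by (intro integrableI_bounded) (simp_all add: nn_integral_return)

text \<open>Variance zero gives the point mass at 0, which has no density and is treated
  separately.\<close>

lemma centered_normal_moments:
  assumes "0 \<le> s"
  shows "integrable (centered_normal s) (\<lambda>x. x\<^sup>2)" "(\<integral>x. x\<^sup>2 \<partial>centered_normal s) = s"
    "(\<integral>x. x \<partial>centered_normal s) = 0"
proof -
  show "integrable (centered_normal s) (\<lambda>x. x\<^sup>2)"
    using assms integrable_normal_moment[of "sqrt s" 0 2]
    by (cases "s = 0") (simp_all add: centered_normal_def integrable_density integrable_return)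
  show "(\<integral>x. x\<^sup>2 \<partial>centered_normal s) = s"
    using assms integral_normal_moment_even[of "sqrt s" 0 1]
    by (auto simp: centered_normal_def integral_return integral_density power_divide)
  show "(\<integral>x. x \<partial>centered_normal s) = 0"
    using assms integral_normal_moment_nz_1[of "sqrt s" 0]
    by (auto simp: centered_normal_def integral_return integral_density)
qed

text \<open>Coordinates are the linear forms given by unit vectors, so the one-dimensional laws in
  the definition determine these moments.\<close>

lemma centered_gaussian_moments:
  assumes X: "centered_gaussian M n S X" and S: "pos_semidef n S"
  shows "square_integrable M n X" "j < n \<Longrightarrow> (\<integral>\<omega>. X \<omega> $ j \<partial>M) = 0"
    "j < n \<Longrightarrow> (\<integral>\<omega>. (X \<omega> $ j)\<^sup>2 \<partial>M) = unit_vec n j \<bullet> (S *\<^sub>v unit_vec n j)"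
proof -
  have Xm: "X \<in> measurable M (vec_borel n)" using X by (simp add: centered_gaussian_def)
  note m = measurable_vec_borelD[OF Xm]
  have d: "distr M borel (\<lambda>\<omega>. X \<omega> $ j) = centered_normal (unit_vec n j \<bullet> (S *\<^sub>v unit_vec n j))"
    if "j < n" for j
  proof -
    have "distr M borel (\<lambda>\<omega>. X \<omega> $ j) = distr M borel (\<lambda>\<omega>. unit_vec n j \<bullet> X \<omega>)"
      using m(1) that by (intro distr_cong) auto
    then show ?thesis
      using X by (simp add: centered_gaussian_def)
  qed
  have nn: "0 \<le> unit_vec n j \<bullet> (S *\<^sub>v unit_vec n j)" for j
    using S by (simp add: pos_semidef_def)
  note c = centered_normal_moments[OF nn]
  show "square_integrable M n X"
    unfolding square_integrable_def
  proof (intro conjI allI impI Xm)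
    fix j assume j: "j < n"
    show "integrable M (\<lambda>\<omega>. (X \<omega> $ j)\<^sup>2)"
      using c(1)[of j] m(2)[OF j] unfolding d[OF j, symmetric]
      by (subst (asm) integrable_distr_eq) auto
  qed
  show "(\<integral>\<omega>. X \<omega> $ j \<partial>M) = 0" if j: "j < n"
    using c(3)[of j] m(2)[OF j] unfolding d[OF j, symmetric]
    by (subst (asm) integral_distr) auto
  show "(\<integral>\<omega>. (X \<omega> $ j)\<^sup>2 \<partial>M) = unit_vec n j \<bullet> (S *\<^sub>v unit_vec n j)" if j: "j < n"
    using c(2)[of j] m(2)[OF j] unfolding d[OF j, symmetric]
    by (subst (asm) integral_distr) auto
qed

section \<open>Averages along windows\<close>

lemma exists_le_average:
  fixes p :: "nat \<Rightarrow> real"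
  assumes "0 < l"
  obtains k where "t \<le> k" "k < t + l" "p k \<le> (\<Sum>j\<in>{t..<t + l}. p j) / real l"
proof (rule ccontr)
  note witness = that
  assume "\<not> thesis"
  then have "(\<Sum>j\<in>{t..<t + l}. p j) / real l < p k" if k: "k \<in> {t..<t + l}" for k
    using k witness[of k] by (auto intro: ccontr)
  then have "(\<Sum>k\<in>{t..<t + l}. (\<Sum>j\<in>{t..<t + l}. p j) / real l) < (\<Sum>k\<in>{t..<t + l}. p k)"
    using assms by (intro sum_strict_mono) auto
  then show False
    using assms by simp
qed

text \<open>If the sums of p grow at most linearly, every window of length about \<open>sqrt T\<close>
  after T contains an index where p is of order \<open>sqrt T\<close>; monotonicity of c then transfers the
  bound at this index back to T.\<close>

lemma limsup_average_le:
  fixes c J p :: "nat \<Rightarrow> real"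
  assumes c: "mono c" and p: "\<And>k. 0 \<le> p k" and le: "\<And>k. c k \<le> J k + p k"
    and sum_p: "\<And>k. (\<Sum>j<k. p j) \<le> C * J (k + N) + D * real k"
    and C: "0 \<le> C" and D: "0 \<le> D"
  shows "limsup (\<lambda>k. ennreal (c k / real k)) \<le> limsup (\<lambda>k. ennreal (J k / real k))"
proof (rule ccontr)
  assume "\<not> ?thesis"
  then have "limsup (\<lambda>k. ennreal (J k / real k)) < limsup (\<lambda>k. ennreal (c k / real k))"
    by (simp only: not_le)
  from dense[OF this] obtain b' where b': "limsup (\<lambda>k. ennreal (J k / real k)) < b'"
    "b' < limsup (\<lambda>k. ennreal (c k / real k))"
    by (elim exE conjE)
  define b where "b = enn2real b'"
  have "b' < \<infinity>" using b'(2) by (rule less_le_trans) simp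
  then have b'_eq: "b' = ennreal b" and b0: "0 \<le> b" by (simp_all add: b_def)
  have "\<forall>\<^sub>F k in sequentially. ennreal (J k / real k) < ennreal b"
    using b'(1) unfolding b'_eq by (rule Limsup_lessD)
  then obtain t0 where t0: "\<And>k. t0 \<le> k \<Longrightarrow> ennreal (J k / real k) < ennreal b"
    by (auto simp: eventually_sequentially)
  have J: "J k \<le> b * real k" if "t0 \<le> k" "0 < k" for k
  proof -
    have "J k / real k < b"
      using t0[OF that(1)] ennreal_leI[of b "J k / real k"] by (meson leD leI)
    then show ?thesis using that(2) by (simp add: field_simps)
  qed
  \<comment> \<open>The bound obtained for \<open>c t\<close> at \<open>x = t\<close>. The window
    has length between \<open>sqrt x\<close> and \<open>sqrt x + 1\<close>, so the averaged sum of p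
    is of order \<open>sqrt x\<close>, and \<open>r x / x\<close> tends to \<open>b\<close>.\<close>
  define r where "r x = b * (x + sqrt x + 1) +
    (C * (b * (x + sqrt x + 1 + real N)) + D * (x + sqrt x + 1)) / sqrt x" for x :: real
  have c_le: "c t \<le> r (real t)" if t: "max t0 1 \<le> t" for t
  proof -
    define l where "l = nat \<lceil>sqrt (real t)\<rceil>"
    have "1 \<le> sqrt (real t)" using t by simp
    then have l: "0 < l" "sqrt (real t) \<le> real l" "real l \<le> sqrt (real t) + 1"
      unfolding l_def by linarith+
    obtain k where k: "t \<le> k" "k < t + l" "p k \<le> (\<Sum>j\<in>{t..<t + l}. p j) / real l"
      by (rule exists_le_average[OF l(1)])
    define q where "q = C * (b * (real t + sqrt (real t) + 1 + real N)) + D * (real t + sqrt (real t) + 1)"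
    have q0: "0 \<le> q" using C D b0 by (simp add: q_def)
    have "(\<Sum>j\<in>{t..<t + l}. p j) \<le> (\<Sum>j<t + l. p j)"
      using p by (intro sum_mono2) auto
    also have "\<dots> \<le> C * J (t + l + N) + D * real (t + l)" by (rule sum_p)
    also have "\<dots> \<le> C * (b * real (t + l + N)) + D * real (t + l)"
      using J[of "t + l + N"] t C by (intro add_right_mono mult_left_mono) auto
    also have "\<dots> \<le> q"
      unfolding q_def using l C D b0 by (intro add_mono mult_left_mono) auto
    finally have "(\<Sum>j\<in>{t..<t + l}. p j) / real l \<le> q / real l"
      by (intro divide_right_mono) simp_all
    with k(3) have "p k \<le> q / real l" by (rule order_trans)
    also have "\<dots> \<le> q / sqrt (real t)"
      using l t q0 by (intro divide_left_mono mult_pos_pos) auto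
    finally have pk: "p k \<le> q / sqrt (real t)" .
    have "c t \<le> c k" using c k(1) by (rule monoD)
    also have "\<dots> \<le> J k + p k" by (rule le)
    also have "J k \<le> b * real k" using k(1) t by (intro J) auto
    also have "b * real k \<le> b * (real t + sqrt (real t) + 1)"
      using k(2) l(3) b0 by (intro mult_left_mono) auto
    finally show ?thesis
      using pk by (simp add: r_def q_def)
  qed
  have "limsup (\<lambda>k. ennreal (c k / real k)) \<le> limsup (\<lambda>k. ennreal (r (real k) / real k))"
    using c_le by (intro Limsup_mono eventually_sequentiallyI[of "max t0 1"] ennreal_leI divide_right_mono) auto
  also have "\<dots> = ennreal b"
  proof (rule lim_imp_Limsup)
    have "((\<lambda>x. r x / x) \<longlongrightarrow> b) at_top"
      unfolding r_def by real_asymp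
    then have "(\<lambda>k. r (real k) / real k) \<longlonglongrightarrow> b"
      by (rule filterlim_compose[OF _ filterlim_real_sequentially])
    then show "(\<lambda>k. ennreal (r (real k) / real k)) \<longlonglongrightarrow> ennreal b"
      by (rule tendsto_ennrealI)
  qed simp
  finally show False
    using b'(2) by (simp add: b'_eq)
qed

section \<open>Signals of one loop\<close>

lemma mult_mat_zero_vec:
  "(A :: real mat) \<in> carrier_mat k n \<Longrightarrow> A *\<^sub>v 0\<^sub>v n = 0\<^sub>v k"
  by (intro eq_vecI) auto

locale loop_signals =
  fixes s :: subsystem and L :: "real mat"
  assumes s: "subsystem_ok s" and L: "L \<in> carrier_mat (nx s) (ny s)"
begin

abbreviation no_input :: "nat \<Rightarrow> 'w \<Rightarrow> real vec" where
  "no_input \<equiv> \<lambda>_ _. 0\<^sub>v (nu s)"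

text \<open>The response to the inputs alone, from the zero state and without noise; as a function
  of past inputs it is known to the controller.\<close>

definition forced :: "(nat \<Rightarrow> 'w \<Rightarrow> real vec) \<Rightarrow> nat \<Rightarrow> 'w \<Rightarrow> real vec" where
  "forced u k \<omega> = lin_state (mA s) (mB s) (0\<^sub>v (nx s)) (\<lambda>l. u l \<omega>) k"

lemma forced_0 [simp]: "forced u 0 \<omega> = 0\<^sub>v (nx s)"
  and forced_Suc [simp]: "forced u (Suc k) \<omega> = mA s *\<^sub>v forced u k \<omega> + mB s *\<^sub>v u k \<omega>"
  by (simp_all add: forced_def)

lemmas dims = subsystem_okD(1-3)[OF s] L

lemmas mult_measurable = dims[THEN measurable_mult_mat_vec]

lemma state_carrier:
  assumes "\<And>p. \<zeta> p \<omega> \<in> carrier_vec (prim_dim s p)" "\<And>l. l < k \<Longrightarrow> u l \<omega> \<in> carrier_vec (nu s)"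
  shows "state s \<zeta> u k \<omega> \<in> carrier_vec (nx s)"
proof (cases k)
  case 0
  then show ?thesis using assms(1)[of X0] by simp
next
  case (Suc j)
  then show ?thesis using carrier_vecD[OF assms(1)[of "Wn j"]] by (intro carrier_vecI) simp
qed

lemma predicted_carrier:
  assumes "\<And>l. l < k \<Longrightarrow> u l \<omega> \<in> carrier_vec (nu s)"
  shows "predicted s L \<zeta> u k \<omega> \<in> carrier_vec (nx s)"
proof (cases k)
  case 0
  then show ?thesis by simp
next
  case (Suc j)
  then show ?thesis using dims(2) by (intro carrier_vecI) simp
qed

lemma forced_carrier:
  "(\<And>l. l < k \<Longrightarrow> u l \<omega> \<in> carrier_vec (nu s)) \<Longrightarrow> forced u k \<omega> \<in> carrier_vec (nx s)"
  by (cases k) (use dims in \<open>auto intro!: carrier_vecI\<close>)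

lemma state_decomp:
  assumes "\<And>p. \<zeta> p \<omega> \<in> carrier_vec (prim_dim s p)" "\<And>l. l < k \<Longrightarrow> u l \<omega> \<in> carrier_vec (nu s)"
  shows "state s \<zeta> u k \<omega> = state s \<zeta> no_input k \<omega> + forced u k \<omega>"
  using assms(2)
proof (induction k)
  case 0
  then show ?case using assms(1)[of X0] by simp
next
  case (Suc k)
  let ?x = "state s \<zeta> no_input k \<omega>"
  have x: "?x \<in> carrier_vec (nx s)" by (rule state_carrier[of \<zeta> \<omega>, OF assms(1)]) simp
  have f: "forced u k \<omega> \<in> carrier_vec (nx s)" using Suc.prems by (intro forced_carrier) simp
  have eq: "state s \<zeta> u k \<omega> = ?x + forced u k \<omega>" using Suc by simp
  have w: "\<zeta> (Wn k) \<omega> \<in> carrier_vec (nx s)" using assms(1)[of "Wn k"] by simp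
  have u: "u k \<omega> \<in> carrier_vec (nu s)" using Suc.prems by simp
  have "mA s *\<^sub>v (?x + forced u k \<omega>) = mA s *\<^sub>v ?x + mA s *\<^sub>v forced u k \<omega>"
    by (rule mult_add_distrib_mat_vec[OF dims(1) x f])
  then show ?case
    using dims w u by (intro eq_vecI) (simp_all add: eq mult_mat_zero_vec del: index_mult_mat_vec)
qed

text \<open>State and prediction are shifted by the same vector, so the innovation is unchanged and
  the filter passes the shift on.\<close>

lemma filter_decomp:
  assumes "\<And>p. \<zeta> p \<omega> \<in> carrier_vec (prim_dim s p)" "\<And>l. l < k \<Longrightarrow> u l \<omega> \<in> carrier_vec (nu s)"
  shows "predicted s L \<zeta> u k \<omega> = predicted s L \<zeta> no_input k \<omega> + forced u k \<omega>"
    and "filtered s L \<zeta> u k \<omega> = filtered s L \<zeta> no_input k \<omega> + forced u k \<omega>"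
proof -
  have upd: "filter_update s L (p + f) (mC s *\<^sub>v (x + f) + v) = filter_update s L p (mC s *\<^sub>v x + v) + f"
    if "p \<in> carrier_vec (nx s)" "f \<in> carrier_vec (nx s)" "x \<in> carrier_vec (nx s)" "v \<in> carrier_vec (ny s)"
    for p f x v
  proof -
    have "mC s *\<^sub>v (x + f) + v - mC s *\<^sub>v (p + f) = mC s *\<^sub>v x + v - mC s *\<^sub>v p"
      unfolding mult_add_distrib_mat_vec[OF dims(3) that(3,2)] mult_add_distrib_mat_vec[OF dims(3) that(1,2)]
      using dims that by (intro eq_vecI) (simp_all del: index_mult_mat_vec)
    moreover have "L *\<^sub>v (mC s *\<^sub>v x + v - mC s *\<^sub>v p) \<in> carrier_vec (nx s)"
      using dims(4) by (intro carrier_vecI) simp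
    ultimately show ?thesis
      using dims that unfolding filter_update_def by (intro eq_vecI) (simp_all del: index_mult_mat_vec)
  qed
  have pred_imp: "filtered s L \<zeta> u k \<omega> = filtered s L \<zeta> no_input k \<omega> + forced u k \<omega>"
    if "predicted s L \<zeta> u k \<omega> = predicted s L \<zeta> no_input k \<omega> + forced u k \<omega>"
      "\<And>l. l < k \<Longrightarrow> u l \<omega> \<in> carrier_vec (nu s)" for k
  proof -
    have "state s \<zeta> no_input k \<omega> \<in> carrier_vec (nx s)" by (rule state_carrier[of \<zeta> \<omega>, OF assms(1)]) simp
    moreover have "predicted s L \<zeta> no_input k \<omega> \<in> carrier_vec (nx s)" by (rule predicted_carrier) simp
    moreover have "forced u k \<omega> \<in> carrier_vec (nx s)" using that(2) by (rule forced_carrier)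
    moreover have "\<zeta> (Vn k) \<omega> \<in> carrier_vec (ny s)" using assms(1)[of "Vn k"] by simp
    ultimately show ?thesis
      using state_decomp[of \<zeta> \<omega> k u, OF assms(1) that(2)]
      by (simp add: filtered_def measured_def that(1) upd)
  qed
  show pred: "predicted s L \<zeta> u k \<omega> = predicted s L \<zeta> no_input k \<omega> + forced u k \<omega>"
    using assms(2)
  proof (induction k)
    case 0
    then show ?case by simp
  next
    case (Suc k)
    have u: "u k \<omega> \<in> carrier_vec (nu s)" using Suc.prems by simp
    have f: "forced u k \<omega> \<in> carrier_vec (nx s)" using Suc.prems by (intro forced_carrier) simp
    have filt: "filtered s L \<zeta> no_input k \<omega> \<in> carrier_vec (nx s)"
    proof -
      have "predicted s L \<zeta> no_input k \<omega> \<in> carrier_vec (nx s)" by (rule predicted_carrier) simp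
      then show ?thesis using dims(4) by (intro carrier_vecI) (simp add: filtered_def filter_update_def)
    qed
    have "filtered s L \<zeta> u k \<omega> = filtered s L \<zeta> no_input k \<omega> + forced u k \<omega>"
      using Suc by (intro pred_imp) auto
    then show ?case
      using dims u f filt mult_add_distrib_mat_vec[OF dims(1) filt f]
      by (intro eq_vecI) (simp_all flip: filtered_def add: mult_mat_zero_vec del: index_mult_mat_vec)
  qed
  show "filtered s L \<zeta> u k \<omega> = filtered s L \<zeta> no_input k \<omega> + forced u k \<omega>"
    by (rule pred_imp[OF pred assms(2)])
qed

lemma forced_measurable:
  assumes "\<And>l. l < k \<Longrightarrow> u l \<in> measurable N (vec_borel (nu s))"
  shows "forced u k \<in> measurable N (vec_borel (nx s))"
  using assms
proof (induction k)
  case 0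
  then show ?case by (simp add: measurable_vec_const)
next
  case (Suc k)
  have "(\<lambda>\<omega>. mA s *\<^sub>v forced u k \<omega> + mB s *\<^sub>v u k \<omega>) \<in> measurable N (vec_borel (nx s))"
    using Suc by (intro measurable_vec_add mult_measurable) auto
  then show ?case by (subst measurable_cong) auto
qed

lemma state_measurable:
  assumes "\<zeta> X0 \<in> measurable N (vec_borel (nx s))"
    "\<And>l. l < k \<Longrightarrow> \<zeta> (Wn l) \<in> measurable N (vec_borel (nx s))"
    "\<And>l. l < k \<Longrightarrow> u l \<in> measurable N (vec_borel (nu s))"
  shows "state s \<zeta> u k \<in> measurable N (vec_borel (nx s))"
  using assms(2,3)
proof (induction k)
  case 0
  have "(\<lambda>\<omega>. \<zeta> X0 \<omega>) \<in> measurable N (vec_borel (nx s))" using assms(1) by simp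
  then show ?case by (subst measurable_cong) auto
next
  case (Suc k)
  have "(\<lambda>\<omega>. mA s *\<^sub>v state s \<zeta> u k \<omega> + mB s *\<^sub>v u k \<omega> + \<zeta> (Wn k) \<omega>) \<in> measurable N (vec_borel (nx s))"
    using Suc by (intro measurable_vec_add mult_measurable) auto
  then show ?case by (subst measurable_cong) auto
qed

lemma filtered_measurable:
  assumes "\<zeta> X0 \<in> measurable N (vec_borel (nx s))"
    "\<And>l. l < k \<Longrightarrow> \<zeta> (Wn l) \<in> measurable N (vec_borel (nx s))"
    "\<And>l. l \<le> k \<Longrightarrow> \<zeta> (Vn l) \<in> measurable N (vec_borel (ny s))"
    "\<And>l. l < k \<Longrightarrow> u l \<in> measurable N (vec_borel (nu s))"
  shows "filtered s L \<zeta> u k \<in> measurable N (vec_borel (nx s))"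
proof -
  have filt: "filtered s L \<zeta> u j \<in> measurable N (vec_borel (nx s))"
    if "j \<le> k" "predicted s L \<zeta> u j \<in> measurable N (vec_borel (nx s))" for j
  proof -
    have "(\<lambda>\<omega>. predicted s L \<zeta> u j \<omega> + L *\<^sub>v (mC s *\<^sub>v state s \<zeta> u j \<omega> + \<zeta> (Vn j) \<omega> -
        mC s *\<^sub>v predicted s L \<zeta> u j \<omega>)) \<in> measurable N (vec_borel (nx s))"
      using that assms
      by (intro measurable_vec_add measurable_vec_diff mult_measurable state_measurable) auto
    then show ?thesis
      by (simp add: filtered_def[abs_def] filter_update_def measured_def)
  qed
  have "predicted s L \<zeta> u j \<in> measurable N (vec_borel (nx s))" if "j \<le> k" for j
    using that
  proof (induction j)
    case 0
    have "(\<lambda>\<omega>. 0\<^sub>v (nx s)) \<in> measurable N (vec_borel (nx s))" by (simp add: measurable_vec_const)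
    then show ?case by (subst measurable_cong) auto
  next
    case (Suc j)
    have "(\<lambda>\<omega>. mA s *\<^sub>v filtered s L \<zeta> u j \<omega> + mB s *\<^sub>v u j \<omega>) \<in> measurable N (vec_borel (nx s))"
      using Suc assms(4) by (intro measurable_vec_add mult_measurable filt) auto
    then show ?case by (subst measurable_cong) (auto simp: filtered_def)
  qed
  then show ?thesis by (intro filt) auto
qed

text \<open>A lost packet is recorded as zero, so \<open>\<phi>\<close> has to agree with the
  estimate only at successful transmissions. This freedom admits replacements built from the
  transmitted data alone.\<close>

lemma history_measurable:
  assumes "\<And>l. l \<le> k \<Longrightarrow> \<sigma> l \<in> measurable N (count_space UNIV)"
    and "\<And>l. l \<le> k \<Longrightarrow> \<phi> l \<in> measurable N (vec_borel (nx s))"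
    and eq: "\<And>l \<omega>. l \<le> k \<Longrightarrow> \<omega> \<in> space N \<Longrightarrow> \<sigma> l \<omega> = 1 \<Longrightarrow> filtered s L \<zeta> u l \<omega> = \<phi> l \<omega>"
  shows "history s L \<zeta> \<sigma> u k \<in> measurable N (history_space s k)"
proof -
  have "(\<lambda>\<omega>. \<lambda>l\<in>{..k}. (\<sigma> l \<omega>, if \<sigma> l \<omega> = 1 then \<phi> l \<omega> else 0\<^sub>v (nx s)))
      \<in> measurable N (history_space s k)"
    unfolding history_space_def
  proof (intro measurable_restrict measurable_Pair)
    fix l assume "l \<in> {..k}"
    then have l: "l \<le> k" by simp
    show "\<sigma> l \<in> measurable N (count_space UNIV)" using l by (rule assms(1))
    have "{\<omega> \<in> space N. \<sigma> l \<omega> = 1} \<in> sets N"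
    proof -
      have "\<sigma> l -` {1} \<inter> space N \<in> sets N"
        by (rule measurable_sets[OF assms(1)[OF l]]) simp
      then show ?thesis by (simp add: vimage_def Int_def conj_commute)
    qed
    then show "(\<lambda>\<omega>. if \<sigma> l \<omega> = 1 then \<phi> l \<omega> else 0\<^sub>v (nx s)) \<in> measurable N (vec_borel (nx s))"
      using assms(2)[OF l] by (intro measurable_If measurable_vec_const) auto
  qed
  then show ?thesis
    by (rule measurable_cong[THEN iffD2, rotated]) (auto simp: history_def eq intro!: restrict_ext)
qed

lemma history_components:
  assumes "history s L \<zeta> \<sigma> u k \<in> measurable N (history_space s k)" "l \<le> k"
  shows "\<sigma> l \<in> measurable N (count_space UNIV)"
    "(\<lambda>\<omega>. if \<sigma> l \<omega> = 1 then filtered s L \<zeta> u l \<omega> else 0\<^sub>v (nx s)) \<in> measurable N (vec_borel (nx s))"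
proof -
  have "history s L \<zeta> \<sigma> u k \<in> measurable N (PiM {..k} (\<lambda>_. count_space UNIV \<Otimes>\<^sub>M vec_borel (nx s)))"
    using assms(1) unfolding history_space_def .
  moreover have "(\<lambda>h. h l) \<in> measurable (PiM {..k} (\<lambda>_. count_space UNIV \<Otimes>\<^sub>M vec_borel (nx s)))
      (count_space UNIV \<Otimes>\<^sub>M vec_borel (nx s) :: (nat \<times> real vec) measure)"
    using assms(2) by (rule_tac measurable_component_singleton) simp
  ultimately have "(\<lambda>\<omega>. history s L \<zeta> \<sigma> u k \<omega> l) \<in> measurable N (count_space UNIV \<Otimes>\<^sub>M vec_borel (nx s))"
    by (rule measurable_compose)
  moreover have "history s L \<zeta> \<sigma> u k \<omega> l =
      (\<sigma> l \<omega>, if \<sigma> l \<omega> = 1 then filtered s L \<zeta> u l \<omega> else 0\<^sub>v (nx s))" for \<omega>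
    using assms(2) by (simp add: history_def)
  ultimately have "(\<lambda>\<omega>. (\<sigma> l \<omega>, if \<sigma> l \<omega> = 1 then filtered s L \<zeta> u l \<omega> else 0\<^sub>v (nx s)))
      \<in> measurable N (count_space UNIV \<Otimes>\<^sub>M vec_borel (nx s))"
    by (simp only:)
  from measurable_compose[OF this measurable_fst] measurable_compose[OF this measurable_snd]
  show "\<sigma> l \<in> measurable N (count_space UNIV)"
    "(\<lambda>\<omega>. if \<sigma> l \<omega> = 1 then filtered s L \<zeta> u l \<omega> else 0\<^sub>v (nx s)) \<in> measurable N (vec_borel (nx s))"
    by (simp_all only: fst_conv snd_conv)
qed

text \<open>There is no dual effect: the inputs only shift the transmitted estimates by known vectors.\<close>

lemma history_transfer:
  assumes \<zeta>: "\<And>p \<omega>. \<omega> \<in> space N \<Longrightarrow> \<zeta> p \<omega> \<in> carrier_vec (prim_dim s p)"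
    and u: "\<And>l. l < k \<Longrightarrow> u l \<in> measurable N (vec_borel (nu s))"
    and u': "\<And>l. l < k \<Longrightarrow> u' l \<in> measurable N (vec_borel (nu s))"
    and h: "history s L \<zeta> \<sigma> u k \<in> measurable N (history_space s k)"
  shows "history s L \<zeta> \<sigma> u' k \<in> measurable N (history_space s k)"
\<comment> \<open>The replacement may use only what the history reveals: from the transmitted value,
  or zero, the shift by \<open>u\<close> is removed and the shift by \<open>u'\<close> is added. At
  a lost packet the result is meaningless, but there it is never compared.\<close>
proof (rule history_measurable[where \<phi> = "\<lambda>l \<omega>. (if \<sigma> l \<omega> = 1 then filtered s L \<zeta> u l \<omega> else 0\<^sub>v (nx s))
      - forced u l \<omega> + forced u' l \<omega>"])
  fix l assume l: "l \<le> k"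
  show "\<sigma> l \<in> measurable N (count_space UNIV)" by (rule history_components(1)[OF h l])
  show "(\<lambda>\<omega>. (if \<sigma> l \<omega> = 1 then filtered s L \<zeta> u l \<omega> else 0\<^sub>v (nx s)) - forced u l \<omega> + forced u' l \<omega>)
      \<in> measurable N (vec_borel (nx s))"
    using l
    by (intro measurable_vec_add measurable_vec_diff history_components(2)[OF h l]
        forced_measurable[OF u] forced_measurable[OF u']) simp_all
  fix \<omega> assume \<omega>: "\<omega> \<in> space N" "\<sigma> l \<omega> = 1"
  have c: "u j \<omega> \<in> carrier_vec (nu s)" "u' j \<omega> \<in> carrier_vec (nu s)" if "j < l" for j
  proof -
    have "j < k" using that l by simp
    then show "u j \<omega> \<in> carrier_vec (nu s)" "u' j \<omega> \<in> carrier_vec (nu s)"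
      using measurable_vec_borelD(1)[OF u[of j] \<omega>(1)] measurable_vec_borelD(1)[OF u'[of j] \<omega>(1)]
      by simp_all
  qed
  have f: "forced u l \<omega> \<in> carrier_vec (nx s)" "forced u' l \<omega> \<in> carrier_vec (nx s)"
    by (rule forced_carrier, erule c(1), rule forced_carrier, erule c(2))
  have "predicted s L \<zeta> no_input l \<omega> \<in> carrier_vec (nx s)" by (rule predicted_carrier) simp
  then have x: "filtered s L \<zeta> no_input l \<omega> \<in> carrier_vec (nx s)"
    using dims(4) by (intro carrier_vecI) (simp add: filtered_def filter_update_def)
  have F: "filtered s L \<zeta> u l \<omega> = filtered s L \<zeta> no_input l \<omega> + forced u l \<omega>"
    by (rule filter_decomp(2)) (erule c(1) | rule \<zeta>[OF \<omega>(1)])+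
  have F': "filtered s L \<zeta> u' l \<omega> = filtered s L \<zeta> no_input l \<omega> + forced u' l \<omega>"
    by (rule filter_decomp(2)) (erule c(2) | rule \<zeta>[OF \<omega>(1)])+
  have "filtered s L \<zeta> u' l \<omega> = filtered s L \<zeta> u l \<omega> - forced u l \<omega> + forced u' l \<omega>"
    unfolding F F' using x f by (intro eq_vecI) simp_all
  then show "filtered s L \<zeta> u' l \<omega> =
      (if \<sigma> l \<omega> = 1 then filtered s L \<zeta> u l \<omega> else 0\<^sub>v (nx s)) - forced u l \<omega> + forced u' l \<omega>"
    unfolding if_P[OF \<omega>(2)] .
qed

lemma history_restrict:
  "l \<le> k \<Longrightarrow> history s L \<zeta> \<sigma> u l \<omega> = restrict (history s L \<zeta> \<sigma> u k \<omega>) {..l}"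
  by (auto simp: history_def restrict_def)

lemma history_measurable_mono:
  assumes "history s L \<zeta> \<sigma> u k \<in> measurable N (history_space s k)" "l \<le> k"
  shows "history s L \<zeta> \<sigma> u l \<in> measurable N (history_space s l)"
proof -
  have "(\<lambda>\<omega>. restrict (history s L \<zeta> \<sigma> u k \<omega>) {..l}) \<in> measurable N (history_space s l)"
    using assms unfolding history_space_def
    by (intro measurable_compose[OF _ measurable_restrict_subset]) auto
  then show ?thesis
    by (rule measurable_cong[THEN iffD2, rotated]) (simp add: history_restrict[OF assms(2)])
qed

end

section \<open>Information of the controller\<close>

text \<open>The sigma-algebra \<open>G k\<close> stands for everything that is determined before the process noise
  of time k acts, including the behaviour of the other loops.\<close>

locale lqg_loop = loop_signals s L + prob_space M
  for s :: subsystem and L :: "real mat" and M :: "'w measure" +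
  fixes \<zeta> :: "primitive \<Rightarrow> 'w \<Rightarrow> real vec" and \<sigma> :: "nat \<Rightarrow> 'w \<Rightarrow> nat"
    and G :: "nat \<Rightarrow> 'w measure" and P :: "real mat" and v :: "nat \<Rightarrow> real"
  assumes P: "pos_def (nx s) P" and riccati: "control_riccati s P"
    and primitive_measurable: "\<zeta> p \<in> measurable M (vec_borel (prim_dim s p))"
    and G_subalgebra: "subalgebra M (G k)"
    and G_X0: "\<zeta> X0 \<in> measurable (G k) (vec_borel (nx s))"
    and G_W: "l < k \<Longrightarrow> \<zeta> (Wn l) \<in> measurable (G k) (vec_borel (nx s))"
    and G_V: "l \<le> k \<Longrightarrow> \<zeta> (Vn l) \<in> measurable (G k) (vec_borel (ny s))"
    and G_success: "l \<le> k \<Longrightarrow> \<sigma> l \<in> measurable (G k) (count_space UNIV)"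
    and X0_square_integrable: "square_integrable M (nx s) (\<zeta> X0)"
    and W_square_integrable: "square_integrable M (nx s) (\<zeta> (Wn k))"
    and W_variance: "j < nx s \<Longrightarrow> (\<integral>\<omega>. (\<zeta> (Wn k) \<omega> $ j)\<^sup>2 \<partial>M) = v j"
    and W_orthogonal: "j < nx s \<Longrightarrow> Y \<in> borel_measurable (G k) \<Longrightarrow> integrable M Y \<Longrightarrow>
      (\<integral>\<omega>. \<zeta> (Wn k) \<omega> $ j * Y \<omega> \<partial>M) = 0"
begin

abbreviation info :: "(nat \<Rightarrow> 'w \<Rightarrow> real vec) \<Rightarrow> nat \<Rightarrow> 'w measure" where
  "info u k \<equiv> info_algebra M s L \<zeta> \<sigma> u k"

text \<open>The loop without inputs is the reference; \<open>info_eq_F\<close> identifies the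
  information generated by any adapted input with it.\<close>

abbreviation F :: "nat \<Rightarrow> 'w measure" where
  "F \<equiv> info no_input"

lemma primitive_carrier: "\<omega> \<in> space M \<Longrightarrow> \<zeta> p \<omega> \<in> carrier_vec (prim_dim s p)"
  using measurable_vec_borelD(1)[OF primitive_measurable] .

lemma space_info [simp]: "space (info u k) = space M"
  by (simp add: info_algebra_def)

lemma space_G [simp]: "space (G k) = space M"
  using G_subalgebra by (simp add: subalgebra_def)

lemma no_input_measurable: "no_input l \<in> measurable N (vec_borel (nu s))"
  by (simp add: measurable_vec_const)

lemma history_no_input_measurable_G:
  "history s L \<zeta> \<sigma> no_input k \<in> measurable (G k) (history_space s k)"
proof (rule history_measurable[where \<phi> = "filtered s L \<zeta> no_input"])
  fix l assume "l \<le> k"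
  then show "\<sigma> l \<in> measurable (G k) (count_space UNIV)" by (rule G_success)
  show "filtered s L \<zeta> no_input l \<in> measurable (G k) (vec_borel (nx s))"
    using \<open>l \<le> k\<close>
    by (rule_tac filtered_measurable) (simp_all add: G_X0 G_W G_V no_input_measurable)
qed simp

lemma sets_info_subset:
  assumes "space N = space M" "history s L \<zeta> \<sigma> u k \<in> measurable N (history_space s k)"
  shows "sets (info u k) \<subseteq> sets N"
  unfolding info_algebra_def using assms by (rule sets_image_in_sets)

lemma measurable_sets_mono:
  assumes "f \<in> measurable N T" "sets N \<subseteq> sets N'" "space N = space N'"
  shows "f \<in> measurable N' T"
  using assms unfolding measurable_def by auto

lemma F_subalgebra_G: "sets (F k) \<subseteq> sets (G k)"
  by (rule sets_info_subset[OF space_G history_no_input_measurable_G])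

lemma F_measurable_G: "f \<in> measurable (F k) T \<Longrightarrow> f \<in> measurable (G k) T"
  by (rule measurable_sets_mono[OF _ F_subalgebra_G]) simp_all

lemma G_measurable_M: "f \<in> measurable (G k) T \<Longrightarrow> f \<in> measurable M T"
  by (rule measurable_from_subalg[OF G_subalgebra])

lemma F_measurable_M: "f \<in> measurable (F k) T \<Longrightarrow> f \<in> measurable M T"
  by (rule G_measurable_M[OF F_measurable_G])

lemma F_subalgebra: "finite_measure_subalgebra M (F k)"
proof (unfold_locales)
  have "sets (F k) \<subseteq> sets M"
    using F_subalgebra_G G_subalgebra by (auto simp: subalgebra_def)
  then show "subalgebra M (F k)" by (simp add: subalgebra_def)
qed

lemma history_measurable_info:
  assumes "history s L \<zeta> \<sigma> u k \<in> measurable M (history_space s k)"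
  shows "history s L \<zeta> \<sigma> u k \<in> measurable (info u k) (history_space s k)"
  unfolding info_algebra_def
  using measurable_space[OF assms] by (intro measurable_vimage_algebra1) auto

lemma sets_info_mono:
  assumes "history s L \<zeta> \<sigma> u k \<in> measurable M (history_space s k)" "l \<le> k"
  shows "sets (info u l) \<subseteq> sets (info u k)"
  by (rule sets_info_subset[OF space_info
        history_measurable_mono[OF history_measurable_info[OF assms(1)] assms(2)]])

lemma F_mono:
  assumes "f \<in> measurable (F l) T" "l \<le> k"
  shows "f \<in> measurable (F k) T"
  using assms(1)
  by (rule measurable_sets_mono[OF _ sets_info_mono[OF G_measurable_M[OF history_no_input_measurable_G] assms(2)]])
    simp

definition adapted :: "(nat \<Rightarrow> 'w \<Rightarrow> real vec) \<Rightarrow> bool" where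
  "adapted u \<longleftrightarrow> (\<forall>k. u k \<in> measurable (F k) (vec_borel (nu s)))"

text \<open>Only inputs strictly before \<open>k\<close> are required, which lets
  \<open>policy_adapted\<close> proceed by induction on time.\<close>

lemma history_measurable_F:
  assumes "\<And>l. l < k \<Longrightarrow> u l \<in> measurable (F l) (vec_borel (nu s))"
  shows "history s L \<zeta> \<sigma> u k \<in> measurable (F k) (history_space s k)"
proof (rule history_transfer)
  show "history s L \<zeta> \<sigma> no_input k \<in> measurable (F k) (history_space s k)"
    by (rule history_measurable_info[OF G_measurable_M[OF history_no_input_measurable_G]])
  fix l assume l: "l < k"
  show "u l \<in> measurable (F k) (vec_borel (nu s))"
    by (rule F_mono[OF assms[OF l]]) (use l in simp)
  show "no_input l \<in> measurable (F k) (vec_borel (nu s))" by (rule no_input_measurable)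
next
  show "\<zeta> p \<omega> \<in> carrier_vec (prim_dim s p)" if "\<omega> \<in> space (F k)" for p \<omega>
    using that by (simp add: primitive_carrier)
qed

lemma policy_adapted:
  assumes "\<gamma> \<in> policies s"
  shows "adapted (input s L \<zeta> \<sigma> \<gamma>)"
proof -
  have "input s L \<zeta> \<sigma> \<gamma> k \<in> measurable (F k) (vec_borel (nu s))" for k
  proof (induction k rule: less_induct)
    case (less k)
    have "history s L \<zeta> \<sigma> (input s L \<zeta> \<sigma> \<gamma>) k \<in> measurable (F k) (history_space s k)"
      by (rule history_measurable_F[OF less])
    moreover have "\<gamma> k \<in> measurable (history_space s k) (vec_borel (nu s))"
      using assms by (simp add: policies_def)
    ultimately have "(\<lambda>\<omega>. \<gamma> k (history s L \<zeta> \<sigma> (input s L \<zeta> \<sigma> \<gamma>) k \<omega>)) \<in> measurable (F k) (vec_borel (nu s))"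
      by (rule measurable_compose)
    moreover have "input s L \<zeta> \<sigma> \<gamma> k = (\<lambda>\<omega>. \<gamma> k (history s L \<zeta> \<sigma> (input s L \<zeta> \<sigma> \<gamma>) k \<omega>))"
      by (rule ext) (rule input_eq)
    ultimately show ?case by (simp only:)
  qed
  then show ?thesis by (simp add: adapted_def)
qed

text \<open>The history is transferred in both directions. That \<open>F k\<close> contains the
  information under \<open>u\<close> follows from adaptedness. For the converse, earlier inputs must
  be measurable in the information generated by \<open>u\<close> itself, which is what the induction
  hypothesis supplies.\<close>

lemma info_eq_F:
  assumes u: "adapted u"
  shows "info u k = F k"
proof (induction k rule: less_induct)
  case (less k)
  have u': "u l \<in> measurable (F l) (vec_borel (nu s))" for l using u by (simp add: adapted_def)
  have hF: "history s L \<zeta> \<sigma> u k \<in> measurable (F k) (history_space s k)"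
    by (rule history_measurable_F[OF u'])
  have hM: "history s L \<zeta> \<sigma> u k \<in> measurable M (history_space s k)"
    by (rule F_measurable_M[OF hF])
  have "history s L \<zeta> \<sigma> no_input k \<in> measurable (info u k) (history_space s k)"
  proof (rule history_transfer)
    show "history s L \<zeta> \<sigma> u k \<in> measurable (info u k) (history_space s k)"
      by (rule history_measurable_info[OF hM])
    fix l assume l: "l < k"
    have "u l \<in> measurable (info u l) (vec_borel (nu s))"
      unfolding less[OF l] by (rule u')
    then show "u l \<in> measurable (info u k) (vec_borel (nu s))"
      by (rule measurable_sets_mono[OF _ sets_info_mono[OF hM]]) (use l in simp_all)
    show "no_input l \<in> measurable (info u k) (vec_borel (nu s))" by (rule no_input_measurable)
  next
    show "\<zeta> p \<omega> \<in> carrier_vec (prim_dim s p)" if "\<omega> \<in> space (info u k)" for p \<omega>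
      using that by (simp add: primitive_carrier)
  qed
  then have "sets (F k) \<subseteq> sets (info u k)" by (rule sets_info_subset[OF space_info])
  moreover have "sets (info u k) \<subseteq> sets (F k)" by (rule sets_info_subset[OF space_info hF])
  ultimately have "sets (info u k) = sets (F k)" by (intro equalityI)
  \<comment> \<open>Equality of measures also asks for equal values; both sigma-algebras carry the
    zero measure.\<close>
  then show ?case
    by (rule measure_eqI) (simp add: info_algebra_def vimage_algebra_def emeasure_sigma)
qed

section \<open>Conditional mean of the state and the certainty equivalent input\<close>

lemma forced_square_integrable:
  assumes "\<And>l. l < k \<Longrightarrow> square_integrable M (nu s) (u l)"
  shows "square_integrable M (nx s) (forced u k)"
  using assms
proof (induction k)
  case 0
  have "square_integrable M (nx s) (\<lambda>\<omega>. 0\<^sub>v (nx s))"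
    by (rule square_integrable_const) (simp_all add: finite_measure_axioms)
  then show ?case by simp
next
  case (Suc k)
  have "square_integrable M (nx s) (\<lambda>\<omega>. mA s *\<^sub>v forced u k \<omega> + mB s *\<^sub>v u k \<omega>)"
    using Suc by (intro square_integrable_add square_integrable_mult_mat[OF dims(1)]
        square_integrable_mult_mat[OF dims(2)]) simp_all
  then show ?case by simp
qed

lemma state_square_integrable:
  assumes "\<And>l. l < k \<Longrightarrow> square_integrable M (nu s) (u l)"
  shows "square_integrable M (nx s) (state s \<zeta> u k)"
  using assms
proof (induction k)
  case 0
  then show ?case using X0_square_integrable by simp
next
  case (Suc k)
  have "square_integrable M (nx s) (\<lambda>\<omega>. mA s *\<^sub>v state s \<zeta> u k \<omega> + mB s *\<^sub>v u k \<omega> + \<zeta> (Wn k) \<omega>)"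
    using Suc W_square_integrable
    by (intro square_integrable_add square_integrable_mult_mat[OF dims(1)]
        square_integrable_mult_mat[OF dims(2)]) simp_all
  then show ?case by simp
qed

lemma no_input_square_integrable: "square_integrable M (nu s) (no_input l)"
  by (rule square_integrable_const) (simp_all add: finite_measure_axioms)

abbreviation free_state :: "nat \<Rightarrow> 'w \<Rightarrow> real vec" where
  "free_state \<equiv> state s \<zeta> no_input"

definition free_estimate :: "nat \<Rightarrow> 'w \<Rightarrow> real vec" where
  "free_estimate k = vec_cond_exp M (F k) (nx s) (free_state k)"

lemma free_state_square_integrable: "square_integrable M (nx s) (free_state k)"
  by (rule state_square_integrable[OF no_input_square_integrable])

lemma free_estimate_measurable: "free_estimate k \<in> measurable (F k) (vec_borel (nx s))"
  unfolding free_estimate_def by (rule vec_cond_exp_measurable)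

lemma free_estimate_square_integrable: "square_integrable M (nx s) (free_estimate k)"
  unfolding free_estimate_def
  by (rule finite_measure_subalgebra.square_integrable_cond_exp[OF F_subalgebra free_state_square_integrable])

lemma adapted_carrier: "adapted u \<Longrightarrow> \<omega> \<in> space M \<Longrightarrow> u k \<omega> \<in> carrier_vec (nu s)"
  using measurable_vec_borelD(1)[of "u k" "F k" "nu s" \<omega>] by (simp add: adapted_def)

lemma state_decomp_adapted:
  assumes "adapted u" "\<omega> \<in> space M"
  shows "state s \<zeta> u k \<omega> = free_state k \<omega> + forced u k \<omega>"
  by (rule state_decomp) (rule primitive_carrier[OF assms(2)], rule adapted_carrier[OF assms])

lemma adapted_measurable_F: "adapted u \<Longrightarrow> l \<le> k \<Longrightarrow> u l \<in> measurable (F k) (vec_borel (nu s))"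
  unfolding adapted_def by (rule F_mono[of _ l]) simp_all

lemma forced_adapted_measurable: "adapted u \<Longrightarrow> forced u k \<in> measurable (F k) (vec_borel (nx s))"
  by (rule forced_measurable) (simp add: adapted_measurable_F)

text \<open>The forced part is measurable in the information and merely shifts the conditional mean.
  Square integrability is asked only before \<open>k\<close>, so that the lemma can be used in
  inductions over time.\<close>

lemma cond_exp_state:
  assumes u: "adapted u" "\<And>l. l < k \<Longrightarrow> square_integrable M (nu s) (u l)"
  shows "AE \<omega> in M. vec_cond_exp M (info u k) (nx s) (state s \<zeta> u k) \<omega> = free_estimate k \<omega> + forced u k \<omega>"
  unfolding info_eq_F[OF u(1)] free_estimate_def
  by (rule finite_measure_subalgebra.vec_cond_exp_add_measurable[OF F_subalgebra
        free_state_square_integrable forced_square_integrable[OF u(2)] forced_adapted_measurable[OF u(1)]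
        square_integrable_measurable[OF state_square_integrable[OF u(2)]] state_decomp_adapted[OF u(1)]])

abbreviation K :: "real mat" where
  "K \<equiv> control_gain s P"

lemmas K_carrier = control_gain_carrier[OF s P]

text \<open>Resolves the circular feedback law: this is the forced state under the input defined
  next, written so that the recursion refers only to \<open>free_estimate\<close>, which no policy
  influences.\<close>

primrec ce_forced :: "nat \<Rightarrow> 'w \<Rightarrow> real vec" where
  "ce_forced 0 = (\<lambda>\<omega>. 0\<^sub>v (nx s))"
| "ce_forced (Suc k) =
    (\<lambda>\<omega>. mA s *\<^sub>v ce_forced k \<omega> + mB s *\<^sub>v (K *\<^sub>v (free_estimate k \<omega> + ce_forced k \<omega>)))"

definition ce_input :: "nat \<Rightarrow> 'w \<Rightarrow> real vec" where
  "ce_input k \<omega> = K *\<^sub>v (free_estimate k \<omega> + ce_forced k \<omega>)"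

lemma forced_ce_input: "forced ce_input k = ce_forced k"
  by (induction k) (auto simp: fun_eq_iff ce_input_def)

text \<open>Kept conditional because the induction for \<open>ce_forced\<close> needs the input
  measurable at each step.\<close>

lemma ce_input_measurable_of:
  "ce_forced k \<in> measurable (F k) (vec_borel (nx s)) \<Longrightarrow> ce_input k \<in> measurable (F k) (vec_borel (nu s))"
  unfolding ce_input_def[abs_def]
  by (intro measurable_mult_mat_vec[OF K_carrier] measurable_vec_add free_estimate_measurable)

lemma ce_forced_measurable: "ce_forced k \<in> measurable (F k) (vec_borel (nx s))"
proof (induction k)
  case 0
  then show ?case by (simp add: measurable_vec_const)
next
  case (Suc k)
  have "(\<lambda>\<omega>. mA s *\<^sub>v ce_forced k \<omega> + mB s *\<^sub>v ce_input k \<omega>) \<in> measurable (F k) (vec_borel (nx s))"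
    by (intro measurable_vec_add mult_measurable(1,2) Suc ce_input_measurable_of)
  then have "ce_forced (Suc k) \<in> measurable (F k) (vec_borel (nx s))"
    by (simp add: ce_input_def)
  then show ?case by (rule F_mono) simp
qed

lemma ce_input_adapted: "adapted ce_input"
  unfolding adapted_def by (intro allI ce_input_measurable_of ce_forced_measurable)

lemma ce_input_square_integrable: "square_integrable M (nu s) (ce_input k)"
proof (induction k rule: less_induct)
  case (less k)
  have "square_integrable M (nx s) (ce_forced k)"
    using forced_square_integrable[of k ce_input, OF less] by (simp only: forced_ce_input)
  then show ?case
    unfolding ce_input_def[abs_def]
    by (intro square_integrable_mult_mat[OF K_carrier] square_integrable_add free_estimate_square_integrable)
qed

text \<open>Being adapted, \<open>ce_input\<close> is measurable in the information of its own loop,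
  so it factors through the history. The factor is the policy, and closing the loop with it
  reproduces \<open>ce_input\<close>.\<close>

lemma certainty_equivalent_exists:
  "\<exists>\<gamma>\<in>policies s. certainty_equivalent M s L \<zeta> \<sigma> K \<gamma>"
proof -
  let ?h = "history s L \<zeta> \<sigma> ce_input"
  have hM: "?h k \<in> measurable M (history_space s k)" for k
    using history_measurable_F[of k ce_input] ce_input_adapted F_measurable_M by (simp add: adapted_def)
  have "\<forall>k. \<exists>g. g \<in> measurable (history_space s k) (vec_borel (nu s)) \<and>
      (\<forall>\<omega>\<in>space M. ce_input k \<omega> = g (?h k \<omega>))"
  proof
    fix k
    have "ce_input k \<in> measurable (info ce_input k) (vec_borel (nu s))"
      using ce_input_adapted unfolding info_eq_F[OF ce_input_adapted] by (simp add: adapted_def)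
    then show "\<exists>g. g \<in> measurable (history_space s k) (vec_borel (nu s)) \<and>
        (\<forall>\<omega>\<in>space M. ce_input k \<omega> = g (?h k \<omega>))"
      unfolding info_algebra_def
      using measurable_vimage_algebra_factor_vec[of "ce_input k" "space M" "?h k" "history_space s k" "nu s"]
        measurable_space[OF hM[of k]] by (auto simp: Bex_def)
  qed
  from choice[OF this] obtain \<gamma> where \<gamma>: "\<forall>k. \<gamma> k \<in> measurable (history_space s k) (vec_borel (nu s)) \<and>
      (\<forall>\<omega>\<in>space M. ce_input k \<omega> = \<gamma> k (?h k \<omega>))"
    by (elim exE)
  then have pol: "\<gamma> \<in> policies s" by (simp add: policies_def)
  let ?u = "input s L \<zeta> \<sigma> \<gamma>"
  \<comment> \<open>Equality holds at every sample point because the factorization does; strong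
    induction suits the history, which involves only earlier inputs.\<close>
  have u_eq: "?u k \<omega> = ce_input k \<omega>" if "\<omega> \<in> space M" for k \<omega>
  proof (induction k rule: less_induct)
    case (less k)
    have "history s L \<zeta> \<sigma> ?u k \<omega> = ?h k \<omega>" by (rule history_cong) (rule less)
    then show ?case using \<gamma> that input_eq[of s L \<zeta> \<sigma> \<gamma> k \<omega>] by simp
  qed
  note ad = policy_adapted[OF pol]
  have sq: "square_integrable M (nu s) (?u k)" for k
  proof (rule square_integrable_cong_AE[OF ce_input_square_integrable])
    show "?u k \<in> measurable M (vec_borel (nu s))"
      by (rule F_measurable_M[OF adapted_measurable_F[OF ad order_refl]])
    show "AE \<omega> in M. ce_input k \<omega> = ?u k \<omega>" using u_eq by (intro AE_I2) simp
  qed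
  have "AE \<omega> in M. ?u k \<omega> = K *\<^sub>v vec_cond_exp M (info ?u k) (nx s) (state s \<zeta> ?u k) \<omega>" for k
    using cond_exp_state[of ?u k, OF ad sq] AE_space
  proof eventually_elim
    case (elim \<omega>)
    have "forced ?u k \<omega> = forced ce_input k \<omega>"
      unfolding forced_def using u_eq[OF elim(2)] by simp
    then show ?case
      using elim u_eq[OF elim(2)] by (simp add: forced_ce_input ce_input_def)
  qed
  then show ?thesis
    using pol unfolding certainty_equivalent_def Let_def by (intro bexI[of _ \<gamma>] allI)
qed

end

section \<open>Costs\<close>

lemma square_integrable_quadratic:
  "S \<in> carrier_mat n n \<Longrightarrow> square_integrable M n X \<Longrightarrow> integrable M (\<lambda>\<omega>. X \<omega> \<bullet> (S *\<^sub>v X \<omega>))"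
  by (intro square_integrable_scalar_prod square_integrable_mult_mat)

context lqg_loop
begin

abbreviation W :: "real mat" where
  "W \<equiv> control_weight s P"

lemmas P_psd = pos_def_imp_pos_semidef[OF P]
lemmas W_psd = pos_def_imp_pos_semidef[OF control_weight_pos_def[OF s P]]
lemmas P_carrier = pos_semidefD(1)[OF P_psd]
lemmas W_carrier = pos_semidefD(1)[OF W_psd]
lemmas Q_carrier = pos_semidefD(1)[OF subsystem_okD(6)[OF s]]
lemmas R_carrier = pos_semidefD(1)[OF pos_def_imp_pos_semidef[OF subsystem_okD(7)[OF s]]]

definition estimation_error :: "nat \<Rightarrow> 'w \<Rightarrow> real vec" where
  "estimation_error k \<omega> = free_state k \<omega> - free_estimate k \<omega>"

definition error_cost :: "nat \<Rightarrow> real" where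
  "error_cost k = (\<integral>\<omega>. (K *\<^sub>v estimation_error k \<omega>) \<bullet> (W *\<^sub>v (K *\<^sub>v estimation_error k \<omega>)) \<partial>M)"

definition noise_cost :: "nat \<Rightarrow> real" where
  "noise_cost k = (\<integral>\<omega>. \<zeta> (Wn k) \<omega> \<bullet> (P *\<^sub>v \<zeta> (Wn k) \<omega>) \<partial>M)"

definition unavoidable_cost :: "nat \<Rightarrow> real" where
  "unavoidable_cost T =
     (\<integral>\<omega>. \<zeta> X0 \<omega> \<bullet> (P *\<^sub>v \<zeta> X0 \<omega>) \<partial>M) + (\<Sum>k<T. error_cost k + noise_cost k)"

definition expected_cost :: "(nat \<Rightarrow> 'w \<Rightarrow> real vec) \<Rightarrow> nat \<Rightarrow> real" where
  "expected_cost u T = (\<integral>\<omega>. (\<Sum>k<T. stage_cost s (state s \<zeta> u k \<omega>) (u k \<omega>)) \<partial>M)"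

definition terminal_cost :: "(nat \<Rightarrow> 'w \<Rightarrow> real vec) \<Rightarrow> nat \<Rightarrow> real" where
  "terminal_cost u k = (\<integral>\<omega>. state s \<zeta> u k \<omega> \<bullet> (P *\<^sub>v state s \<zeta> u k \<omega>) \<partial>M)"

text \<open>For square integrable adapted inputs the vector in parentheses is almost surely the
  conditional mean of the state, by \<open>cond_exp_state\<close>; the deviation is thus measured
  from the certainty equivalent feedback.\<close>

definition deviation :: "(nat \<Rightarrow> 'w \<Rightarrow> real vec) \<Rightarrow> nat \<Rightarrow> 'w \<Rightarrow> real vec" where
  "deviation u k \<omega> = u k \<omega> - K *\<^sub>v (free_estimate k \<omega> + forced u k \<omega>)"

definition deviation_cost :: "(nat \<Rightarrow> 'w \<Rightarrow> real vec) \<Rightarrow> nat \<Rightarrow> real" where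
  "deviation_cost u k = (\<integral>\<omega>. deviation u k \<omega> \<bullet> (W *\<^sub>v deviation u k \<omega>) \<partial>M)"

lemma estimation_error_square_integrable: "square_integrable M (nx s) (estimation_error k)"
  unfolding estimation_error_def[abs_def]
  by (intro square_integrable_diff free_state_square_integrable free_estimate_square_integrable)

lemma error_cost_nonneg: "0 \<le> error_cost k"
  unfolding error_cost_def
proof (rule integral_nonneg_AE, rule AE_I2)
  fix \<omega> assume "\<omega> \<in> space M"
  then have "estimation_error k \<omega> \<in> carrier_vec (nx s)"
    by (rule measurable_vec_borelD(1)[OF square_integrable_measurable[OF estimation_error_square_integrable]])
  then show "0 \<le> (K *\<^sub>v estimation_error k \<omega>) \<bullet> (W *\<^sub>v (K *\<^sub>v estimation_error k \<omega>))"
    by (intro pos_semidefD(3)[OF W_psd] mult_mat_vec_carrier[OF K_carrier])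
qed

lemma noise_carrier: "\<omega> \<in> space M \<Longrightarrow> \<zeta> (Wn k) \<omega> \<in> carrier_vec (nx s)"
  using primitive_carrier[of \<omega> "Wn k"] by simp

lemma noise_cost_nonneg: "0 \<le> noise_cost k"
  unfolding noise_cost_def
  by (rule integral_nonneg_AE, rule AE_I2, rule pos_semidefD(3)[OF P_psd noise_carrier])

lemma mono_unavoidable_cost: "mono unavoidable_cost"
  by (rule incseq_SucI) (simp add: unavoidable_cost_def error_cost_nonneg noise_cost_nonneg)

lemma noise_orthogonal:
  assumes "square_integrable M (nx s) Y" "Y \<in> measurable (G k) (vec_borel (nx s))"
  shows "(\<integral>\<omega>. \<zeta> (Wn k) \<omega> \<bullet> Y \<omega> \<partial>M) = 0"
proof -
  have "(\<integral>\<omega>. \<zeta> (Wn k) \<omega> \<bullet> Y \<omega> \<partial>M) = (\<integral>\<omega>. (\<Sum>j<nx s. \<zeta> (Wn k) \<omega> $ j * Y \<omega> $ j) \<partial>M)"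
    using measurable_vec_dim[OF square_integrable_measurable[OF assms(1)]]
    by (intro Bochner_Integration.integral_cong) (simp_all add: scalar_prod_def atLeast0LessThan)
  also have "\<dots> = (\<Sum>j<nx s. \<integral>\<omega>. \<zeta> (Wn k) \<omega> $ j * Y \<omega> $ j \<partial>M)"
    using square_integrable_index_mult[OF W_square_integrable assms(1)]
    by (intro Bochner_Integration.integral_sum) simp
  also have "\<dots> = 0"
    using W_orthogonal measurable_vec_borelD(2)[OF assms(2)]
      square_integrable_index[OF finite_measure_axioms assms(1)]
    by (intro sum.neutral ballI) simp
  finally show ?thesis .
qed

lemma state_carrier_adapted:
  assumes "adapted u" "\<omega> \<in> space M"
  shows "state s \<zeta> u k \<omega> \<in> carrier_vec (nx s)"
  by (rule state_carrier) (rule primitive_carrier[OF assms(2)], rule adapted_carrier[OF assms])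

lemma terminal_cost_nonneg: "adapted u \<Longrightarrow> 0 \<le> terminal_cost u k"
  unfolding terminal_cost_def
  by (rule integral_nonneg_AE, rule AE_I2, rule pos_semidefD(3)[OF P_psd state_carrier_adapted])

lemma deviation_cost_nonneg:
  assumes "adapted u"
  shows "0 \<le> deviation_cost u k"
  unfolding deviation_cost_def
proof (rule integral_nonneg_AE, rule AE_I2)
  fix \<omega> assume "\<omega> \<in> space M"
  then have "deviation u k \<omega> \<in> carrier_vec (nu s)"
    using adapted_carrier[OF assms] K_carrier unfolding deviation_def by (intro carrier_vecI) simp
  then show "0 \<le> deviation u k \<omega> \<bullet> (W *\<^sub>v deviation u k \<omega>)"
    by (rule pos_semidefD(3)[OF W_psd])
qed

context
  fixes u :: "nat \<Rightarrow> 'w \<Rightarrow> real vec"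
  assumes u: "adapted u" and u_sq: "\<And>k. square_integrable M (nu s) (u k)"
begin

lemma state_sq: "square_integrable M (nx s) (state s \<zeta> u k)"
  by (rule state_square_integrable[OF u_sq])

lemma deviation_sq: "square_integrable M (nu s) (deviation u k)"
  unfolding deviation_def[abs_def]
  by (intro square_integrable_diff u_sq square_integrable_mult_mat[OF K_carrier]
      square_integrable_add free_estimate_square_integrable forced_square_integrable)

lemma deviation_measurable: "deviation u k \<in> measurable (F k) (vec_borel (nu s))"
  unfolding deviation_def[abs_def]
  by (intro measurable_vec_diff measurable_mult_mat_vec[OF K_carrier] measurable_vec_add
      free_estimate_measurable forced_adapted_measurable[OF u] adapted_measurable_F[OF u order_refl])

text \<open>The deviation is known to the controller, and the estimation error is orthogonal to
  everything known.\<close>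

lemma deviation_orthogonal:
  "(\<integral>\<omega>. deviation u k \<omega> \<bullet> (W *\<^sub>v (K *\<^sub>v estimation_error k \<omega>)) \<partial>M) = 0"
proof -
  \<comment> \<open>Taking adjoints moves W and K onto the deviation and leaves the bare error
    paired with a vector measurable in \<open>F k\<close>.\<close>
  define Y where "Y \<omega> = transpose_mat K *\<^sub>v (W *\<^sub>v deviation u k \<omega>)" for \<omega>
  have T: "transpose_mat K \<in> carrier_mat (nx s) (nu s)" using K_carrier by simp
  have "deviation u k \<omega> \<bullet> (W *\<^sub>v (K *\<^sub>v estimation_error k \<omega>)) =
      Y \<omega> \<bullet> (free_state k \<omega> - vec_cond_exp M (F k) (nx s) (free_state k) \<omega>)"
    if \<omega>: "\<omega> \<in> space M" for \<omega>
  proof -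
    have e: "estimation_error k \<omega> \<in> carrier_vec (nx s)"
      using measurable_vec_borelD(1)[OF square_integrable_measurable[OF estimation_error_square_integrable] \<omega>] .
    have d: "deviation u k \<omega> \<in> carrier_vec (nu s)"
      using measurable_vec_borelD(1)[OF square_integrable_measurable[OF deviation_sq] \<omega>] .
    have "deviation u k \<omega> \<bullet> (W *\<^sub>v (K *\<^sub>v estimation_error k \<omega>)) =
        (K *\<^sub>v estimation_error k \<omega>) \<bullet> (W *\<^sub>v deviation u k \<omega>)"
      by (rule scalar_prod_symmetric_mat[OF W_carrier pos_semidefD(2)[OF W_psd] d mult_mat_vec_carrier[OF K_carrier e]])
    also have "\<dots> = (W *\<^sub>v deviation u k \<omega>) \<bullet> (K *\<^sub>v estimation_error k \<omega>)"
      by (rule comm_scalar_prod[OF mult_mat_vec_carrier[OF K_carrier e] mult_mat_vec_carrier[OF W_carrier d]])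
    also have "\<dots> = Y \<omega> \<bullet> estimation_error k \<omega>"
      unfolding Y_def
      by (rule transpose_vec_mult_scalar[OF K_carrier e mult_mat_vec_carrier[OF W_carrier d], symmetric])
    finally show ?thesis by (simp only: estimation_error_def free_estimate_def)
  qed
  then have "(\<integral>\<omega>. deviation u k \<omega> \<bullet> (W *\<^sub>v (K *\<^sub>v estimation_error k \<omega>)) \<partial>M) =
      (\<integral>\<omega>. Y \<omega> \<bullet> (free_state k \<omega> - vec_cond_exp M (F k) (nx s) (free_state k) \<omega>) \<partial>M)"
    by (intro Bochner_Integration.integral_cong) simp_all
  also have "\<dots> = 0"
  proof (rule finite_measure_subalgebra.integral_scalar_prod_cond_exp[OF F_subalgebra])
    show "square_integrable M (nx s) Y"
      unfolding Y_def by (intro square_integrable_mult_mat[OF T] square_integrable_mult_mat[OF W_carrier] deviation_sq)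
    show "Y \<in> measurable (F k) (vec_borel (nx s))"
      unfolding Y_def by (intro measurable_mult_mat_vec[OF T] measurable_mult_mat_vec[OF W_carrier] deviation_measurable)
  qed (rule free_state_square_integrable)
  finally show ?thesis .
qed

text \<open>Pythagoras in the inner product of W: the difference from full state feedback is the
  deviation minus K times the estimation error.\<close>

lemma feedback_deviation_cost:
  "(\<integral>\<omega>. (u k \<omega> - K *\<^sub>v state s \<zeta> u k \<omega>) \<bullet> (W *\<^sub>v (u k \<omega> - K *\<^sub>v state s \<zeta> u k \<omega>)) \<partial>M) =
    deviation_cost u k + error_cost k"
proof -
  let ?d = "deviation u k" and ?e = "\<lambda>\<omega>. K *\<^sub>v estimation_error k \<omega>"
  have e_sq: "square_integrable M (nu s) ?e"
    by (intro square_integrable_mult_mat[OF K_carrier] estimation_error_square_integrable)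
  have "(u k \<omega> - K *\<^sub>v state s \<zeta> u k \<omega>) \<bullet> (W *\<^sub>v (u k \<omega> - K *\<^sub>v state s \<zeta> u k \<omega>)) =
      ?d \<omega> \<bullet> (W *\<^sub>v ?d \<omega>) + ?e \<omega> \<bullet> (W *\<^sub>v ?e \<omega>) - 2 * (?d \<omega> \<bullet> (W *\<^sub>v ?e \<omega>))"
    if \<omega>: "\<omega> \<in> space M" for \<omega>
  proof -
    have d: "?d \<omega> \<in> carrier_vec (nu s)" and e: "?e \<omega> \<in> carrier_vec (nu s)"
      using measurable_vec_borelD(1)[OF square_integrable_measurable[OF deviation_sq] \<omega>]
        measurable_vec_borelD(1)[OF square_integrable_measurable[OF e_sq] \<omega>] by simp_all
    have xh: "free_estimate k \<omega> \<in> carrier_vec (nx s)" and x: "free_state k \<omega> \<in> carrier_vec (nx s)"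
      and z: "forced u k \<omega> \<in> carrier_vec (nx s)" and uc: "u k \<omega> \<in> carrier_vec (nu s)"
      using measurable_vec_borelD(1)[OF square_integrable_measurable[OF free_estimate_square_integrable] \<omega>]
        measurable_vec_borelD(1)[OF square_integrable_measurable[OF free_state_square_integrable] \<omega>]
        measurable_vec_borelD(1)[OF square_integrable_measurable[OF forced_square_integrable[OF u_sq]] \<omega>]
        adapted_carrier[OF u \<omega>] by simp_all
    have "u k \<omega> - K *\<^sub>v state s \<zeta> u k \<omega> = ?d \<omega> - ?e \<omega>"
      unfolding state_decomp_adapted[OF u \<omega>] deviation_def estimation_error_def
        mult_add_distrib_mat_vec[OF K_carrier x z] mult_add_distrib_mat_vec[OF K_carrier xh z]
        mult_minus_distrib_mat_vec[OF K_carrier x xh]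
      using uc K_carrier by (intro eq_vecI) (simp_all del: index_mult_mat_vec)
    then show ?thesis
      using d e W_carrier scalar_prod_symmetric_mat[OF W_carrier pos_semidefD(2)[OF W_psd] d e]
      by (simp add: mult_minus_distrib_mat_vec[of _ "nu s" "nu s"] minus_scalar_prod_distrib[of _ "nu s"]
          scalar_prod_minus_distrib[of _ "nu s"])
  qed
  then have "(\<integral>\<omega>. (u k \<omega> - K *\<^sub>v state s \<zeta> u k \<omega>) \<bullet> (W *\<^sub>v (u k \<omega> - K *\<^sub>v state s \<zeta> u k \<omega>)) \<partial>M) =
      (\<integral>\<omega>. ?d \<omega> \<bullet> (W *\<^sub>v ?d \<omega>) + ?e \<omega> \<bullet> (W *\<^sub>v ?e \<omega>) - 2 * (?d \<omega> \<bullet> (W *\<^sub>v ?e \<omega>)) \<partial>M)"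
    by (intro Bochner_Integration.integral_cong) simp_all
  also have "\<dots> = deviation_cost u k + error_cost k
      - 2 * (\<integral>\<omega>. ?d \<omega> \<bullet> (W *\<^sub>v ?e \<omega>) \<partial>M)"
    using square_integrable_quadratic[OF W_carrier deviation_sq, of k]
      square_integrable_quadratic[OF W_carrier e_sq]
      square_integrable_scalar_prod[OF deviation_sq square_integrable_mult_mat[OF W_carrier e_sq], of k]
    by (simp add: deviation_cost_def error_cost_def)
  finally show ?thesis by (simp add: deviation_orthogonal)
qed

lemma stage_cost_integrable: "integrable M (\<lambda>\<omega>. stage_cost s (state s \<zeta> u k \<omega>) (u k \<omega>))"
  unfolding stage_cost_def
  using square_integrable_quadratic[OF Q_carrier state_sq, of k]
    square_integrable_quadratic[OF R_carrier u_sq, of k] by simp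

lemma expected_cost_Suc:
  "expected_cost u (Suc T) = expected_cost u T + (\<integral>\<omega>. stage_cost s (state s \<zeta> u T \<omega>) (u T \<omega>) \<partial>M)"
  unfolding expected_cost_def by (simp add: stage_cost_integrable)

lemma expected_cost_eq_sum:
  "expected_cost u T = (\<Sum>k<T. \<integral>\<omega>. stage_cost s (state s \<zeta> u k \<omega>) (u k \<omega>) \<partial>M)"
  unfolding expected_cost_def by (simp add: stage_cost_integrable)

text \<open>The expectation of the completed square. Its cross term pairs the noise of time k with
  the noise-free successor state, which is determined before that noise acts, and so
  vanishes.\<close>

lemma one_step_cost:
  "(\<integral>\<omega>. stage_cost s (state s \<zeta> u k \<omega>) (u k \<omega>) \<partial>M) + terminal_cost u (Suc k) =
    terminal_cost u k + deviation_cost u k + error_cost k + noise_cost k"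
proof -
  let ?x = "state s \<zeta> u" and ?w = "\<zeta> (Wn k)"
  let ?c = "\<lambda>\<omega>. mA s *\<^sub>v ?x k \<omega> + mB s *\<^sub>v u k \<omega>"
  let ?v = "\<lambda>\<omega>. u k \<omega> - K *\<^sub>v ?x k \<omega>"
  have c_sq: "square_integrable M (nx s) ?c"
    by (intro square_integrable_add square_integrable_mult_mat[OF dims(1)]
        square_integrable_mult_mat[OF dims(2)] state_sq u_sq)
  have v_sq: "square_integrable M (nu s) ?v"
    by (intro square_integrable_diff square_integrable_mult_mat[OF K_carrier] state_sq u_sq)
  \<comment> \<open>Inputs up to time k are measurable in \<open>F k\<close>, hence in
    \<open>G k\<close>; the state at k follows, as it involves only noises before k.\<close>
  have uG: "u l \<in> measurable (G k) (vec_borel (nu s))" if "l \<le> k" for l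
    by (rule F_measurable_G[OF adapted_measurable_F[OF u that]])
  have xG: "?x k \<in> measurable (G k) (vec_borel (nx s))"
    by (rule state_measurable) (simp_all add: G_X0 G_W uG)
  have Pc_G: "(\<lambda>\<omega>. P *\<^sub>v ?c \<omega>) \<in> measurable (G k) (vec_borel (nx s))"
    by (intro measurable_mult_mat_vec[OF P_carrier] measurable_vec_add mult_measurable(1,2) xG uG order_refl)
  have Pc_sq: "square_integrable M (nx s) (\<lambda>\<omega>. P *\<^sub>v ?c \<omega>)"
    by (rule square_integrable_mult_mat[OF P_carrier c_sq])
  have "stage_cost s (?x k \<omega>) (u k \<omega>) + ?x (Suc k) \<omega> \<bullet> (P *\<^sub>v ?x (Suc k) \<omega>) =
      ?x k \<omega> \<bullet> (P *\<^sub>v ?x k \<omega>) + ?v \<omega> \<bullet> (W *\<^sub>v ?v \<omega>) + ?w \<omega> \<bullet> (P *\<^sub>v ?w \<omega>) + 2 * (?w \<omega> \<bullet> (P *\<^sub>v ?c \<omega>))"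
    if "\<omega> \<in> space M" for \<omega>
    using completing_squares[OF s P riccati state_carrier_adapted[OF u that] adapted_carrier[OF u that] noise_carrier[OF that]]
    by (simp add: stage_cost_def)
  then have "(\<integral>\<omega>. stage_cost s (?x k \<omega>) (u k \<omega>) + ?x (Suc k) \<omega> \<bullet> (P *\<^sub>v ?x (Suc k) \<omega>) \<partial>M) =
      (\<integral>\<omega>. ?x k \<omega> \<bullet> (P *\<^sub>v ?x k \<omega>) + ?v \<omega> \<bullet> (W *\<^sub>v ?v \<omega>) + ?w \<omega> \<bullet> (P *\<^sub>v ?w \<omega>) + 2 * (?w \<omega> \<bullet> (P *\<^sub>v ?c \<omega>)) \<partial>M)"
    by (intro Bochner_Integration.integral_cong) (simp_all only:)
  also have "(\<integral>\<omega>. stage_cost s (?x k \<omega>) (u k \<omega>) + ?x (Suc k) \<omega> \<bullet> (P *\<^sub>v ?x (Suc k) \<omega>) \<partial>M) =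
      (\<integral>\<omega>. stage_cost s (?x k \<omega>) (u k \<omega>) \<partial>M) + terminal_cost u (Suc k)"
    unfolding terminal_cost_def
    by (intro Bochner_Integration.integral_add stage_cost_integrable square_integrable_quadratic[OF P_carrier state_sq])
  also have "(\<integral>\<omega>. ?x k \<omega> \<bullet> (P *\<^sub>v ?x k \<omega>) + ?v \<omega> \<bullet> (W *\<^sub>v ?v \<omega>) + ?w \<omega> \<bullet> (P *\<^sub>v ?w \<omega>) + 2 * (?w \<omega> \<bullet> (P *\<^sub>v ?c \<omega>)) \<partial>M) =
      terminal_cost u k + (\<integral>\<omega>. ?v \<omega> \<bullet> (W *\<^sub>v ?v \<omega>) \<partial>M) + noise_cost k + 2 * (\<integral>\<omega>. ?w \<omega> \<bullet> (P *\<^sub>v ?c \<omega>) \<partial>M)"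
    unfolding terminal_cost_def noise_cost_def
    using square_integrable_quadratic[OF P_carrier state_sq, of k] square_integrable_quadratic[OF W_carrier v_sq]
      square_integrable_quadratic[OF P_carrier W_square_integrable, of k]
      square_integrable_scalar_prod[OF W_square_integrable Pc_sq, of k]
    by (simp add: Bochner_Integration.integral_add)
  finally show ?thesis
    unfolding noise_orthogonal[OF Pc_sq Pc_G] feedback_deviation_cost by simp
qed

text \<open>The terminal cost telescopes; its value at time 0 is the first summand of
  \<open>unavoidable_cost\<close>.\<close>

lemma expected_cost_eq:
  "expected_cost u T + terminal_cost u T = unavoidable_cost T + (\<Sum>k<T. deviation_cost u k)"
proof (induction T)
  case 0
  then show ?case by (simp add: expected_cost_def terminal_cost_def unavoidable_cost_def)
next
  case (Suc T)
  then show ?case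
    using one_step_cost[of T] by (simp add: expected_cost_Suc unavoidable_cost_def)
qed

lemma expected_cost_nn_integral:
  "(\<integral>\<^sup>+\<omega>. ennreal (\<Sum>k<T. stage_cost s (state s \<zeta> u k \<omega>) (u k \<omega>)) \<partial>M) = ennreal (expected_cost u T)"
  unfolding expected_cost_def
  using stage_cost_nonneg(1)[OF s state_carrier_adapted[OF u] adapted_carrier[OF u]] stage_cost_integrable
  by (intro nn_integral_eq_integral Bochner_Integration.integrable_sum AE_I2 sum_nonneg) auto

text \<open>The observability bound in expectation: every terminal cost is paid for by
  \<open>N + 1\<close> consecutive stages and their noise, and summation counts each stage at most
  \<open>N + 1\<close> times.\<close>

lemma sum_terminal_cost_le:
  obtains C N D where "0 \<le> C" "0 \<le> D"
    "\<And>T. (\<Sum>k<T. terminal_cost u k) \<le> C * expected_cost u (T + N) + D * real T"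
proof -
  let ?e = "\<lambda>k. \<integral>\<omega>. stage_cost s (state s \<zeta> u k \<omega>) (u k \<omega>) \<partial>M"
  define V where "V = (\<Sum>j<nx s. v j)"
  obtain p where p: "0 \<le> p" "\<And>x. x \<in> carrier_vec (nx s) \<Longrightarrow> x \<bullet> (P *\<^sub>v x) \<le> p * (x \<bullet> x)"
    by (rule quadratic_form_upper_bound[OF P_carrier]) (rule that)
  obtain N C where C: "0 \<le> C" "\<And>x u w. trajectory s x u w \<Longrightarrow>
    x 0 \<bullet> x 0 \<le> C * (\<Sum>l\<le>N. stage_cost s (x l) (u l) + w l \<bullet> w l)"
    by (rule state_le_stage_costs[OF s]) (rule that)
  have noise: "(\<integral>\<omega>. \<zeta> (Wn k) \<omega> \<bullet> \<zeta> (Wn k) \<omega> \<partial>M) = V" for k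
  proof -
    have "(\<integral>\<omega>. \<zeta> (Wn k) \<omega> \<bullet> \<zeta> (Wn k) \<omega> \<partial>M) = (\<integral>\<omega>. (\<Sum>j<nx s. (\<zeta> (Wn k) \<omega> $ j)\<^sup>2) \<partial>M)"
      using measurable_vec_dim[OF square_integrable_measurable[OF W_square_integrable]]
      by (intro Bochner_Integration.integral_cong)
        (simp_all add: scalar_prod_def atLeast0LessThan power2_eq_square)
    also have "\<dots> = V"
      using W_square_integrable[of k] W_variance
      by (subst Bochner_Integration.integral_sum) (simp_all add: square_integrable_def V_def)
    finally show ?thesis .
  qed
  have V0: "0 \<le> V"
    unfolding noise[of 0, symmetric] by (intro integral_nonneg_AE AE_I2 scalar_prod_self_nonneg)
  have e0: "0 \<le> ?e k" for k
    using stage_cost_nonneg(1)[OF s state_carrier_adapted[OF u] adapted_carrier[OF u]]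
    by (intro integral_nonneg_AE AE_I2) simp
  have term_le: "terminal_cost u k \<le> p * C * (\<Sum>l\<le>N. ?e (k + l) + V)" for k
  proof -
    have "terminal_cost u k \<le> (\<integral>\<omega>. p * (C * (\<Sum>l\<le>N. stage_cost s (state s \<zeta> u (k + l) \<omega>) (u (k + l) \<omega>)
        + \<zeta> (Wn (k + l)) \<omega> \<bullet> \<zeta> (Wn (k + l)) \<omega>)) \<partial>M)"
      unfolding terminal_cost_def
    proof (rule Bochner_Integration.integral_mono)
      show "integrable M (\<lambda>\<omega>. state s \<zeta> u k \<omega> \<bullet> (P *\<^sub>v state s \<zeta> u k \<omega>))"
        by (rule square_integrable_quadratic[OF P_carrier state_sq])
      show "integrable M (\<lambda>\<omega>. p * (C * (\<Sum>l\<le>N. stage_cost s (state s \<zeta> u (k + l) \<omega>) (u (k + l) \<omega>)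
        + \<zeta> (Wn (k + l)) \<omega> \<bullet> \<zeta> (Wn (k + l)) \<omega>)))"
        by (intro Bochner_Integration.integrable_mult_right Bochner_Integration.integrable_sum
            Bochner_Integration.integrable_add stage_cost_integrable
            square_integrable_scalar_prod[OF W_square_integrable W_square_integrable])
      fix \<omega> assume \<omega>: "\<omega> \<in> space M"
      \<comment> \<open>Shifting by k turns the pathwise bound on the initial state into one on the
        state at time k.\<close>
      have t: "trajectory s (\<lambda>l. state s \<zeta> u (k + l) \<omega>) (\<lambda>l. u (k + l) \<omega>) (\<lambda>l. \<zeta> (Wn (k + l)) \<omega>)"
        using state_carrier_adapted[OF u \<omega>] adapted_carrier[OF u \<omega>] noise_carrier[OF \<omega>]
        by (simp add: trajectory_def)
      have "state s \<zeta> u k \<omega> \<bullet> (P *\<^sub>v state s \<zeta> u k \<omega>) \<le> p * (state s \<zeta> u k \<omega> \<bullet> state s \<zeta> u k \<omega>)"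
        by (rule p(2)[OF state_carrier_adapted[OF u \<omega>]])
      also have "\<dots> \<le> p * (C * (\<Sum>l\<le>N. stage_cost s (state s \<zeta> u (k + l) \<omega>) (u (k + l) \<omega>)
        + \<zeta> (Wn (k + l)) \<omega> \<bullet> \<zeta> (Wn (k + l)) \<omega>))"
        using C(2)[OF t] p(1) by (intro mult_left_mono) simp_all
      finally show "state s \<zeta> u k \<omega> \<bullet> (P *\<^sub>v state s \<zeta> u k \<omega>) \<le> \<dots>" .
    qed
    also have "\<dots> = p * (C * (\<Sum>l\<le>N. ?e (k + l) + V))"
      using stage_cost_integrable square_integrable_scalar_prod[OF W_square_integrable W_square_integrable]
      by (simp add: noise)
    finally show ?thesis by simp
  qed
  show thesis
  proof (rule that)
    \<comment> \<open>There are \<open>N + 1\<close> shifted sums, each at most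
      \<open>expected_cost u (T + N)\<close> plus the noise part \<open>V * real T\<close>.\<close>
    show "0 \<le> p * C * real (Suc N)" "0 \<le> p * C * real (Suc N) * V"
      using p C V0 by simp_all
    fix T
    have "(\<Sum>k<T. terminal_cost u k) \<le> (\<Sum>k<T. p * C * (\<Sum>l\<le>N. ?e (k + l) + V))"
      by (intro sum_mono term_le)
    also have "\<dots> = p * C * (\<Sum>l\<le>N. (\<Sum>k<T. ?e (k + l)) + V * real T)"
      unfolding sum_distrib_left[symmetric] by (subst sum.swap) (simp add: sum.distrib mult.commute)
    also have "\<dots> \<le> p * C * (\<Sum>l\<le>N. expected_cost u (T + N) + V * real T)"
    proof (intro mult_left_mono sum_mono add_right_mono)
      fix l assume "l \<in> {..N}"
      have "(\<Sum>k<T. ?e (k + l)) = (\<Sum>k\<in>{l..<T + l}. ?e k)"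
        using sum.shift_bounds_nat_ivl[of ?e 0 l T] by (simp add: atLeast0LessThan)
      also have "\<dots> \<le> (\<Sum>k<T + N. ?e k)"
        using \<open>l \<in> {..N}\<close> e0 by (intro sum_mono2) auto
      finally show "(\<Sum>k<T. ?e (k + l)) \<le> expected_cost u (T + N)"
        by (simp only: expected_cost_eq_sum)
    qed (use p C in simp)
    also have "\<dots> = p * C * real (Suc N) * expected_cost u (T + N) + p * C * real (Suc N) * V * real T"
      by (simp add: algebra_simps)
    finally show "(\<Sum>k<T. terminal_cost u k) \<le> \<dots>" .
  qed
qed

text \<open>Discarding the nonnegative deviation costs from the identity leaves the hypothesis
  \<open>c k \<le> J k + p k\<close> of the averaging lemma, with the terminal cost as
  \<open>p\<close>.\<close>

lemma limsup_unavoidable_cost_le: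
  "limsup (\<lambda>T. ennreal (unavoidable_cost T / real T)) \<le> limsup (\<lambda>T. ennreal (expected_cost u T / real T))"
proof -
  obtain C N D where b: "0 \<le> C" "0 \<le> D"
    "\<And>T. (\<Sum>k<T. terminal_cost u k) \<le> C * expected_cost u (T + N) + D * real T"
    by (rule sum_terminal_cost_le) (rule that)
  show ?thesis
  proof (rule limsup_average_le[OF mono_unavoidable_cost terminal_cost_nonneg[OF u] _ b(3) b(1,2)])
    fix T
    show "unavoidable_cost T \<le> expected_cost u T + terminal_cost u T"
      unfolding expected_cost_eq using deviation_cost_nonneg[OF u] by (simp add: sum_nonneg)
  qed
qed

lemma average_cost_eq: "average_cost M s \<zeta> u = limsup (\<lambda>T. ennreal (expected_cost u T / real T))"
proof -
  have "0 \<le> expected_cost u T" for T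
    using stage_cost_nonneg(1)[OF s state_carrier_adapted[OF u] adapted_carrier[OF u]]
    unfolding expected_cost_def by (intro integral_nonneg_AE AE_I2 sum_nonneg) simp
  then show ?thesis
    unfolding average_cost_def stage_cost_def[symmetric] expected_cost_nn_integral
    by (simp add: ennreal_mult'[symmetric])
qed

end

text \<open>Positive definiteness of R bounds each squared input coordinate by a multiple of the
  stage cost of its time, and this by the total cost because stage costs are nonnegative.\<close>

lemma square_integrable_of_finite_cost:
  assumes u: "adapted u"
    and fin: "(\<integral>\<^sup>+\<omega>. ennreal (\<Sum>k<T. stage_cost s (state s \<zeta> u k \<omega>) (u k \<omega>)) \<partial>M) < \<infinity>" and k: "k < T"
  shows "square_integrable M (nu s) (u k)"
proof -
  obtain r where r: "0 < r" "\<And>u. u \<in> carrier_vec (nu s) \<Longrightarrow> r * (u \<bullet> u) \<le> u \<bullet> (mR s *\<^sub>v u)"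
    by (rule pos_def_lower_bound[OF subsystem_okD(7)[OF s]]) (rule that)
  have uM: "u k \<in> measurable M (vec_borel (nu s))"
    by (rule F_measurable_M[OF adapted_measurable_F[OF u order_refl]])
  have "integrable M (\<lambda>\<omega>. (u k \<omega> $ j)\<^sup>2)" if j: "j < nu s" for j
  proof (rule integrableI_bounded)
    show "(\<lambda>\<omega>. (u k \<omega> $ j)\<^sup>2) \<in> borel_measurable M"
      using measurable_vec_borelD(2)[OF uM j] by simp
    have "(\<integral>\<^sup>+\<omega>. ennreal (norm ((u k \<omega> $ j)\<^sup>2)) \<partial>M) \<le>
        (\<integral>\<^sup>+\<omega>. ennreal (1 / r) * ennreal (\<Sum>k<T. stage_cost s (state s \<zeta> u k \<omega>) (u k \<omega>)) \<partial>M)"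
    proof (rule nn_integral_mono)
      fix \<omega> assume \<omega>: "\<omega> \<in> space M"
      note c = adapted_carrier[OF u \<omega>] state_carrier_adapted[OF u \<omega>]
      have "(u k \<omega> $ j)\<^sup>2 \<le> u k \<omega> \<bullet> u k \<omega>"
        using j carrier_vecD[OF c(1)[of k]] member_le_sum[of j "{0..<nu s}" "\<lambda>j. (u k \<omega> $ j)\<^sup>2"]
        by (simp add: scalar_prod_def power2_eq_square)
      also have "\<dots> \<le> (u k \<omega> \<bullet> (mR s *\<^sub>v u k \<omega>)) / r"
        using r(1) r(2)[OF c(1)[of k]] by (simp add: field_simps)
      also have "\<dots> \<le> stage_cost s (state s \<zeta> u k \<omega>) (u k \<omega>) / r"
        using r(1) stage_cost_nonneg(2)[OF s c(2)[of k] c(1)[of k]]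
        by (intro divide_right_mono) (simp_all add: stage_cost_def)
      also have "\<dots> \<le> (\<Sum>k<T. stage_cost s (state s \<zeta> u k \<omega>) (u k \<omega>)) / r"
        using r(1) k stage_cost_nonneg(1)[OF s c(2) c(1)]
        by (intro divide_right_mono member_le_sum) simp_all
      finally show "ennreal (norm ((u k \<omega> $ j)\<^sup>2)) \<le>
          ennreal (1 / r) * ennreal (\<Sum>k<T. stage_cost s (state s \<zeta> u k \<omega>) (u k \<omega>))"
        using r(1) by (simp add: ennreal_mult'[symmetric] ennreal_leI)
    qed
    also have "\<dots> = ennreal (1 / r) * (\<integral>\<^sup>+\<omega>. ennreal (\<Sum>k<T. stage_cost s (state s \<zeta> u k \<omega>) (u k \<omega>)) \<partial>M)"
    proof (rule nn_integral_cmult)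
      have uM: "u l \<in> measurable M (vec_borel (nu s))" for l
        by (rule F_measurable_M[OF adapted_measurable_F[OF u order_refl]])
      have xM: "state s \<zeta> u l \<in> measurable M (vec_borel (nx s))" for l
        by (rule state_measurable[OF square_integrable_measurable[OF X0_square_integrable]
              square_integrable_measurable[OF W_square_integrable] uM])
      show "(\<lambda>\<omega>. ennreal (\<Sum>k<T. stage_cost s (state s \<zeta> u k \<omega>) (u k \<omega>))) \<in> borel_measurable M"
        unfolding stage_cost_def
        by (intro measurable_compose[OF _ measurable_ennreal] borel_measurable_sum borel_measurable_add
            measurable_scalar_prod[OF xM measurable_mult_mat_vec[OF Q_carrier xM]]
            measurable_scalar_prod[OF uM measurable_mult_mat_vec[OF R_carrier uM]])
    qed
    also have "\<dots> < \<infinity>" using fin by (simp add: ennreal_mult_less_top)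
    finally show "(\<integral>\<^sup>+\<omega>. ennreal (norm ((u k \<omega> $ j)\<^sup>2)) \<partial>M) < \<infinity>" .
  qed
  then show ?thesis using uM by (simp add: square_integrable_def)
qed

lemma unavoidable_cost_le_average_cost:
  assumes u: "adapted u"
  shows "limsup (\<lambda>T. ennreal (unavoidable_cost T / real T)) \<le> average_cost M s \<zeta> u"
proof (cases "\<forall>k. square_integrable M (nu s) (u k)")
  case True
  then have sq: "square_integrable M (nu s) (u k)" for k by simp
  show ?thesis
    unfolding average_cost_eq[OF u sq] by (rule limsup_unavoidable_cost_le[OF u sq])
next
  case False
  then obtain k where k: "\<not> square_integrable M (nu s) (u k)" by blast
  \<comment> \<open>A single input without second moments makes every horizon beyond
    \<open>k\<close> infinitely expensive. The bound on T also keeps the factor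
    \<open>1 / real T\<close> positive; at \<open>T = 0\<close> it would annihilate the infinite
    integral.\<close>
  have "ennreal (1 / real T) * (\<integral>\<^sup>+\<omega>. ennreal (\<Sum>k<T. stage_cost s (state s \<zeta> u k \<omega>) (u k \<omega>)) \<partial>M) = \<infinity>"
    if "Suc k \<le> T" for T
  proof -
    have "\<not> (\<integral>\<^sup>+\<omega>. ennreal (\<Sum>k<T. stage_cost s (state s \<zeta> u k \<omega>) (u k \<omega>)) \<partial>M) < \<infinity>"
    proof
      assume "(\<integral>\<^sup>+\<omega>. ennreal (\<Sum>k<T. stage_cost s (state s \<zeta> u k \<omega>) (u k \<omega>)) \<partial>M) < \<infinity>"
      from square_integrable_of_finite_cost[OF u this] k that show False by simp
    qed
    then have "(\<integral>\<^sup>+\<omega>. ennreal (\<Sum>k<T. stage_cost s (state s \<zeta> u k \<omega>) (u k \<omega>)) \<partial>M) = \<infinity>"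
      by (simp add: top.not_eq_extremum[symmetric])
    then show ?thesis using that by (simp add: ennreal_mult_eq_top_iff)
  qed
  then have "average_cost M s \<zeta> u = limsup (\<lambda>T. \<infinity> :: ennreal)"
    unfolding average_cost_def stage_cost_def[symmetric]
    by (intro Limsup_eq eventually_sequentiallyI[of "Suc k"])
  then show ?thesis by (simp add: Limsup_const)
qed

text \<open>Here the policy is given and obeys the law only almost surely, so second moments are
  derived along time: those of earlier inputs make \<open>cond_exp_state\<close> applicable, and its
  formula yields those of the next input.\<close>

lemma certainty_equivalent_square_integrable:
  assumes \<gamma>: "\<gamma> \<in> policies s" and ce: "certainty_equivalent M s L \<zeta> \<sigma> K \<gamma>"
  defines "u \<equiv> input s L \<zeta> \<sigma> \<gamma>"
  shows "square_integrable M (nu s) (u k)"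
    and "AE \<omega> in M. u k \<omega> = K *\<^sub>v (free_estimate k \<omega> + forced u k \<omega>)"
proof -
  have ad: "adapted u" unfolding u_def by (rule policy_adapted[OF \<gamma>])
  have eq: "AE \<omega> in M. u k \<omega> = K *\<^sub>v (free_estimate k \<omega> + forced u k \<omega>)"
    if "\<And>l. l < k \<Longrightarrow> square_integrable M (nu s) (u l)" for k
  proof -
    have "AE \<omega> in M. u k \<omega> = K *\<^sub>v vec_cond_exp M (info u k) (nx s) (state s \<zeta> u k) \<omega>"
      using ce unfolding certainty_equivalent_def Let_def u_def by (rule spec)
    moreover have "AE \<omega> in M. vec_cond_exp M (info u k) (nx s) (state s \<zeta> u k) \<omega> =
        free_estimate k \<omega> + forced u k \<omega>"
      by (rule cond_exp_state[OF ad that])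
    ultimately show ?thesis
      by eventually_elim simp
  qed
  have sq: "square_integrable M (nu s) (u k)" for k
  proof (induction k rule: less_induct)
    case (less k)
    have "square_integrable M (nu s) (\<lambda>\<omega>. K *\<^sub>v (free_estimate k \<omega> + forced u k \<omega>))"
      by (intro square_integrable_mult_mat[OF K_carrier] square_integrable_add
          free_estimate_square_integrable forced_square_integrable less)
    then show ?case
    proof (rule square_integrable_cong_AE)
      show "u k \<in> measurable M (vec_borel (nu s))"
        by (rule F_measurable_M[OF adapted_measurable_F[OF ad order_refl]])
      show "AE \<omega> in M. K *\<^sub>v (free_estimate k \<omega> + forced u k \<omega>) = u k \<omega>"
      proof -
        have "AE \<omega> in M. u k \<omega> = K *\<^sub>v (free_estimate k \<omega> + forced u k \<omega>)"
          by (rule eq[OF less])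
        then show ?thesis by eventually_elim simp
      qed
    qed
  qed
  show "square_integrable M (nu s) (u k)" by (rule sq)
  show "AE \<omega> in M. u k \<omega> = K *\<^sub>v (free_estimate k \<omega> + forced u k \<omega>)" by (rule eq[OF sq])
qed

text \<open>The deviation vanishes almost surely, so the last sum of the cost identity is zero; for
  an upper bound the terminal cost may be dropped by its sign.\<close>

lemma certainty_equivalent_average_cost_le:
  assumes \<gamma>: "\<gamma> \<in> policies s" and ce: "certainty_equivalent M s L \<zeta> \<sigma> K \<gamma>"
  shows "average_cost M s \<zeta> (input s L \<zeta> \<sigma> \<gamma>) \<le> limsup (\<lambda>T. ennreal (unavoidable_cost T / real T))"
proof -
  define u where "u = input s L \<zeta> \<sigma> \<gamma>"
  note ad = policy_adapted[OF \<gamma>, folded u_def]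
  note sq = certainty_equivalent_square_integrable(1)[OF \<gamma> ce, folded u_def]
  note eq = certainty_equivalent_square_integrable(2)[OF \<gamma> ce, folded u_def]
  have "deviation_cost u k = 0" for k
  proof -
    have "AE \<omega> in M. deviation u k \<omega> \<bullet> (W *\<^sub>v deviation u k \<omega>) = 0"
      using eq[of k] AE_space
    proof eventually_elim
      case (elim \<omega>)
      have "deviation u k \<omega> = 0\<^sub>v (nu s)"
        unfolding deviation_def elim(1)[symmetric] using adapted_carrier[OF ad elim(2)] by simp
      then show ?case using W_carrier by (simp add: mult_mat_zero_vec)
    qed
    then show ?thesis unfolding deviation_cost_def by (rule integral_eq_zero_AE)
  qed
  then have "expected_cost u T \<le> unavoidable_cost T" for T
    using expected_cost_eq[OF ad sq, of T] terminal_cost_nonneg[OF ad, of T] by simp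
  then show ?thesis
    unfolding u_def[symmetric] average_cost_eq[OF ad sq]
    by (intro Limsup_mono always_eventually allI ennreal_leI divide_right_mono) simp_all
qed

lemma certainty_equivalent_optimal:
  assumes "\<gamma> \<in> policies s" "certainty_equivalent M s L \<zeta> \<sigma> K \<gamma>"
  shows "optimal_policy M s L \<zeta> \<sigma> \<gamma>"
  unfolding optimal_policy_def
  using assms certainty_equivalent_average_cost_le[OF assms]
    unavoidable_cost_le_average_cost[OF policy_adapted]
  by (auto intro: order_trans)

end

section \<open>The network\<close>

text \<open>The noise covariances make the prediction and innovation covariances positive definite,
  so the inverse in the gain is a genuine one.\<close>

lemma filter_gain_carrier:
  assumes s: "subsystem_ok s" and \<Theta>: "pos_semidef (nx s) \<Theta>"
  shows "filter_gain s \<Theta> \<in> carrier_mat (nx s) (ny s)"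
proof -
  note d = subsystem_okD[OF s]
  have congr: "pos_semidef k (A * S * transpose_mat A)"
    if "pos_semidef n S" "A \<in> carrier_mat k n" for k n and A S :: "real mat"
    using pos_semidef_congruence[OF that(1), of "transpose_mat A" k] that(2) by simp
  have p: "pos_def (nx s) (pred_cov s \<Theta>)"
    unfolding pred_cov_def by (intro pos_def_add_pos_semidef congr[OF \<Theta>] d)
  have "pos_def (ny s) (innov_cov s \<Theta>)"
    unfolding innov_cov_def
    by (intro pos_def_add_pos_semidef congr[OF pos_def_imp_pos_semidef[OF p]] d)
  note i = pos_def_mat_inv(1)[OF this]
  have "pred_cov s \<Theta> \<in> carrier_mat (nx s) (nx s)" using p by (simp add: pos_def_def)
  moreover have "transpose_mat (mC s) \<in> carrier_mat (nx s) (ny s)" using d(3) by simp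
  ultimately show ?thesis
    unfolding filter_gain_def using i by (intro mult_carrier_mat)
qed

text \<open>The values of \<open>f\<close> are countable, so measurability can be checked separately
  for each of them, without a product sigma-algebra.\<close>

lemma measurable_countable_op:
  fixes f g :: "'a \<Rightarrow> nat"
  assumes "f \<in> measurable M (count_space UNIV)" "g \<in> measurable M (count_space UNIV)"
  shows "(\<lambda>\<omega>. h (f \<omega>) (g \<omega>)) \<in> measurable M (count_space UNIV)"
proof (rule measurable_compose_countable[OF _ assms(1)])
  fix a :: nat
  show "(\<lambda>\<omega>. h a (g \<omega>)) \<in> measurable M (count_space UNIV)"
    by (rule measurable_compose[OF assms(2)]) simp
qed

lemma measurable_nat_prod:
  fixes f :: "'b \<Rightarrow> 'a \<Rightarrow> nat"
  assumes "\<And>j. j \<in> J \<Longrightarrow> f j \<in> measurable M (count_space UNIV)"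
  shows "(\<lambda>\<omega>. \<Prod>j\<in>J. f j \<omega>) \<in> measurable M (count_space UNIV)"
  using assms
proof (induction J rule: infinite_finite_induct)
  case (insert j J)
  have "(\<lambda>\<omega>. f j \<omega> * (\<Prod>j\<in>J. f j \<omega>)) \<in> measurable M (count_space UNIV)"
    by (rule measurable_countable_op[where h = "(*)"]) (use insert in simp_all)
  then show ?case using insert.hyps by simp
qed simp_all

text \<open>One variable is independent of the tuple of all others, and by Doob-Dynkin
  \<open>Y\<close> is a function of that tuple; hence the expectation factorizes.\<close>

lemma (in prob_space) indep_vars_integral_mult:
  fixes Y :: "'a \<Rightarrow> real"
  assumes ind: "indep_vars N X I" and q: "q \<in> I" and h: "h \<in> borel_measurable (N q)"
    and Y: "Y \<in> borel_measurable (vimage_algebra (space M) (\<lambda>\<omega>. \<lambda>r\<in>I - {q}. X r \<omega>) (PiM (I - {q}) N))"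
    and int: "integrable M (\<lambda>\<omega>. h (X q \<omega>))" "integrable M Y"
  shows "(\<integral>\<omega>. h (X q \<omega>) * Y \<omega> \<partial>M) = (\<integral>\<omega>. h (X q \<omega>) \<partial>M) * (\<integral>\<omega>. Y \<omega> \<partial>M)"
proof -
  let ?R = "\<lambda>\<omega>. \<lambda>r\<in>I - {q}. X r \<omega>" and ?Q = "\<lambda>\<omega>. \<lambda>r\<in>{q}. X r \<omega>"
  have rv: "X r \<in> measurable M (N r)" if "r \<in> I" for r
    using ind that by (simp add: indep_vars_def)
  have R: "?R \<in> measurable M (PiM (I - {q}) N)"
    using rv by (intro measurable_restrict) simp
  obtain g where g: "g \<in> borel_measurable (PiM (I - {q}) N)" "\<forall>\<omega>\<in>space M. Y \<omega> = g (?R \<omega>)"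
    using measurable_vimage_algebra_factor_real[OF Y] measurable_space[OF R] by auto
  have "indep_var (PiM {q} N) ?Q (PiM (I - {q}) N) ?R"
    using q by (intro indep_var_restrict[OF ind]) auto
  moreover have "(\<lambda>f. h (f q)) \<in> borel_measurable (PiM {q} N)"
    by (rule measurable_compose[OF measurable_component_singleton[of q "{q}" N] h]) simp
  ultimately have "indep_var borel ((\<lambda>f. h (f q)) \<circ> ?Q) borel (g \<circ> ?R)"
    using g(1) by (rule indep_var_compose)
  then have ind': "indep_var borel (\<lambda>\<omega>. h (X q \<omega>)) borel (\<lambda>\<omega>. g (?R \<omega>))"
    by (simp add: comp_def)
  have Y_eq: "integrable M (\<lambda>\<omega>. g (?R \<omega>)) = integrable M Y"
    "(\<integral>\<omega>. g (?R \<omega>) \<partial>M) = (\<integral>\<omega>. Y \<omega> \<partial>M)"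
    "(\<integral>\<omega>. h (X q \<omega>) * g (?R \<omega>) \<partial>M) = (\<integral>\<omega>. h (X q \<omega>) * Y \<omega> \<partial>M)"
    using g(2) by (auto intro!: Bochner_Integration.integrable_cong Bochner_Integration.integral_cong)
  show ?thesis
    using indep_var_lebesgue_integral[OF ind' int(1)] int(2) unfolding Y_eq by simp
qed

text \<open>In \<open>G k\<close> just one primitive variable is left out, the process noise of time
  k in loop i. Including the other loops makes the success indicators measurable although they
  depend on all schedulers; leaving out that one noise keeps it independent of
  \<open>G k\<close>.\<close>

lemma lqg_loop_of_network:
  fixes M :: "'w measure" and \<xi> :: "nat \<Rightarrow> primitive \<Rightarrow> 'w \<Rightarrow> real vec"
  assumes M: "prob_space M" and i: "i \<in> {1..m}"
    and s: "subsystem_ok (S i)" and P: "pos_def (nx (S i)) P" "control_riccati (S i) P"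
    and \<Theta>: "pos_semidef (nx (S i)) \<Theta>"
    and indep: "primitives_indep M m S \<xi>"
    and noise: "noise_ok M (S i) (\<xi> i)" and init: "initial_state_ok M (S i) \<Theta> (\<xi> i)"
    and sched: "\<And>j. j \<in> {1..m} \<Longrightarrow> admissible_scheduler M (S j) (\<xi> j) (\<delta> j)"
  defines "I \<equiv> {1..m} \<times> (UNIV :: primitive set)"
    and "N \<equiv> \<lambda>(j, p). vec_borel (prim_dim (S j) p)" and "X \<equiv> \<lambda>(j, p). \<xi> j p"
  defines "G \<equiv> \<lambda>k. vimage_algebra (space M) (\<lambda>\<omega>. \<lambda>r\<in>I - {(i, Wn k)}. X r \<omega>) (PiM (I - {(i, Wn k)}) N)"
  shows "lqg_loop (S i) (filter_gain (S i) \<Theta>) M (\<xi> i) (success m \<delta> i) G P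
    (\<lambda>j. unit_vec (nx (S i)) j \<bullet> (mW (S i) *\<^sub>v unit_vec (nx (S i)) j))"
proof -
  interpret prob_space M by (rule M)
  have ind: "indep_vars N X I"
    using indep by (simp add: primitives_indep_def I_def N_def X_def)
  have rv: "X r \<in> measurable M (N r)" if "r \<in> I" for r
    using ind that by (simp add: indep_vars_def)
  have \<xi>_M: "\<xi> i p \<in> measurable M (vec_borel (prim_dim (S i) p))" for p
    using rv[of "(i, p)"] i by (simp add: I_def N_def X_def)
  have tuple: "(\<lambda>\<omega>. \<lambda>r\<in>I - {(i, Wn k)}. X r \<omega>) \<in> measurable M (PiM (I - {(i, Wn k)}) N)" for k
    using rv by (intro measurable_restrict) simp
  have \<xi>_G: "\<xi> j p \<in> measurable (G k) (vec_borel (prim_dim (S j) p))"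
    if "j \<in> {1..m}" "(j, p) \<noteq> (i, Wn k)" for j p k
  proof -
    have r: "(j, p) \<in> I - {(i, Wn k)}" using that by (simp add: I_def)
    have "(\<lambda>\<omega>. \<lambda>r\<in>I - {(i, Wn k)}. X r \<omega>) \<in> measurable (G k) (PiM (I - {(i, Wn k)}) N)"
      unfolding G_def using measurable_space[OF tuple[of k]] by (intro measurable_vimage_algebra1) auto
    from measurable_compose[OF this measurable_component_singleton[OF r]]
    have "(\<lambda>\<omega>. X (j, p) \<omega>) \<in> measurable (G k) (N (j, p))"
      using r by (simp only: restrict_apply if_True)
    then show ?thesis by (simp add: X_def N_def)
  qed
  have \<delta>_G: "\<delta> j l \<in> measurable (G k) (count_space UNIV)" if j: "j \<in> {1..m}" and l: "l \<le> k" for j l k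
  proof -
    from sched[OF j] obtain g
      where g: "g \<in> measurable (PiM (prims_upto l) (\<lambda>p. vec_borel (prim_dim (S j) p))) (count_space {0, 1})"
        "\<forall>\<omega>\<in>space M. \<delta> j l \<omega> = g (\<lambda>p\<in>prims_upto l. \<xi> j p \<omega>)"
      unfolding admissible_scheduler_def by blast
    have "(\<lambda>\<omega>. \<lambda>p\<in>prims_upto l. \<xi> j p \<omega>)
        \<in> measurable (G k) (PiM (prims_upto l) (\<lambda>p. vec_borel (prim_dim (S j) p)))"
    proof (intro measurable_restrict \<xi>_G j)
      \<comment> \<open>A decision at time \<open>l\<close> uses process noises strictly before
        \<open>l\<close>, and \<open>l \<le> k\<close>. This is where admissibility keeps the noise
        of time k out of the success indicators.\<close>
      show "(j, p) \<noteq> (i, Wn k)" if "p \<in> prims_upto l" for p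
        using that l by (auto simp: prims_upto_def)
    qed
    from measurable_compose[OF measurable_compose[OF this g(1)], of "\<lambda>x. x" "count_space UNIV"]
    have "(\<lambda>\<omega>. g (\<lambda>p\<in>prims_upto l. \<xi> j p \<omega>)) \<in> measurable (G k) (count_space UNIV)" by simp
    then show ?thesis
      by (rule measurable_cong[THEN iffD2, rotated]) (use g(2) in \<open>simp add: G_def\<close>)
  qed
  have noise': "centered_gaussian M (nx (S i)) (mW (S i)) (\<xi> i (Wn k))" for k
    using noise by (simp add: noise_ok_def)
  note W = centered_gaussian_moments[OF noise' pos_def_imp_pos_semidef[OF subsystem_okD(4)[OF s]]]
  show ?thesis
  proof unfold_locales
    show "subsystem_ok (S i)" "pos_def (nx (S i)) P" "control_riccati (S i) P" by fact+
    show "filter_gain (S i) \<Theta> \<in> carrier_mat (nx (S i)) (ny (S i))" by (rule filter_gain_carrier[OF s \<Theta>])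
    show "\<xi> i p \<in> measurable M (vec_borel (prim_dim (S i) p))" for p by (rule \<xi>_M)
    show "subalgebra M (G k)" for k
      unfolding subalgebra_def G_def using sets_image_in_sets[OF refl tuple[of k]] by simp
    show "\<xi> i X0 \<in> measurable (G k) (vec_borel (nx (S i)))" for k
      using \<xi>_G[of i X0 k] i by simp
    show "\<xi> i (Wn l) \<in> measurable (G k) (vec_borel (nx (S i)))" if "l < k" for l k
      using \<xi>_G[of i "Wn l" k] i that by simp
    show "\<xi> i (Vn l) \<in> measurable (G k) (vec_borel (ny (S i)))" for l k
      using \<xi>_G[of i "Vn l" k] i by simp
    show "success m \<delta> i l \<in> measurable (G k) (count_space UNIV)" if l: "l \<le> k" for l k
      unfolding success_def[abs_def] available_def
    proof (rule measurable_countable_op[where h = "(*)"])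
      show "(\<lambda>\<omega>. \<Prod>j\<in>{1..m} - {i}. 1 - \<delta> j l \<omega>) \<in> measurable (G k) (count_space UNIV)"
      proof (rule measurable_nat_prod)
        fix j assume "j \<in> {1..m} - {i}"
        then show "(\<lambda>\<omega>. 1 - \<delta> j l \<omega>) \<in> measurable (G k) (count_space UNIV)"
          using l by (intro measurable_compose[OF \<delta>_G, where g = "\<lambda>d. 1 - d"]) simp_all
      qed
      show "\<delta> i l \<in> measurable (G k) (count_space UNIV)" by (rule \<delta>_G[OF i l])
    qed
    show "square_integrable M (nx (S i)) (\<xi> i X0)"
      using init centered_gaussian_moments(1) unfolding initial_state_ok_def by blast
    show "square_integrable M (nx (S i)) (\<xi> i (Wn k))" for k by (rule W(1))
    show "(\<integral>\<omega>. (\<xi> i (Wn k) \<omega> $ j)\<^sup>2 \<partial>M) = unit_vec (nx (S i)) j \<bullet> (mW (S i) *\<^sub>v unit_vec (nx (S i)) j)"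
      if "j < nx (S i)" for j k
      using that by (rule W(3))
    fix j k and Y :: "'w \<Rightarrow> real"
    assume j: "j < nx (S i)" and Y: "Y \<in> borel_measurable (G k)" "integrable M Y"
    have q: "(i, Wn k) \<in> I" using i by (simp add: I_def)
    have h: "(\<lambda>x. x $ j) \<in> borel_measurable (N (i, Wn k))"
      using measurable_vec_borelD(2)[OF measurable_ident j] by (simp add: N_def)
    have X_eq: "X (i, Wn k) = \<xi> i (Wn k)" by (simp add: X_def)
    have "(\<integral>\<omega>. X (i, Wn k) \<omega> $ j * Y \<omega> \<partial>M) = (\<integral>\<omega>. X (i, Wn k) \<omega> $ j \<partial>M) * (\<integral>\<omega>. Y \<omega> \<partial>M)"
      by (rule indep_vars_integral_mult[OF ind q h Y(1)[unfolded G_def] _ Y(2)])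
        (use square_integrable_index[OF finite_measure_axioms W(1) j] in \<open>simp add: X_eq\<close>)
    then show "(\<integral>\<omega>. \<xi> i (Wn k) \<omega> $ j * Y \<omega> \<partial>M) = 0"
      using W(2)[OF j, of k] by (simp add: X_eq)
  qed
qed

text \<open>The feedback law is a fixed point condition, satisfied almost surely. Existence of a
  policy obeying it is therefore stated along with the optimality of all such policies, which could
  otherwise hold vacuously.\<close>

theorem theorem1:
  fixes M :: "'w measure"
    and m :: nat
    and S :: "nat \<Rightarrow> subsystem"
    and P \<Theta> :: "nat \<Rightarrow> real mat"
    and \<xi> :: "nat \<Rightarrow> primitive \<Rightarrow> 'w \<Rightarrow> real vec"
    and \<delta> :: "nat \<Rightarrow> nat \<Rightarrow> 'w \<Rightarrow> nat"
  assumes "prob_space M"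
    and "\<And>i. i \<in> {1..m} \<Longrightarrow> subsystem_ok (S i)"
    and "\<And>i. i \<in> {1..m} \<Longrightarrow> pos_def (nx (S i)) (P i) \<and> control_riccati (S i) (P i)"
    and "\<And>i. i \<in> {1..m} \<Longrightarrow> pos_semidef (nx (S i)) (\<Theta> i) \<and> filter_riccati (S i) (\<Theta> i)"
    and "primitives_indep M m S \<xi>"
    and "\<And>i. i \<in> {1..m} \<Longrightarrow> noise_ok M (S i) (\<xi> i)"
    and "\<And>i. i \<in> {1..m} \<Longrightarrow> initial_state_ok M (S i) (\<Theta> i) (\<xi> i)"
    and "\<And>i. i \<in> {1..m} \<Longrightarrow> admissible_scheduler M (S i) (\<xi> i) (\<delta> i)"
  shows "\<forall>i\<in>{1..m}.
    (\<exists>\<gamma>\<in>policies (S i).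
        certainty_equivalent M (S i) (filter_gain (S i) (\<Theta> i)) (\<xi> i) (success m \<delta> i)
          (control_gain (S i) (P i)) \<gamma>) \<and>
    (\<forall>\<gamma>\<in>policies (S i).
        certainty_equivalent M (S i) (filter_gain (S i) (\<Theta> i)) (\<xi> i) (success m \<delta> i)
          (control_gain (S i) (P i)) \<gamma> \<longrightarrow>
        optimal_policy M (S i) (filter_gain (S i) (\<Theta> i)) (\<xi> i) (success m \<delta> i) \<gamma>)"
proof (intro ballI conjI impI)
  fix i assume i: "i \<in> {1..m}"
  note loop = lqg_loop_of_network[of M i m S "P i" "\<Theta> i" \<xi> \<delta>, OF assms(1) i assms(2)[OF i]
      conjunct1[OF assms(3)[OF i]] conjunct2[OF assms(3)[OF i]] conjunct1[OF assms(4)[OF i]]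
      assms(5) assms(6)[OF i] assms(7)[OF i] assms(8)]
  show "\<exists>\<gamma>\<in>policies (S i).
      certainty_equivalent M (S i) (filter_gain (S i) (\<Theta> i)) (\<xi> i) (success m \<delta> i)
        (control_gain (S i) (P i)) \<gamma>"
    by (rule lqg_loop.certainty_equivalent_exists[OF loop])
  fix \<gamma>
  assume "\<gamma> \<in> policies (S i)"
    "certainty_equivalent M (S i) (filter_gain (S i) (\<Theta> i)) (\<xi> i) (success m \<delta> i)
      (control_gain (S i) (P i)) \<gamma>"
  then show "optimal_policy M (S i) (filter_gain (S i) (\<Theta> i)) (\<xi> i) (success m \<delta> i) \<gamma>"
    by (intro lqg_loop.certainty_equivalent_optimal[OF loop])
qed

end
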